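(* Let $\mathcal D$ be a $B$-Hessian discretisation and $\mathcal M$ be a mesh of $\Omega$ (as in the context). Let $(\overline y,\overline p,\overline u)$ and $(\overline y_{\mathcal D},\overline p_{\mathcal D},\overline u_h)$ be the solutions of the continuous and the discrete KKT systems. Assume that - $\mathcal U_{ad}=\{u\in L^2(\omega): a\le u(x)\le b \text{ for a.e. } x\in\omega\}$ and $\mathcal U_h$ is the space of functions that are constant on each cell $K\in\mathcal M$; - the assumptions (A1)–(A4) listed in the context hold; - $\overline y$ and $\overline p$ belong to $H^4(\Omega)$, and $\overline u_d$ belongs to $H^2(\Omega)$. Define the post-processed controls $$\widetilde u(x)=P_{[a,b]}\Big(\mathcal P_{\mathcal M}\overline u_d(x)-\frac{\chi_\omega(x)}{\alpha}\,\overline p_{\mathcal M}(x)\Big),\qquad \widetilde u_h(x)=P_{[a,b]}\Big(\mathcal P_{\mathcal M}\overline u_d(x)-\frac{\chi_\omega(x)}{\alpha}\,\Pi_{\mathcal D}\overline p_{\mathcal D}(x)\Big),$$ where $\overline p_{\mathcal M}$ is the function $w_{\mathcal M}$ associated by (A1) with $w=\overline p$. Then there exist $C$ depending only on $\alpha$, and $C'$ depending only on $\Omega$, $B$, $\varrho$, an upper bound of $C^B_{\mathcal D}$ and $\eta$ (and on the constant $c_0$ of (A1)–(A4)), such that $$\|\widetilde u-\widetilde u_h\|\le C'C\,h^2\Big(\|\overline u\|_{W^{1,\infty}(\mathcal M_1)}+\mathcal F(a,b,\overline y_d,\overline u_d,f,\overline y,\overline p)\Big),$$ where $$\mathcal F(a,b,\overline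 y_d,\overline u_d,f,\overline y,\overline p)=\mathrm{minmod}(a,b)+\|\overline y_d\|+\|\overline u_d\|_{H^2(\Omega)}+\|f\|+\|\overline y\|_{H^4(\Omega)}+\|\overline p\|_{H^4(\Omega)},$$ with $\mathrm{minmod}(a,b)=0$ if $ab\le0$ and $\mathrm{minmod}(a,b)=\min(|a|,|b|)$ otherwise.
   Context: **Setting.** $\Omega\subset\mathbb R^d$ ($d\ge1$) is a bounded polytopal domain, $\mathcal S_d(\mathbb R)$ is the set of symmetric $d\times d$ matrices, $\xi:\phi=\sum_{i,j}\xi_{ij}\phi_{ij}$, $\mathcal H$ is the Hessian matrix. $(\cdot,\cdot)$ and $\|\cdot\|$ are the $L^2$ inner product and norm on $\Omega$ (scalar, vector or matrix valued functions). $B$ is a fourth-order tensor, constant over $\Omega$, acting linearly on matrices and mapping $\mathcal S_d(\mathbb R)$ to itself. Put $\mathcal H^B w=B\mathcal H w$. The coefficients $a_{ijkl}$ (with $a_{ijkl}=a_{jikl}=a_{ijlk}=a_{klij}$) are such that $a(z,w):=\sum_{i,j,k,l}\int_\Omega a_{ijkl}\,\partial_{ij}z\,\partial_{kl}w\,dx=\int_\Omega\mathcal H^Bz:\mathcal H^Bw\,dx$ for $z,w\in H^2_0(\Omega)$. Coercivity is assumed: there is $\varrho>0$ with $\|\mathcal H^Bw\|\ge\varrho\|w\|_{H^2(\Omega)}$ for all $w\in H^2_0(\Omega)$. **Mesh.** $\mathcal M$ is a finite family of non-empty connected polytopal open disjoint subsets (cells) of $\Omega$ with $\overline\Omega=\bigcup_{K\in\mathcal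 M}\overline K$ (a polytopal mesh: boundaries of cells are unions of closed flat faces, each face being either on $\partial\Omega$ and belonging to exactly one cell, or inside $\Omega$ and shared by exactly two cells); each cell $K$ is star-shaped with respect to its centroid $\overline x_K$. $h=\max_{K}\mathrm{diam}(K)$. With $\rho_K$ the maximal radius of a ball centred at $\overline x_K$ and included in $K$, regularity is assumed: $\mathrm{diam}(K)/\rho_K\le\eta$ for all $K\in\mathcal M$, for some $\eta>0$. $\omega\subset\Omega$ is a polygonal/polyhedral domain such that the cells of $\mathcal M$ contained in $\omega$ form a mesh of $\omega$. $\mathcal P_{\mathcal M}$ is the projection on piecewise constant functions: $(\mathcal P_{\mathcal M}v)_{|K}=\frac1{|K|}\int_Kv\,dx$ for $v\in L^1(\Omega)$, $K\in\mathcal M$. **Control problem.** $f,\overline y_d\in L^2(\Omega)$, $\alpha>0$, $a\le b$ are real constants, $P_{[a,b]}(s)=\min\{b,\max\{a,s\}\}$. The desired control is (the restriction to $\omega$ of) $\overline u_d$. $\mathcal C:L^2(\omega)\to L^2(\Omega)$ is extension by zero, $\mathcal Cu=u\chi_\omega$; its adjoint $\mathcal C^*$ is restriction to $\omega$. The continuous KKT system is: find $(\overline y,\overline p,\overline u)\in H^2_0(\Omega)\times H^2_0(\Omega)\times\mathcal U_{ad}$ such that - $a(\overline y,w)=(f+\mathcal C\overline u,w)$ for all $w\in H^2_0(\Omega)$; - $a(w,\overline p)=(\overline y-\overline y_d,w)$ for all $w\in H^2_0(\Omega)$; - $(\mathcal C^*\overline p+\alpha(\overline u-\overline u_d),v-\overline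 u)_{L^2(\omega)}\ge0$ for all $v\in\mathcal U_{ad}$. **Hessian discretisation.** A $B$-Hessian discretisation is a quadruplet $\mathcal D=(X_{\mathcal D,0},\Pi_{\mathcal D},\nabla_{\mathcal D},\mathcal H^B_{\mathcal D})$ where $X_{\mathcal D,0}$ is a finite-dimensional real vector space and $\Pi_{\mathcal D}:X_{\mathcal D,0}\to L^2(\Omega)$, $\nabla_{\mathcal D}:X_{\mathcal D,0}\to L^2(\Omega)^d$, $\mathcal H^B_{\mathcal D}:X_{\mathcal D,0}\to L^2(\Omega;\mathcal S_d(\mathbb R))$ are linear, such that $\|\mathcal H^B_{\mathcal D}\cdot\|$ is a norm on $X_{\mathcal D,0}$. Put $a_{\mathcal D}(v,w)=\int_\Omega\mathcal H^B_{\mathcal D}v:\mathcal H^B_{\mathcal D}w\,dx$ and $$C^B_{\mathcal D}=\max_{w\in X_{\mathcal D,0}\setminus\{0\}}\max\Big(\frac{\|\Pi_{\mathcal D}w\|}{\|\mathcal H^B_{\mathcal D}w\|},\frac{\|\nabla_{\mathcal D}w\|}{\|\mathcal H^B_{\mathcal D}w\|}\Big).$$ The Hessian scheme for the equation with source $g\in L^2(\Omega)$ and clamped boundary conditions is: find $w_{\mathcal D}\in X_{\mathcal D,0}$ with $a_{\mathcal D}(w_{\mathcal D},v_{\mathcal D})=(g,\Pi_{\mathcal D}v_{\mathcal D})$ for all $v_{\mathcal D}\in X_{\mathcal D,0}$. **Discrete KKT system.** $\mathcal U_{ad,h}=\mathcal U_{ad}\cap\mathcal U_h$ (elements of $\mathcal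 U_h$ being restricted to $\omega$). Find $(\overline y_{\mathcal D},\overline p_{\mathcal D},\overline u_h)\in X_{\mathcal D,0}\times X_{\mathcal D,0}\times\mathcal U_{ad,h}$ such that - $a_{\mathcal D}(\overline y_{\mathcal D},w_{\mathcal D})=(f+\mathcal C\overline u_h,\Pi_{\mathcal D}w_{\mathcal D})$ for all $w_{\mathcal D}\in X_{\mathcal D,0}$; - $a_{\mathcal D}(w_{\mathcal D},\overline p_{\mathcal D})=(\Pi_{\mathcal D}\overline y_{\mathcal D}-\overline y_d,\Pi_{\mathcal D}w_{\mathcal D})$ for all $w_{\mathcal D}\in X_{\mathcal D,0}$; - $(\mathcal C^*\Pi_{\mathcal D}\overline p_{\mathcal D}+\alpha(\overline u_h-\overline u_d),v_h-\overline u_h)_{L^2(\omega)}\ge0$ for all $v_h\in\mathcal U_{ad,h}$. **Assumptions (A1)–(A4).** There is a constant $c_0>0$, depending only on $\Omega$, $\varrho$ and an upper bound of $C^B_{\mathcal D}$, such that: (A1) For each $w\in H^2(\Omega)$ there exists $w_{\mathcal M}\in L^2(\Omega)$ such that: (i) if $w\in H^4(\Omega)\cap H^2_0(\Omega)$ solves $\sum_{i,j,k,l}\partial_{kl}(a_{ijkl}\partial_{ij}w)=g\in L^2(\Omega)$ and $w_{\mathcal D}$ is the solution of the corresponding Hessian scheme, then $\|\Pi_{\mathcal D}w_{\mathcal D}-w_{\mathcal M}\|\le c_0h^2\|g\|$; (ii) for any $w\in H^2(\Omega)$: $|(w-w_{\mathcal M},\Pi_{\mathcal D}v_{\mathcal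 D})|\le c_0h^2\|\Pi_{\mathcal D}v_{\mathcal D}\|\,\|w\|_{H^2(\Omega)}$ for all $v_{\mathcal D}\in X_{\mathcal D,0}$, and $\|\mathcal P_{\mathcal M}(w-w_{\mathcal M})\|\le c_0h^2\|w\|_{H^2(\Omega)}$. (A2) $\|\Pi_{\mathcal D}v_{\mathcal D}-\mathcal P_{\mathcal M}(\Pi_{\mathcal D}v_{\mathcal D})\|\le c_0h\|\mathcal H^B_{\mathcal D}v_{\mathcal D}\|$ for all $v_{\mathcal D}\in X_{\mathcal D,0}$. (A3) $\|\Pi_{\mathcal D}v_{\mathcal D}\|_{L^\infty(\Omega)}\le c_0\|\mathcal H^B_{\mathcal D}v_{\mathcal D}\|$ for all $v_{\mathcal D}\in X_{\mathcal D,0}$. (A4) Let $\mathcal M_2$ be the set of cells $K$ (of the mesh of $\omega$) such that $\overline u=a$ a.e. on $K$, or $\overline u=b$ a.e. on $K$, or $a<\overline u<b$ a.e. on $K$; let $\mathcal M_1$ be the set of remaining cells (of the mesh of $\omega$), and $\Omega_{1,\mathcal M}=\mathrm{int}(\bigcup_{K\in\mathcal M_1}\overline K)$. Then $|\Omega_{1,\mathcal M}|\le c_0h$ (Lebesgue measure) and $\overline u_{|\Omega_{1,\mathcal M}}\in W^{1,\infty}(\mathcal M_1)$, the broken Sobolev space of functions that are $W^{1,\infty}$ on each $K\in\mathcal M_1$, with its broken norm $\|\cdot\|_{W^{1,\infty}(\mathcal M_1)}$. *)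

theory Defs
  imports "HOL-Analysis.Analysis"
begin

text \<open>Elements of Lebesgue and Sobolev spaces are represented by functions on the whole
  ambient space; only their values almost everywhere on the domain matter.\<close>

definition L2 :: "'a::euclidean_space set \<Rightarrow> ('a \<Rightarrow> 'b::euclidean_space) set" where
  "L2 \<Omega> = {f. f \<in> borel_measurable (lebesgue_on \<Omega>) \<and>
              integrable (lebesgue_on \<Omega>) (\<lambda>x. (norm (f x))\<^sup>2)}"

definition L2_inner ::
    "'a::euclidean_space set \<Rightarrow> ('a \<Rightarrow> 'b::euclidean_space) \<Rightarrow> ('a \<Rightarrow> 'b) \<Rightarrow> real" where
  "L2_inner \<Omega> f g = (LINT x|lebesgue_on \<Omega>. f x \<bullet> g x)"

text \<open>On matrices (type \<open>real^'d^'d\<close>), \<open>\<bullet>\<close> is the Frobenius product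
  \<open>\<Sum>i j. \<xi>$i$j * \<phi>$i$j\<close>.\<close>

definition L2_norm :: "'a::euclidean_space set \<Rightarrow> ('a \<Rightarrow> 'b::euclidean_space) \<Rightarrow> real" where
  "L2_norm \<Omega> f = sqrt (LINT x|lebesgue_on \<Omega>. (norm (f x))\<^sup>2)"

definition Linf :: "'a::euclidean_space set \<Rightarrow> ('a \<Rightarrow> real) set" where
  "Linf \<Omega> = {f. f \<in> borel_measurable (lebesgue_on \<Omega>) \<and>
                (\<exists>M. AE x in lebesgue_on \<Omega>. \<bar>f x\<bar> \<le> M)}"

definition Linf_norm :: "'a::euclidean_space set \<Rightarrow> ('a \<Rightarrow> real) \<Rightarrow> real" where
  "Linf_norm \<Omega> f = Inf {M. 0 \<le> M \<and> (AE x in lebesgue_on \<Omega>. \<bar>f x\<bar> \<le> M)}"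

definition partial :: "'d::finite \<Rightarrow> (real^'d \<Rightarrow> real) \<Rightarrow> real^'d \<Rightarrow> real" where
  "partial i f x = frechet_derivative f (at x) (axis i 1)"

fun partials :: "'d::finite list \<Rightarrow> (real^'d \<Rightarrow> real) \<Rightarrow> real^'d \<Rightarrow> real" where
  "partials [] f = f"
| "partials (i # js) f = partial i (partials js f)"

definition test_functions :: "(real^'d::finite) set \<Rightarrow> (real^'d \<Rightarrow> real) set" where
  "test_functions \<Omega> = {\<phi>. (\<forall>js x. partials js \<phi> differentiable (at x)) \<and>
     compact (closure {x. \<phi> x \<noteq> 0}) \<and> closure {x. \<phi> x \<noteq> 0} \<subseteq> \<Omega>}"

definition locally_integrable :: "(real^'d::finite) set \<Rightarrow> (real^'d \<Rightarrow> real) \<Rightarrow> bool" where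
  "locally_integrable \<Omega> u \<longleftrightarrow> (\<forall>S. compact S \<and> S \<subseteq> \<Omega> \<longrightarrow> integrable (lebesgue_on S) u)"

text \<open>\<open>v\<close> is the weak derivative \<open>\<partial>\<^bsub>js\<^esub> u\<close>, where a derivative of order \<open>k\<close> is indexed
  by the list of its \<open>k\<close> directions rather than by a multi-index.\<close>

definition is_weak_deriv ::
    "(real^'d::finite) set \<Rightarrow> 'd list \<Rightarrow> (real^'d \<Rightarrow> real) \<Rightarrow> (real^'d \<Rightarrow> real) \<Rightarrow> bool" where
  "is_weak_deriv \<Omega> js u v \<longleftrightarrow> locally_integrable \<Omega> u \<and> locally_integrable \<Omega> v \<and>
     (\<forall>\<phi>\<in>test_functions \<Omega>.
        (LINT x|lebesgue_on \<Omega>. u x * partials js \<phi> x)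
          = (- 1) ^ length js * (LINT x|lebesgue_on \<Omega>. v x * \<phi> x))"

definition weak_deriv ::
    "(real^'d::finite) set \<Rightarrow> 'd list \<Rightarrow> (real^'d \<Rightarrow> real) \<Rightarrow> real^'d \<Rightarrow> real" where
  "weak_deriv \<Omega> js u = (SOME v. is_weak_deriv \<Omega> js u v)"

definition Hk :: "nat \<Rightarrow> (real^'d::finite) set \<Rightarrow> (real^'d \<Rightarrow> real) set" where
  "Hk k \<Omega> = {u \<in> L2 \<Omega>. \<forall>js. length js \<le> k \<longrightarrow> (\<exists>v\<in>L2 \<Omega>. is_weak_deriv \<Omega> js u v)}"

text \<open>Summing over lists of directions amounts to \<open>\<parallel>u\<parallel>\<^sup>2 + \<parallel>\<nabla>u\<parallel>\<^sup>2 + \<parallel>\<H>u\<parallel>\<^sup>2 + \<dots>\<close> with the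
  Euclidean/Frobenius norms of the derivative tensors.\<close>

definition Hk_norm :: "nat \<Rightarrow> (real^'d::finite) set \<Rightarrow> (real^'d \<Rightarrow> real) \<Rightarrow> real" where
  "Hk_norm k \<Omega> u = sqrt (\<Sum>js\<in>{js. length js \<le> k}. (L2_norm \<Omega> (weak_deriv \<Omega> js u))\<^sup>2)"

definition H20 :: "(real^'d::finite) set \<Rightarrow> (real^'d \<Rightarrow> real) set" where
  "H20 \<Omega> = {u \<in> Hk 2 \<Omega>. \<forall>\<epsilon>>0. \<exists>\<phi>\<in>test_functions \<Omega>. Hk_norm 2 \<Omega> (\<lambda>x. u x - \<phi> x) < \<epsilon>}"

definition hessian :: "(real^'d::finite) set \<Rightarrow> (real^'d \<Rightarrow> real) \<Rightarrow> real^'d \<Rightarrow> real^'d^'d" where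
  "hessian \<Omega> w x = (\<chi> i j. weak_deriv \<Omega> [i, j] w x)"

definition W1inf :: "(real^'d::finite) set \<Rightarrow> (real^'d \<Rightarrow> real) set" where
  "W1inf \<Omega> = {u \<in> Linf \<Omega>. \<forall>js. length js \<le> 1 \<longrightarrow> (\<exists>v\<in>Linf \<Omega>. is_weak_deriv \<Omega> js u v)}"

definition W1inf_norm :: "(real^'d::finite) set \<Rightarrow> (real^'d \<Rightarrow> real) \<Rightarrow> real" where
  "W1inf_norm \<Omega> u = Max ((\<lambda>js. Linf_norm \<Omega> (weak_deriv \<Omega> js u)) ` {js. length js \<le> 1})"

definition broken_W1inf :: "(real^'d::finite) set set \<Rightarrow> (real^'d \<Rightarrow> real) set" where
  "broken_W1inf \<K> = {u. \<forall>K\<in>\<K>. u \<in> W1inf K}"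

text \<open>The value \<open>0\<close> is only there for the empty family of cells.\<close>

definition broken_W1inf_norm :: "(real^'d::finite) set set \<Rightarrow> (real^'d \<Rightarrow> real) \<Rightarrow> real" where
  "broken_W1inf_norm \<K> u = Max (insert 0 ((\<lambda>K. W1inf_norm K u) ` \<K>))"

definition polytopal_domain :: "'a::euclidean_space set \<Rightarrow> bool" where
  "polytopal_domain \<Omega> \<longleftrightarrow> open \<Omega> \<and> connected \<Omega> \<and> \<Omega> \<noteq> {} \<and> bounded \<Omega> \<and>
     (\<exists>\<F>. finite \<F> \<and> (\<forall>\<sigma>\<in>\<F>. polytope \<sigma> \<and> aff_dim \<sigma> = int DIM('a) - 1) \<and> frontier \<Omega> = \<Union>\<F>)"

definition centroid :: "'a::euclidean_space set \<Rightarrow> 'a" where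
  "centroid K = (1 / measure lebesgue K) *\<^sub>R (LINT x|lebesgue_on K. x)"

text \<open>\<open>\<F>\<close> is the set of closed faces. Taking them convex is no restriction, since a flat
  polytopal face can be subdivided. A closed face may meet \<open>\<partial>\<Omega>\<close> at its relative boundary
  even if it lies inside \<open>\<Omega>\<close>, hence the relative interior below.\<close>

definition polytopal_mesh :: "'a::euclidean_space set \<Rightarrow> 'a set set \<Rightarrow> bool" where
  "polytopal_mesh \<Omega> \<M> \<longleftrightarrow>
     finite \<M> \<and> (\<forall>K\<in>\<M>. polytopal_domain K \<and> K \<subseteq> \<Omega>) \<and> pairwise disjnt \<M> \<and>
     closure \<Omega> = (\<Union>K\<in>\<M>. closure K) \<and>
     (\<exists>\<F>. finite \<F> \<and> (\<forall>\<sigma>\<in>\<F>. polytope \<sigma> \<and> aff_dim \<sigma> = int DIM('a) - 1) \<and>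
        pairwise (\<lambda>\<sigma> \<tau>. disjnt (rel_interior \<sigma>) (rel_interior \<tau>)) \<F> \<and>
        (\<forall>K\<in>\<M>. frontier K = \<Union>{\<sigma>\<in>\<F>. \<sigma> \<subseteq> frontier K}) \<and>
        (\<forall>\<sigma>\<in>\<F>. (\<sigma> \<subseteq> frontier \<Omega> \<and> card {K\<in>\<M>. \<sigma> \<subseteq> frontier K} = 1) \<or>
               (rel_interior \<sigma> \<subseteq> \<Omega> \<and> card {K\<in>\<M>. \<sigma> \<subseteq> frontier K} = 2))) \<and>
     (\<forall>K\<in>\<M>. \<forall>x\<in>K. closed_segment (centroid K) x \<subseteq> K)"

definition mesh_size :: "'a::euclidean_space set set \<Rightarrow> real" where
  "mesh_size \<M> = Max (diameter ` \<M>)"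

definition inradius :: "'a::euclidean_space set \<Rightarrow> real" where
  "inradius K = Sup {r. 0 \<le> r \<and> ball (centroid K) r \<subseteq> K}"

definition mesh_regular :: "'a::euclidean_space set set \<Rightarrow> real \<Rightarrow> bool" where
  "mesh_regular \<M> \<eta> \<longleftrightarrow> (\<forall>K\<in>\<M>. diameter K / inradius K \<le> \<eta>)"

definition cells_in :: "'a set set \<Rightarrow> 'a set \<Rightarrow> 'a set set" where
  "cells_in \<M> \<omega> = {K\<in>\<M>. K \<subseteq> \<omega>}"

definition mesh_proj ::
    "'a::euclidean_space set set \<Rightarrow> ('a \<Rightarrow> real) \<Rightarrow> 'a \<Rightarrow> real" where
  "mesh_proj \<M> v x =
     (\<Sum>K\<in>\<M>. indicator K x * ((1 / measure lebesgue K) * (LINT y|lebesgue_on K. v y)))"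

definition symmetric_matrix :: "real^'d^'d::finite \<Rightarrow> bool" where
  "symmetric_matrix A \<longleftrightarrow> transpose A = A"

definition hessianB ::
    "(real^'d^'d \<Rightarrow> real^'d^'d) \<Rightarrow> (real^'d::finite) set \<Rightarrow> (real^'d \<Rightarrow> real) \<Rightarrow> real^'d \<Rightarrow> real^'d^'d"
  where "hessianB B \<Omega> w x = B (hessian \<Omega> w x)"

definition coercive :: "(real^'d^'d \<Rightarrow> real^'d^'d) \<Rightarrow> (real^'d::finite) set \<Rightarrow> real \<Rightarrow> bool" where
  "coercive B \<Omega> \<rho> \<longleftrightarrow> (\<forall>w\<in>H20 \<Omega>. L2_norm \<Omega> (hessianB B \<Omega> w) \<ge> \<rho> * Hk_norm 2 \<Omega> w)"

type_synonym 'd coeffs = "'d \<Rightarrow> 'd \<Rightarrow> 'd \<Rightarrow> 'd \<Rightarrow> real^'d \<Rightarrow> real"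

definition aform ::
    "(real^'d::finite) set \<Rightarrow> 'd coeffs \<Rightarrow> (real^'d \<Rightarrow> real) \<Rightarrow> (real^'d \<Rightarrow> real) \<Rightarrow> real" where
  "aform \<Omega> A z w = (\<Sum>i\<in>UNIV. \<Sum>j\<in>UNIV. \<Sum>k\<in>UNIV. \<Sum>l\<in>UNIV.
     LINT x|lebesgue_on \<Omega>. A i j k l x * weak_deriv \<Omega> [i, j] z x * weak_deriv \<Omega> [k, l] w x)"

text \<open>The coefficients are bounded measurable functions, not necessarily constant.\<close>

definition admissible_coeffs ::
    "(real^'d::finite) set \<Rightarrow> (real^'d^'d \<Rightarrow> real^'d^'d) \<Rightarrow> 'd coeffs \<Rightarrow> bool" where
  "admissible_coeffs \<Omega> B A \<longleftrightarrow>
     (\<forall>i j k l. A i j k l \<in> Linf \<Omega>) \<and>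
     (\<forall>i j k l. \<forall>x\<in>\<Omega>. A i j k l x = A j i k l x \<and> A i j k l x = A i j l k x \<and>
                        A i j k l x = A k l i j x) \<and>
     (\<forall>z\<in>H20 \<Omega>. \<forall>w\<in>H20 \<Omega>. aform \<Omega> A z w = L2_inner \<Omega> (hessianB B \<Omega> z) (hessianB B \<Omega> w))"

text \<open>The equation \<open>\<Sum>i j k l. \<partial>\<^bsub>kl\<^esub>(a\<^bsub>ijkl\<^esub> \<partial>\<^bsub>ij\<^esub> w) = g\<close> in \<open>\<Omega>\<close>, in the sense of distributions.\<close>

definition solves_pde ::
    "(real^'d::finite) set \<Rightarrow> 'd coeffs \<Rightarrow> (real^'d \<Rightarrow> real) \<Rightarrow> (real^'d \<Rightarrow> real) \<Rightarrow> bool" where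
  "solves_pde \<Omega> A w g \<longleftrightarrow> (\<forall>\<phi>\<in>test_functions \<Omega>.
     (\<Sum>i\<in>UNIV. \<Sum>j\<in>UNIV. \<Sum>k\<in>UNIV. \<Sum>l\<in>UNIV.
        LINT x|lebesgue_on \<Omega>. A i j k l x * weak_deriv \<Omega> [i, j] w x * partials [k, l] \<phi> x)
      = (LINT x|lebesgue_on \<Omega>. g x * \<phi> x))"

definition ext_zero :: "'a set \<Rightarrow> ('a \<Rightarrow> real) \<Rightarrow> 'a \<Rightarrow> real" where
  "ext_zero \<omega> u x = u x * indicator \<omega> x"

definition U_ad :: "'a::euclidean_space set \<Rightarrow> real \<Rightarrow> real \<Rightarrow> ('a \<Rightarrow> real) set" where
  "U_ad \<omega> a b = {u \<in> L2 \<omega>. AE x in lebesgue_on \<omega>. a \<le> u x \<and> u x \<le> b}"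

text \<open>The adjoint of \<^const>\<open>ext_zero\<close> is restriction to \<open>\<omega>\<close>: it is built into integrating
  over \<open>\<omega>\<close> only.\<close>

definition continuous_KKT ::
    "(real^'d::finite) set \<Rightarrow> (real^'d) set \<Rightarrow> 'd coeffs \<Rightarrow> real \<Rightarrow> (real^'d \<Rightarrow> real) set \<Rightarrow>
     (real^'d \<Rightarrow> real) \<Rightarrow> (real^'d \<Rightarrow> real) \<Rightarrow> (real^'d \<Rightarrow> real) \<Rightarrow>
     (real^'d \<Rightarrow> real) \<Rightarrow> (real^'d \<Rightarrow> real) \<Rightarrow> (real^'d \<Rightarrow> real) \<Rightarrow> bool" where
  "continuous_KKT \<Omega> \<omega> A \<alpha> Uad f yd ud y p u \<longleftrightarrow>
     y \<in> H20 \<Omega> \<and> p \<in> H20 \<Omega> \<and> u \<in> Uad \<and>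
     (\<forall>w\<in>H20 \<Omega>. aform \<Omega> A y w = L2_inner \<Omega> (\<lambda>x. f x + ext_zero \<omega> u x) w) \<and>
     (\<forall>w\<in>H20 \<Omega>. aform \<Omega> A w p = L2_inner \<Omega> (\<lambda>x. y x - yd x) w) \<and>
     (\<forall>v\<in>Uad. L2_inner \<omega> (\<lambda>x. p x + \<alpha> * (u x - ud x)) (\<lambda>x. v x - u x) \<ge> 0)"

definition ae_linear_on ::
    "'x::real_vector set \<Rightarrow> 'a::euclidean_space set \<Rightarrow> ('x \<Rightarrow> 'a \<Rightarrow> 'b::real_vector) \<Rightarrow> bool" where
  "ae_linear_on X \<Omega> T \<longleftrightarrow>
     (\<forall>v\<in>X. \<forall>w\<in>X. AE x in lebesgue_on \<Omega>. T (v + w) x = T v x + T w x) \<and>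
     (\<forall>c. \<forall>v\<in>X. AE x in lebesgue_on \<Omega>. T (c *\<^sub>R v) x = c *\<^sub>R T v x)"

definition is_norm_on :: "'x::real_vector set \<Rightarrow> ('x \<Rightarrow> real) \<Rightarrow> bool" where
  "is_norm_on X N \<longleftrightarrow> (\<forall>v\<in>X. 0 \<le> N v \<and> (N v = 0 \<longleftrightarrow> v = 0)) \<and>
     (\<forall>v\<in>X. \<forall>w\<in>X. N (v + w) \<le> N v + N w) \<and> (\<forall>c. \<forall>v\<in>X. N (c *\<^sub>R v) = \<bar>c\<bar> * N v)"

text \<open>The discrete space is a finite-dimensional subspace \<open>X\<close> of an arbitrary real vector
  space, rather than a type of its own, so that estimates can be uniform in its dimension.\<close>

definition hessian_discretisation ::
    "(real^'d::finite) set \<Rightarrow> 'x::real_vector set \<Rightarrow> ('x \<Rightarrow> real^'d \<Rightarrow> real) \<Rightarrow>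
     ('x \<Rightarrow> real^'d \<Rightarrow> real^'d) \<Rightarrow> ('x \<Rightarrow> real^'d \<Rightarrow> real^'d^'d) \<Rightarrow> bool" where
  "hessian_discretisation \<Omega> X PiD GradD HD \<longleftrightarrow>
     subspace X \<and> (\<exists>S. finite S \<and> X = span S) \<and>
     (\<forall>v\<in>X. PiD v \<in> L2 \<Omega> \<and> GradD v \<in> L2 \<Omega> \<and> HD v \<in> L2 \<Omega> \<and>
            (AE x in lebesgue_on \<Omega>. symmetric_matrix (HD v x))) \<and>
     ae_linear_on X \<Omega> PiD \<and> ae_linear_on X \<Omega> GradD \<and> ae_linear_on X \<Omega> HD \<and>
     is_norm_on X (\<lambda>v. L2_norm \<Omega> (HD v))"

definition aD ::
    "(real^'d::finite) set \<Rightarrow> ('x \<Rightarrow> real^'d \<Rightarrow> real^'d^'d) \<Rightarrow> 'x \<Rightarrow> 'x \<Rightarrow> real" where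
  "aD \<Omega> HD v w = L2_inner \<Omega> (HD v) (HD w)"

text \<open>The value \<open>0\<close> is only there for the trivial space \<open>X = {0}\<close>.\<close>

definition CD ::
    "(real^'d::finite) set \<Rightarrow> 'x::real_vector set \<Rightarrow> ('x \<Rightarrow> real^'d \<Rightarrow> real) \<Rightarrow>
     ('x \<Rightarrow> real^'d \<Rightarrow> real^'d) \<Rightarrow> ('x \<Rightarrow> real^'d \<Rightarrow> real^'d^'d) \<Rightarrow> real" where
  "CD \<Omega> X PiD GradD HD = Sup (insert 0 ((\<lambda>w.
     max (L2_norm \<Omega> (PiD w) / L2_norm \<Omega> (HD w)) (L2_norm \<Omega> (GradD w) / L2_norm \<Omega> (HD w)))
       ` (X - {0})))"

definition hessian_scheme ::
    "(real^'d::finite) set \<Rightarrow> 'x::real_vector set \<Rightarrow> ('x \<Rightarrow> real^'d \<Rightarrow> real) \<Rightarrow>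
     ('x \<Rightarrow> real^'d \<Rightarrow> real^'d^'d) \<Rightarrow> (real^'d \<Rightarrow> real) \<Rightarrow> 'x \<Rightarrow> bool" where
  "hessian_scheme \<Omega> X PiD HD g wD \<longleftrightarrow>
     wD \<in> X \<and> (\<forall>v\<in>X. aD \<Omega> HD wD v = L2_inner \<Omega> g (PiD v))"

definition U_h :: "'a::euclidean_space set set \<Rightarrow> ('a \<Rightarrow> real) set" where
  "U_h \<M> = {v. \<forall>K\<in>\<M>. \<exists>c. AE x in lebesgue_on K. v x = c}"

definition U_ad_h ::
    "'a::euclidean_space set \<Rightarrow> ('a \<Rightarrow> real) set \<Rightarrow> ('a \<Rightarrow> real) set \<Rightarrow> ('a \<Rightarrow> real) set" where
  "U_ad_h \<omega> Uad Uh = {u \<in> Uad. \<exists>v\<in>Uh. AE x in lebesgue_on \<omega>. u x = v x}"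

definition discrete_KKT ::
    "(real^'d::finite) set \<Rightarrow> (real^'d) set \<Rightarrow> 'x::real_vector set \<Rightarrow> ('x \<Rightarrow> real^'d \<Rightarrow> real) \<Rightarrow>
     ('x \<Rightarrow> real^'d \<Rightarrow> real^'d^'d) \<Rightarrow> real \<Rightarrow> (real^'d \<Rightarrow> real) set \<Rightarrow>
     (real^'d \<Rightarrow> real) \<Rightarrow> (real^'d \<Rightarrow> real) \<Rightarrow> (real^'d \<Rightarrow> real) \<Rightarrow>
     'x \<Rightarrow> 'x \<Rightarrow> (real^'d \<Rightarrow> real) \<Rightarrow> bool" where
  "discrete_KKT \<Omega> \<omega> X PiD HD \<alpha> Uadh f yd ud yD pD uh \<longleftrightarrow>
     yD \<in> X \<and> pD \<in> X \<and> uh \<in> Uadh \<and>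
     (\<forall>w\<in>X. aD \<Omega> HD yD w = L2_inner \<Omega> (\<lambda>x. f x + ext_zero \<omega> uh x) (PiD w)) \<and>
     (\<forall>w\<in>X. aD \<Omega> HD w pD = L2_inner \<Omega> (\<lambda>x. PiD yD x - yd x) (PiD w)) \<and>
     (\<forall>v\<in>Uadh. L2_inner \<omega> (\<lambda>x. PiD pD x + \<alpha> * (uh x - ud x)) (\<lambda>x. v x - uh x) \<ge> 0)"

text \<open>\<open>wM w\<close> is the function \<open>w\<^sub>\<M>\<close> associated with \<open>w\<close>.\<close>

definition assumption_A1 ::
    "(real^'d::finite) set \<Rightarrow> 'd coeffs \<Rightarrow> (real^'d) set set \<Rightarrow> 'x::real_vector set \<Rightarrow>
     ('x \<Rightarrow> real^'d \<Rightarrow> real) \<Rightarrow> ('x \<Rightarrow> real^'d \<Rightarrow> real^'d^'d) \<Rightarrow> real \<Rightarrow>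
     ((real^'d \<Rightarrow> real) \<Rightarrow> real^'d \<Rightarrow> real) \<Rightarrow> bool" where
  "assumption_A1 \<Omega> A \<M> X PiD HD c0 wM \<longleftrightarrow>
     (\<forall>w\<in>Hk 2 \<Omega>. wM w \<in> L2 \<Omega>) \<and>
     (\<forall>w g wD. w \<in> Hk 4 \<Omega> \<inter> H20 \<Omega> \<and> g \<in> L2 \<Omega> \<and> solves_pde \<Omega> A w g \<and>
        hessian_scheme \<Omega> X PiD HD g wD \<longrightarrow>
        L2_norm \<Omega> (\<lambda>x. PiD wD x - wM w x) \<le> c0 * (mesh_size \<M>)\<^sup>2 * L2_norm \<Omega> g) \<and>
     (\<forall>w\<in>Hk 2 \<Omega>.
        (\<forall>v\<in>X. \<bar>L2_inner \<Omega> (\<lambda>x. w x - wM w x) (PiD v)\<bar>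
           \<le> c0 * (mesh_size \<M>)\<^sup>2 * L2_norm \<Omega> (PiD v) * Hk_norm 2 \<Omega> w) \<and>
        L2_norm \<Omega> (mesh_proj \<M> (\<lambda>x. w x - wM w x)) \<le> c0 * (mesh_size \<M>)\<^sup>2 * Hk_norm 2 \<Omega> w)"

definition assumption_A2 ::
    "(real^'d::finite) set \<Rightarrow> (real^'d) set set \<Rightarrow> 'x::real_vector set \<Rightarrow>
     ('x \<Rightarrow> real^'d \<Rightarrow> real) \<Rightarrow> ('x \<Rightarrow> real^'d \<Rightarrow> real^'d^'d) \<Rightarrow> real \<Rightarrow> bool" where
  "assumption_A2 \<Omega> \<M> X PiD HD c0 \<longleftrightarrow>
     (\<forall>v\<in>X. L2_norm \<Omega> (\<lambda>x. PiD v x - mesh_proj \<M> (PiD v) x)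
              \<le> c0 * mesh_size \<M> * L2_norm \<Omega> (HD v))"

definition assumption_A3 ::
    "(real^'d::finite) set \<Rightarrow> 'x::real_vector set \<Rightarrow>
     ('x \<Rightarrow> real^'d \<Rightarrow> real) \<Rightarrow> ('x \<Rightarrow> real^'d \<Rightarrow> real^'d^'d) \<Rightarrow> real \<Rightarrow> bool" where
  "assumption_A3 \<Omega> X PiD HD c0 \<longleftrightarrow>
     (\<forall>v\<in>X. PiD v \<in> Linf \<Omega> \<and> Linf_norm \<Omega> (PiD v) \<le> c0 * L2_norm \<Omega> (HD v))"

definition M2_cells ::
    "'a::euclidean_space set set \<Rightarrow> 'a set \<Rightarrow> real \<Rightarrow> real \<Rightarrow> ('a \<Rightarrow> real) \<Rightarrow> 'a set set" where
  "M2_cells \<M> \<omega> a b u = {K \<in> cells_in \<M> \<omega>.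
     (AE x in lebesgue_on K. u x = a) \<or> (AE x in lebesgue_on K. u x = b) \<or>
     (AE x in lebesgue_on K. a < u x \<and> u x < b)}"

definition M1_cells ::
    "'a::euclidean_space set set \<Rightarrow> 'a set \<Rightarrow> real \<Rightarrow> real \<Rightarrow> ('a \<Rightarrow> real) \<Rightarrow> 'a set set" where
  "M1_cells \<M> \<omega> a b u = cells_in \<M> \<omega> - M2_cells \<M> \<omega> a b u"

definition assumption_A4 ::
    "(real^'d::finite) set set \<Rightarrow> (real^'d) set \<Rightarrow> real \<Rightarrow> real \<Rightarrow> (real^'d \<Rightarrow> real) \<Rightarrow> real \<Rightarrow> bool"
  where
  "assumption_A4 \<M> \<omega> a b u c0 \<longleftrightarrow>
     measure lebesgue (interior (\<Union>K\<in>M1_cells \<M> \<omega> a b u. closure K)) \<le> c0 * mesh_size \<M> \<and>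
     u \<in> broken_W1inf (M1_cells \<M> \<omega> a b u)"

definition clip :: "real \<Rightarrow> real \<Rightarrow> real \<Rightarrow> real" where
  "clip a b s = min b (max a s)"

definition postprocess ::
    "'a::euclidean_space set set \<Rightarrow> 'a set \<Rightarrow> real \<Rightarrow> real \<Rightarrow> real \<Rightarrow>
     ('a \<Rightarrow> real) \<Rightarrow> ('a \<Rightarrow> real) \<Rightarrow> 'a \<Rightarrow> real" where
  "postprocess \<M> \<omega> \<alpha> a b ud q x =
     clip a b (mesh_proj \<M> ud x - indicator \<omega> x / \<alpha> * q x)"

definition minmod :: "real \<Rightarrow> real \<Rightarrow> real" where
  "minmod a b = (if a * b \<le> 0 then 0 else min \<bar>a\<bar> \<bar>b\<bar>)"

definition data_size ::
    "(real^'d::finite) set \<Rightarrow> real \<Rightarrow> real \<Rightarrow> (real^'d \<Rightarrow> real) \<Rightarrow> (real^'d \<Rightarrow> real) \<Rightarrow>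
     (real^'d \<Rightarrow> real) \<Rightarrow> (real^'d \<Rightarrow> real) \<Rightarrow> (real^'d \<Rightarrow> real) \<Rightarrow> real" where
  "data_size \<Omega> a b yd ud f y p = minmod a b + L2_norm \<Omega> yd + Hk_norm 2 \<Omega> ud +
     L2_norm \<Omega> f + Hk_norm 4 \<Omega> y + Hk_norm 4 \<Omega> p"

end

theory Submission
  imports Defs
begin

text \<open>By (A3), \<open>\<Pi>\<^sub>D\<close> is bounded by the discrete Hessian norm. Put
  \<open>g = u\<^sub>d - p/\<alpha>\<close>, so that \<open>u = P\<^bsub>[a,b]\<^esub> g\<close>, and compare with the cellwise constant control
  \<open>u\<^sub>c = P\<^bsub>[a,b]\<^esub> (P\<^sub>M g)\<close>. Being a pointwise projection, \<open>u\<^sub>c\<close> satisfies a variational inequality tested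
  with \<open>u\<^sub>h\<close>; added to the discrete one this bounds \<open>\<alpha> \<parallel>u\<^sub>h - u\<^sub>c\<parallel>\<^sup>2\<close> by \<open>(p - \<Pi>\<^sub>D p\<^sub>D, u\<^sub>h - u\<^sub>c)\<close>,
  where the mean values in (A1) enter because \<open>u\<^sub>h - u\<^sub>c\<close> is cellwise constant, and the
  contribution of the adjoints driven by \<open>u\<^sub>c\<close> and \<open>u\<^sub>h\<close> has a good sign.

  Replacing \<open>u\<close> by \<open>u\<^sub>c\<close> in the state equation costs \<open>(u - u\<^sub>c, \<Pi>\<^sub>D q)\<close> for a discrete adjoint \<open>q\<close>. On
  cells of \<open>M\<^sub>2\<close> the function \<open>u - u\<^sub>c\<close> has mean zero, hence (A2) and a Poincare inequality give \<open>h\<^sup>2\<close>; on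
  cells of \<open>M\<^sub>1\<close> one factor \<open>h\<close> is the oscillation of \<open>u\<close>, the other the measure of \<open>\<Omega>\<^sub>1\<close>.

  Both the Poincare inequality and the oscillation bound on a cell star-shaped with respect to its
  centroid come from one observation: the derivative in \<open>r\<close> of \<open>\<phi>\<^sub>r(z) = r\<^sup>d \<phi>(w + r (z - w))\<close> is a
  divergence, so \<open>g \<circ> T - g\<close>, for a contraction \<open>T\<close> towards \<open>w\<close>, is controlled by the weak gradient
  of \<open>g\<close>. This moves the cell into its inscribed ball, where all centres \<open>w\<close> are allowed.\<close>

section \<open>Square-integrable functions\<close>

text \<open>In general \<open>u\<close> is not cellwise constant, so it cannot be tested in the
  discrete inequality; \<open>uc\<close> can. It is built from means of \<open>g\<close>, not from
  point values, and so makes sense for L2 data in every dimension. The clipping is the obstacle: on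
  a cell of M_1 only \<open>u\<close>, not \<open>g\<close>, is known to be Lipschitz, and the
  passage from \<open>u\<close> to \<open>uc\<close> has to use that clipping is monotone.

  The cells need be neither convex nor uniformly Lipschitz, while the constants may depend on \<eta>
  and the dimension only. The gradient estimates therefore go by duality: the displacement of the
  argument of \<open>g\<close> is moved onto a test function, where the definition of a weak
  derivative applies at once and the domain enters only through being star-shaped.

  Constants: (A3) makes the reconstruction bounded with \<open>P\<close> = c0 sqrt |\<Omega>|. The
  three powers of 1 + 1 / \<alpha> come from the size of \<open>g\<close> and \<open>u\<close>, from
  dividing the variational inequality by \<alpha>, and from the factor 1 / \<alpha> in the
  post-processing.\<close>

lemma AE_lebesgue_on_iff:
  assumes "S \<in> sets lebesgue"
  shows "(AE x in lebesgue_on S. P x) \<longleftrightarrow> (AE x in lebesgue. x \<in> S \<longrightarrow> P x)"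
  using assms by (subst AE_restrict_space_iff) auto

lemma AE_lebesgue_on_subset:
  assumes "S \<in> sets lebesgue" "T \<in> sets lebesgue" "T \<subseteq> S" "AE x in lebesgue_on S. P x"
  shows "AE x in lebesgue_on T. P x"
  using assms by (auto simp: AE_lebesgue_on_iff elim!: eventually_mono)

lemma AE_in_lebesgue_on: "AE x in lebesgue_on S. x \<in> S"
  by (rule AE_I2) (simp add: space_restrict_space)

lemma borel_measurable_lebesgue_on_iff:
  fixes f :: "'a::euclidean_space \<Rightarrow> 'b::euclidean_space"
  assumes "S \<in> sets lebesgue"
  shows "f \<in> borel_measurable (lebesgue_on S) \<longleftrightarrow>
    (\<lambda>x. indicator S x *\<^sub>R f x) \<in> borel_measurable lebesgue"
  using assms by (subst borel_measurable_restrict_space_iff) auto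

lemma borel_measurable_lebesgue_on_cong_AE:
  fixes f g :: "'a::euclidean_space \<Rightarrow> 'b::euclidean_space"
  assumes S: "S \<in> sets lebesgue" and f: "f \<in> borel_measurable (lebesgue_on S)"
    and ae: "AE x in lebesgue_on S. f x = g x"
  shows "g \<in> borel_measurable (lebesgue_on S)"
proof -
  have "AE x in lebesgue. indicator S x *\<^sub>R f x = indicator S x *\<^sub>R g x"
    using ae unfolding AE_lebesgue_on_iff[OF S]
    by eventually_elim (auto simp: indicator_def)
  then show ?thesis
    using f unfolding borel_measurable_lebesgue_on_iff[OF S]
    by (rule borel_measurable_AE[rotated])
qed

text \<open>Completeness of Lebesgue measure transports measurability along an a.e. equality, so
  none is assumed. If integrability fails, it fails for both functions, and both integrals take the
  default value 0.\<close>

lemma lebesgue_on_cong_AE: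
  fixes f g :: "'a::euclidean_space \<Rightarrow> 'b::euclidean_space"
  assumes S: "S \<in> sets lebesgue" and ae: "AE x in lebesgue_on S. f x = g x"
  shows "f \<in> borel_measurable (lebesgue_on S) \<longleftrightarrow> g \<in> borel_measurable (lebesgue_on S)"
    and "integrable (lebesgue_on S) f \<longleftrightarrow> integrable (lebesgue_on S) g"
    and "integral\<^sup>L (lebesgue_on S) f = integral\<^sup>L (lebesgue_on S) g"
proof -
  have ae': "AE x in lebesgue_on S. g x = f x" using ae by eventually_elim auto
  show meas: "f \<in> borel_measurable (lebesgue_on S) \<longleftrightarrow> g \<in> borel_measurable (lebesgue_on S)"
    using borel_measurable_lebesgue_on_cong_AE[OF S] ae ae' by metis
  show int: "integrable (lebesgue_on S) f \<longleftrightarrow> integrable (lebesgue_on S) g"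
    using meas integrable_cong_AE[OF _ _ ae] borel_measurable_integrable by metis
  show "integral\<^sup>L (lebesgue_on S) f = integral\<^sup>L (lebesgue_on S) g"
    using meas integral_cong_AE[OF _ _ ae] int
    by (metis borel_measurable_integrable not_integrable_integral_eq)
qed

lemma integrable_lebesgue_on_subset:
  fixes f :: "'a::euclidean_space \<Rightarrow> 'b::euclidean_space"
  assumes "S \<in> sets lebesgue" "T \<in> sets lebesgue" "T \<subseteq> S" "integrable (lebesgue_on S) f"
  shows "integrable (lebesgue_on T) f"
proof -
  have "integrable lebesgue (\<lambda>x. indicator T x *\<^sub>R (indicator S x *\<^sub>R f x))"
    by (rule integrable_mult_indicator) (use assms in \<open>simp_all add: integrable_restrict_space\<close>)
  also have "(\<lambda>x. indicator T x *\<^sub>R (indicator S x *\<^sub>R f x)) = (\<lambda>x. indicator T x *\<^sub>R f x)"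
    using assms(3) by (auto simp: indicator_def fun_eq_iff)
  finally show ?thesis using assms by (simp add: integrable_restrict_space)
qed

lemma borel_measurable_lebesgue_on_subset:
  fixes f :: "'a::euclidean_space \<Rightarrow> 'b::euclidean_space"
  assumes "T \<subseteq> S" "f \<in> borel_measurable (lebesgue_on S)"
  shows "f \<in> borel_measurable (lebesgue_on T)"
  using assms by (rule measurable_restrict_mono[rotated])

section \<open>Closure properties, inner product and norm of L2\<close>

lemma L2_D:
  assumes "f \<in> L2 S"
  shows "f \<in> borel_measurable (lebesgue_on S)" "integrable (lebesgue_on S) (\<lambda>x. (norm (f x))\<^sup>2)"
  using assms by (auto simp: L2_def)

lemma L2_integrable_inner:
  assumes "f \<in> L2 S" "g \<in> L2 S"
  shows "integrable (lebesgue_on S) (\<lambda>x. f x \<bullet> g x)"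
proof (rule Bochner_Integration.integrable_bound)
  show "integrable (lebesgue_on S) (\<lambda>x. (norm (f x))\<^sup>2 + (norm (g x))\<^sup>2)"
    using assms by (auto dest: L2_D)
  show "(\<lambda>x. f x \<bullet> g x) \<in> borel_measurable (lebesgue_on S)"
    by (intro borel_measurable_inner L2_D(1) assms)
  have "\<bar>a \<bullet> b\<bar> \<le> (norm a)\<^sup>2 + (norm b)\<^sup>2" for a b :: 'b
  proof -
    have "\<bar>a \<bullet> b\<bar> \<le> norm a * norm b" by (rule Cauchy_Schwarz_ineq2)
    also have "\<dots> \<le> (norm a)\<^sup>2 + (norm b)\<^sup>2"
    proof -
      have "2 * (norm a * norm b) \<le> (norm a)\<^sup>2 + (norm b)\<^sup>2"
        using sum_squares_bound[of "norm a" "norm b"] by simp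
      moreover have "0 \<le> norm a * norm b" by simp
      ultimately show ?thesis by linarith
    qed
    finally show ?thesis .
  qed
  then show "AE x in lebesgue_on S. norm (f x \<bullet> g x) \<le> norm ((norm (f x))\<^sup>2 + (norm (g x))\<^sup>2)"
    by auto
qed

lemma L2_integrable_mult:
  fixes f g :: "'a::euclidean_space \<Rightarrow> real"
  assumes "f \<in> L2 S" "g \<in> L2 S"
  shows "integrable (lebesgue_on S) (\<lambda>x. f x * g x)"
  using L2_integrable_inner[OF assms] by simp

lemma L2_add:
  assumes "f \<in> L2 S" "g \<in> L2 S"
  shows "(\<lambda>x. f x + g x) \<in> L2 S"
proof -
  have "(\<lambda>x. (norm (f x + g x))\<^sup>2) = (\<lambda>x. (norm (f x))\<^sup>2 + 2 * (f x \<bullet> g x) + (norm (g x))\<^sup>2)"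
    by (simp add: power2_norm_eq_inner inner_add_left inner_add_right inner_commute fun_eq_iff)
  then show ?thesis
    using assms L2_integrable_inner[OF assms] by (auto simp: L2_def)
qed

lemma L2_scaleR:
  assumes "f \<in> L2 S"
  shows "(\<lambda>x. c *\<^sub>R f x) \<in> L2 S"
  using assms by (auto simp: L2_def power_mult_distrib)

lemma L2_mult:
  fixes f :: "'a::euclidean_space \<Rightarrow> real"
  assumes "f \<in> L2 S"
  shows "(\<lambda>x. c * f x) \<in> L2 S"
  using L2_scaleR[OF assms] by simp

lemma L2_diff:
  assumes "f \<in> L2 S" "g \<in> L2 S"
  shows "(\<lambda>x. f x - g x) \<in> L2 S"
  using L2_add[OF assms(1) L2_scaleR[OF assms(2), of "-1"]] by simp

lemma L2_zero: "(\<lambda>x. 0) \<in> L2 S"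
  by (auto simp: L2_def)

lemma L2_sum:
  assumes "\<And>i. i \<in> I \<Longrightarrow> f i \<in> L2 S"
  shows "(\<lambda>x. \<Sum>i\<in>I. f i x) \<in> L2 S"
  using assms
proof (induction I rule: infinite_finite_induct)
  case (insert i I)
  then show ?case using L2_add[of "f i" S "\<lambda>x. \<Sum>i\<in>I. f i x"] by simp
qed (auto simp: L2_zero)

lemma L2_cong_AE:
  assumes S: "S \<in> sets lebesgue" and ae: "AE x in lebesgue_on S. f x = g x"
  shows "f \<in> L2 S \<longleftrightarrow> g \<in> L2 S"
proof -
  have "AE x in lebesgue_on S. (norm (f x))\<^sup>2 = (norm (g x))\<^sup>2"
    using ae by eventually_elim auto
  then show ?thesis
    unfolding L2_def using lebesgue_on_cong_AE(1)[OF S ae]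
      lebesgue_on_cong_AE(2)[OF S, of "\<lambda>x. (norm (f x))\<^sup>2" "\<lambda>x. (norm (g x))\<^sup>2"] by simp
qed

lemma L2_bound:
  assumes g: "g \<in> L2 S" and f: "f \<in> borel_measurable (lebesgue_on S)"
    and le: "AE x in lebesgue_on S. norm (f x) \<le> norm (g x)"
  shows "f \<in> L2 S"
proof -
  have "integrable (lebesgue_on S) (\<lambda>x. (norm (f x))\<^sup>2)"
  proof (rule Bochner_Integration.integrable_bound)
    show "integrable (lebesgue_on S) (\<lambda>x. (norm (g x))\<^sup>2)" using g by (rule L2_D)
    show "AE x in lebesgue_on S. norm ((norm (f x))\<^sup>2) \<le> norm ((norm (g x))\<^sup>2)"
      using le by eventually_elim (auto intro: power_mono)
  qed (use f in auto)
  then show ?thesis using f by (simp add: L2_def)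
qed

lemma L2_const:
  assumes "S \<in> lmeasurable"
  shows "(\<lambda>x. c) \<in> L2 S"
proof -
  have "integrable (lebesgue_on S) (\<lambda>x. (norm c)\<^sup>2)"
    using assms by (intro finite_measure.integrable_const finite_measure_lebesgue_on)
  then show ?thesis by (auto simp: L2_def)
qed

lemma L2_bounded:
  assumes S: "S \<in> lmeasurable" and f: "f \<in> borel_measurable (lebesgue_on S)"
    and le: "AE x in lebesgue_on S. norm (f x) \<le> (c::real)"
  shows "f \<in> L2 S"
  by (rule L2_bound[OF L2_const[OF S, of c] f]) (use le in eventually_elim, auto)

lemma L2_subset:
  assumes "S \<in> sets lebesgue" "T \<in> sets lebesgue" "T \<subseteq> S" "f \<in> L2 S"
  shows "f \<in> L2 T"
  using assms integrable_lebesgue_on_subset[OF assms(1-3)] borel_measurable_lebesgue_on_subset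
  by (auto simp: L2_def)

lemma L2_integrable:
  fixes f :: "'a::euclidean_space \<Rightarrow> real"
  assumes "S \<in> lmeasurable" "f \<in> L2 S"
  shows "integrable (lebesgue_on S) f"
  using L2_integrable_mult[OF assms(2) L2_const[OF assms(1), of 1]] by simp

lemma L2_norm_nonneg [simp]: "0 \<le> L2_norm S f"
  by (simp add: L2_norm_def)

lemma L2_norm_square: "(L2_norm S f)\<^sup>2 = (LINT x|lebesgue_on S. (norm (f x))\<^sup>2)"
  by (simp add: L2_norm_def)

lemma L2_inner_self: "L2_inner S f f = (L2_norm S f)\<^sup>2"
  by (simp add: L2_norm_square L2_inner_def power2_norm_eq_inner)

lemma L2_inner_commute: "L2_inner S f g = L2_inner S g f"
  by (simp add: L2_inner_def inner_commute)

lemma L2_inner_add_left: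
  assumes "f \<in> L2 S" "g \<in> L2 S" "h \<in> L2 S"
  shows "L2_inner S (\<lambda>x. f x + g x) h = L2_inner S f h + L2_inner S g h"
  unfolding L2_inner_def inner_add_left
  by (rule Bochner_Integration.integral_add) (use assms in \<open>auto intro: L2_integrable_inner\<close>)

lemma L2_inner_diff_left:
  assumes "f \<in> L2 S" "g \<in> L2 S" "h \<in> L2 S"
  shows "L2_inner S (\<lambda>x. f x - g x) h = L2_inner S f h - L2_inner S g h"
  unfolding L2_inner_def inner_diff_left
  by (rule Bochner_Integration.integral_diff) (use assms in \<open>auto intro: L2_integrable_inner\<close>)

lemma L2_inner_scaleR_left: "L2_inner S (\<lambda>x. c *\<^sub>R f x) h = c * L2_inner S f h"
  by (simp add: L2_inner_def)

lemma L2_inner_mult_left: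
  fixes f :: "'a::euclidean_space \<Rightarrow> real"
  shows "L2_inner S (\<lambda>x. c * f x) h = c * L2_inner S f h"
  using L2_inner_scaleR_left[of S c f h] by simp

lemma L2_inner_cong_AE:
  assumes S: "S \<in> sets lebesgue" and "AE x in lebesgue_on S. f x = f' x" "AE x in lebesgue_on S. g x = g' x"
  shows "L2_inner S f g = L2_inner S f' g'"
  unfolding L2_inner_def
  by (rule lebesgue_on_cong_AE(3)[OF S]) (use assms(2,3) in eventually_elim, auto)

lemma L2_norm_cong_AE:
  assumes S: "S \<in> sets lebesgue" and "AE x in lebesgue_on S. f x = g x"
  shows "L2_norm S f = L2_norm S g"
proof -
  have "AE x in lebesgue_on S. (norm (f x))\<^sup>2 = (norm (g x))\<^sup>2"
    using assms(2) by eventually_elim auto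
  then show ?thesis unfolding L2_norm_def using lebesgue_on_cong_AE(3)[OF S] by metis
qed

text \<open>\<open>f\<close> may even be non-measurable: the integral of a non-integrable function
  is 0, so the inequality survives. This spares measurability proofs at each use.\<close>

lemma L2_norm_mono_AE:
  assumes g: "g \<in> L2 S" and le: "AE x in lebesgue_on S. norm (f x) \<le> norm (g x)"
  shows "L2_norm S f \<le> L2_norm S g"
  unfolding L2_norm_def
proof (rule real_sqrt_le_mono, rule integral_mono_AE')
  show "integrable (lebesgue_on S) (\<lambda>x. (norm (g x))\<^sup>2)" using g by (rule L2_D)
  show "AE x in lebesgue_on S. (norm (f x))\<^sup>2 \<le> (norm (g x))\<^sup>2"
    using le by eventually_elim (auto intro: power_mono)
qed auto

lemma L2_Cauchy_Schwarz:
  assumes f: "f \<in> L2 S" and g: "g \<in> L2 S"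
  shows "\<bar>L2_inner S f g\<bar> \<le> L2_norm S f * L2_norm S g"
proof -
  define A B C where "A = (L2_norm S f)\<^sup>2" and "B = L2_inner S f g" and "C = (L2_norm S g)\<^sup>2"
  have pos: "0 \<le> A - 2 * t * B + t\<^sup>2 * C" for t
  proof -
    have tg: "(\<lambda>x. t *\<^sub>R g x) \<in> L2 S" using g by (rule L2_scaleR)
    have d: "(\<lambda>x. f x - t *\<^sub>R g x) \<in> L2 S" using f tg by (rule L2_diff)
    have "0 \<le> L2_inner S (\<lambda>x. f x - t *\<^sub>R g x) (\<lambda>x. f x - t *\<^sub>R g x)"
      unfolding L2_inner_self by simp
    also have "\<dots> = L2_inner S f (\<lambda>x. f x - t *\<^sub>R g x) - t * L2_inner S g (\<lambda>x. f x - t *\<^sub>R g x)"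
      using L2_inner_diff_left[OF f tg d] by (simp add: L2_inner_scaleR_left)
    also have "L2_inner S f (\<lambda>x. f x - t *\<^sub>R g x) = A - t * B"
      using L2_inner_diff_left[OF f tg f] L2_inner_commute[of S f "\<lambda>x. f x - t *\<^sub>R g x"]
      by (simp add: L2_inner_scaleR_left A_def B_def L2_inner_self L2_inner_commute[of S g f])
    also have "L2_inner S g (\<lambda>x. f x - t *\<^sub>R g x) = B - t * C"
      using L2_inner_diff_left[OF f tg g]
      by (subst L2_inner_commute) (simp add: L2_inner_scaleR_left B_def C_def L2_inner_self)
    finally show ?thesis by (simp add: power2_eq_square algebra_simps)
  qed
  have "B\<^sup>2 \<le> A * C"
  proof (cases "C = 0")
    case True
    have "B = 0"
    proof (rule ccontr)
      assume "B \<noteq> 0"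
      \<comment> \<open>For C = 0 the quadratic is affine in t, and this t gives it the value
        -1.\<close>
      then show False using pos[of "(A + 1) / (2 * B)"] True by (simp add: field_simps)
    qed
    then show ?thesis using True by simp
  next
    case False
    then have "C > 0" by (simp add: C_def zero_less_power2 less_le)
    then show ?thesis using pos[of "B / C"] by (simp add: field_simps power2_eq_square)
  qed
  then have "\<bar>B\<bar>\<^sup>2 \<le> (L2_norm S f * L2_norm S g)\<^sup>2"
    by (simp add: A_def C_def power_mult_distrib)
  then show ?thesis unfolding B_def by (rule power2_le_imp_le) simp
qed

lemma L2_norm_triangle:
  assumes f: "f \<in> L2 S" and g: "g \<in> L2 S"
  shows "L2_norm S (\<lambda>x. f x + g x) \<le> L2_norm S f + L2_norm S g"
proof (rule power2_le_imp_le)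
  have fg: "(\<lambda>x. f x + g x) \<in> L2 S" using f g by (rule L2_add)
  have "(L2_norm S (\<lambda>x. f x + g x))\<^sup>2 = L2_inner S f (\<lambda>x. f x + g x) + L2_inner S g (\<lambda>x. f x + g x)"
    unfolding L2_inner_self[symmetric] by (rule L2_inner_add_left[OF f g fg])
  also have "L2_inner S f (\<lambda>x. f x + g x) = (L2_norm S f)\<^sup>2 + L2_inner S f g"
    using L2_inner_add_left[OF f g f] L2_inner_commute[of S f "\<lambda>x. f x + g x"]
    by (simp add: L2_inner_self L2_inner_commute[of S g f])
  also have "L2_inner S g (\<lambda>x. f x + g x) = L2_inner S f g + (L2_norm S g)\<^sup>2"
    using L2_inner_add_left[OF f g g] L2_inner_commute[of S g "\<lambda>x. f x + g x"]
    by (simp add: L2_inner_self)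
  finally show "(L2_norm S (\<lambda>x. f x + g x))\<^sup>2 \<le> (L2_norm S f + L2_norm S g)\<^sup>2"
    using L2_Cauchy_Schwarz[OF f g] by (simp add: power2_sum)
qed simp

lemma L2_norm_scaleR: "L2_norm S (\<lambda>x. c *\<^sub>R f x) = \<bar>c\<bar> * L2_norm S f"
  by (simp add: L2_norm_def power_mult_distrib real_sqrt_mult)

lemma L2_norm_mult:
  fixes f :: "'a::euclidean_space \<Rightarrow> real"
  shows "L2_norm S (\<lambda>x. c * f x) = \<bar>c\<bar> * L2_norm S f"
  using L2_norm_scaleR[of S c f] by simp

lemma L2_norm_diff:
  assumes f: "f \<in> L2 S" and g: "g \<in> L2 S"
  shows "L2_norm S (\<lambda>x. f x - g x) \<le> L2_norm S f + L2_norm S g"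
  using L2_norm_triangle[OF f L2_scaleR[OF g, of "-1"]] L2_norm_scaleR[of S "-1" g] by simp

lemma L2_norm_zero_iff_AE:
  assumes "f \<in> L2 S"
  shows "L2_norm S f = 0 \<longleftrightarrow> (AE x in lebesgue_on S. f x = 0)"
  using integral_nonneg_eq_0_iff_AE[OF L2_D(2)[OF assms]] by (simp add: L2_norm_def)

lemma L2_norm_subset:
  assumes "S \<in> sets lebesgue" "T \<in> sets lebesgue" "T \<subseteq> S" "f \<in> L2 S"
  shows "L2_norm T f \<le> L2_norm S f"
proof -
  have *: "integrable lebesgue (\<lambda>x. indicator S x *\<^sub>R (norm (f x))\<^sup>2)"
    using L2_D(2)[OF assms(4)] assms(1) by (simp add: integrable_restrict_space)
  have "(\<integral>x. indicator T x *\<^sub>R (norm (f x))\<^sup>2 \<partial>lebesgue) \<le> (\<integral>x. indicator S x *\<^sub>R (norm (f x))\<^sup>2 \<partial>lebesgue)"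
    by (rule integral_mono'[OF *]) (use assms(3) in \<open>auto simp: indicator_def\<close>)
  then show ?thesis using assms(1,2) by (simp add: L2_norm_def integral_restrict_space)
qed

lemma L2_norm_bounded:
  assumes S: "S \<in> lmeasurable" and c: "0 \<le> (c::real)"
    and le: "AE x in lebesgue_on S. norm (f x) \<le> c"
  shows "L2_norm S f \<le> c * sqrt (measure lebesgue S)"
proof -
  have "L2_norm S f \<le> L2_norm S (\<lambda>x. c)"
    by (rule L2_norm_mono_AE[OF L2_const[OF S]]) (use le c in auto)
  also have "\<dots> = c * sqrt (measure lebesgue S)"
    using S c by (simp add: L2_norm_def real_sqrt_mult lmeasure_integral measure_restrict_space space_restrict_space
        fmeasurableD)
  finally show ?thesis .
qed

text \<open>The infimum of the essential bounds is itself one: the bounds infimum + 1 / (n + 1) hold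
  simultaneously off a countable union of null sets.\<close>

lemma Linf_norm_AE:
  assumes "f \<in> Linf S"
  shows "AE x in lebesgue_on S. \<bar>f x\<bar> \<le> Linf_norm S f" and "0 \<le> Linf_norm S f"
proof -
  let ?A = "{M. 0 \<le> M \<and> (AE x in lebesgue_on S. \<bar>f x\<bar> \<le> M)}"
  obtain M where "AE x in lebesgue_on S. \<bar>f x\<bar> \<le> M" using assms by (auto simp: Linf_def)
  then have "AE x in lebesgue_on S. \<bar>f x\<bar> \<le> max 0 M" by eventually_elim auto
  then have ne: "?A \<noteq> {}" by (auto intro!: exI[of _ "max 0 M"])
  have bdd: "bdd_below ?A" by (rule bdd_belowI[of _ 0]) auto
  show "0 \<le> Linf_norm S f" unfolding Linf_norm_def by (rule cInf_greatest[OF ne]) auto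
  have "AE x in lebesgue_on S. \<forall>n::nat. \<bar>f x\<bar> \<le> Linf_norm S f + 1 / Suc n"
    unfolding AE_all_countable
  proof
    fix n :: nat
    have "Inf ?A < Linf_norm S f + 1 / Suc n" by (simp add: Linf_norm_def)
    then obtain M where "M \<in> ?A" "M < Linf_norm S f + 1 / Suc n"
      using cInf_less_iff[OF ne bdd] by blast
    then show "AE x in lebesgue_on S. \<bar>f x\<bar> \<le> Linf_norm S f + 1 / Suc n"
      by (auto elim!: eventually_mono)
  qed
  then show "AE x in lebesgue_on S. \<bar>f x\<bar> \<le> Linf_norm S f"
  proof eventually_elim
    case (elim x)
    have "(\<lambda>n. Linf_norm S f + 1 / real (Suc n)) \<longlonglongrightarrow> Linf_norm S f + 0"
      by (intro tendsto_intros LIMSEQ_inverse_real_of_nat[unfolded inverse_eq_divide])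
    then show ?case using elim by (intro LIMSEQ_le_const) auto
  qed
qed

lemma integral_lebesgue_on_partition:
  assumes fin: "finite \<K>" and meas: "\<And>K. K \<in> \<K> \<Longrightarrow> K \<in> sets lebesgue"
    and disj: "pairwise disjnt \<K>" and S: "S \<in> sets lebesgue"
    and sub: "\<Union>\<K> \<subseteq> S" and null: "negligible (S - \<Union>\<K>)"
    and int: "integrable (lebesgue_on S) f"
  shows "(LINT x|lebesgue_on S. f x) = (\<Sum>K\<in>\<K>. LINT x|lebesgue_on K. (f x :: real))"
proof -
  have "AE x in lebesgue. x \<notin> S - \<Union>\<K>"
    using null negligible_iff_null_sets AE_not_in by blast
  then have ae: "AE x in lebesgue. indicator S x *\<^sub>R f x = (\<Sum>K\<in>\<K>. indicator K x *\<^sub>R f x)"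
  proof eventually_elim
    case (elim x)
    show ?case
    proof (cases "x \<in> S")
      case True
      then obtain K0 where K0: "K0 \<in> \<K>" "x \<in> K0" using elim by auto
      have "indicator K x *\<^sub>R f x = (if K = K0 then f x else 0)" if "K \<in> \<K>" for K
        using disj K0 that by (auto simp: pairwise_def disjnt_iff indicator_def)
      then have "(\<Sum>K\<in>\<K>. indicator K x *\<^sub>R f x) = (\<Sum>K\<in>\<K>. if K = K0 then f x else 0)"
        by (rule sum.cong[OF refl])
      also have "\<dots> = f x" using fin K0 by simp
      finally show ?thesis using True by simp
    next
      case False
      then have "\<And>K. K \<in> \<K> \<Longrightarrow> x \<notin> K" using sub by auto
      then show ?thesis using False by simp
    qed
  qed
  have intK: "integrable lebesgue (\<lambda>x. indicator K x *\<^sub>R f x)" if "K \<in> \<K>" for K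
    using integrable_lebesgue_on_subset[OF S meas[OF that] _ int] sub that meas[OF that]
    by (auto simp: integrable_restrict_space)
  have "(LINT x|lebesgue_on S. f x) = (\<integral>x. indicator S x *\<^sub>R f x \<partial>lebesgue)"
    using S by (simp add: integral_restrict_space)
  also have "\<dots> = (\<integral>x. (\<Sum>K\<in>\<K>. indicator K x *\<^sub>R f x) \<partial>lebesgue)"
    by (rule integral_cong_AE[OF _ _ ae])
       (use int S intK in \<open>auto simp: integrable_restrict_space intro!: borel_measurable_sum\<close>)
  also have "\<dots> = (\<Sum>K\<in>\<K>. \<integral>x. indicator K x *\<^sub>R f x \<partial>lebesgue)"
    by (rule Bochner_Integration.integral_sum) (rule intK)
  also have "\<dots> = (\<Sum>K\<in>\<K>. LINT x|lebesgue_on K. f x)"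
    using meas by (intro sum.cong) (auto simp: integral_restrict_space)
  finally show ?thesis .
qed

section \<open>Smooth functions and test functions\<close>

definition smooth_fun :: "(real^'d::finite \<Rightarrow> real) \<Rightarrow> bool" where
  "smooth_fun f \<longleftrightarrow> (\<forall>js x. partials js f differentiable (at x))"

text \<open>Coinduction for smoothness: any family of differentiable functions that
  \<open>partial\<close> does not leave consists of smooth functions.\<close>

lemma smooth_funI_closed:
  assumes F: "\<And>f x. f \<in> F \<Longrightarrow> f differentiable (at x)" "\<And>f i. f \<in> F \<Longrightarrow> partial i f \<in> F"
    and f: "f \<in> F"
  shows "smooth_fun f"
proof -
  have "partials js f \<in> F" for js using f F(2) by (induction js) auto
  then show ?thesis using F(1) by (auto simp: smooth_fun_def)
qed

lemma partials_append: "partials (js @ ks) f = partials js (partials ks f)"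
  by (induction js) auto

lemma smooth_fun_differentiable: "smooth_fun f \<Longrightarrow> f differentiable (at x)"
  using partials.simps(1) by (metis smooth_fun_def)

lemma smooth_fun_partials:
  assumes "smooth_fun f" shows "smooth_fun (partials ks f)"
  using assms unfolding smooth_fun_def partials_append[symmetric] by blast

lemma smooth_fun_partial: "smooth_fun f \<Longrightarrow> smooth_fun (partial i f)"
  using smooth_fun_partials[of f "[i]"] by simp

lemma partial_eqI:
  assumes "(f has_derivative f') (at x)"
  shows "partial i f x = f' (axis i 1)"
  using frechet_derivative_at[OF assms] by (simp add: partial_def)

lemma partial_add:
  assumes "\<And>x. f differentiable (at x)" "\<And>x. g differentiable (at x)"
  shows "partial i (\<lambda>x. f x + g x) = (\<lambda>x. partial i f x + partial i g x)"
proof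
  fix x
  have "((\<lambda>x. f x + g x) has_derivative
      (\<lambda>h. frechet_derivative f (at x) h + frechet_derivative g (at x) h)) (at x)"
    using assms by (intro has_derivative_add) (auto simp: frechet_derivative_works[symmetric])
  from partial_eqI[OF this] show "partial i (\<lambda>x. f x + g x) x = partial i f x + partial i g x"
    by (simp add: partial_def)
qed

lemma partial_mult:
  assumes "\<And>x. f differentiable (at x)" "\<And>x. g differentiable (at x)"
  shows "partial i (\<lambda>x. f x * g x) = (\<lambda>x. f x * partial i g x + partial i f x * g x)"
proof
  fix x
  have "((\<lambda>x. f x * g x) has_derivative
      (\<lambda>h. f x * frechet_derivative g (at x) h + frechet_derivative f (at x) h * g x)) (at x)"
    using assms by (intro has_derivative_mult) (auto simp: frechet_derivative_works[symmetric])
  from partial_eqI[OF this]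
  show "partial i (\<lambda>x. f x * g x) x = f x * partial i g x + partial i f x * g x"
    by (simp add: partial_def)
qed

lemma partial_const: "partial i (\<lambda>x. c) = (\<lambda>x. 0)"
  by (simp add: partial_def fun_eq_iff)

text \<open>A derivative of a product or a composition is not again a product or a composition, but
  a polynomial in functions of the same kind. The generated algebra is the family to which
  \<open>smooth_funI_closed\<close> can be applied: by the Leibniz rule it suffices to differentiate
  the generators.\<close>

inductive_set algebra_hull :: "(real^'d::finite \<Rightarrow> real) set \<Rightarrow> (real^'d \<Rightarrow> real) set" for G where
  alg_base: "g \<in> G \<Longrightarrow> g \<in> algebra_hull G"
| alg_const: "(\<lambda>x. c) \<in> algebra_hull G"
| alg_add: "f \<in> algebra_hull G \<Longrightarrow> g \<in> algebra_hull G \<Longrightarrow> (\<lambda>x. f x + g x) \<in> algebra_hull G"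
| alg_mult: "f \<in> algebra_hull G \<Longrightarrow> g \<in> algebra_hull G \<Longrightarrow> (\<lambda>x. f x * g x) \<in> algebra_hull G"

lemma smooth_fun_alg:
  assumes G: "\<And>g x. g \<in> G \<Longrightarrow> g differentiable (at x)" "\<And>g i. g \<in> G \<Longrightarrow> partial i g \<in> algebra_hull G"
    and f: "f \<in> algebra_hull G"
  shows "smooth_fun f"
proof (rule smooth_funI_closed[OF _ _ f])
  have D: "(\<forall>x. f differentiable (at x)) \<and> (\<forall>i. partial i f \<in> algebra_hull G)" if "f \<in> algebra_hull G" for f
    using that
  proof induction
    case (alg_base g) then show ?case using G by auto
  next
    case (alg_const c) then show ?case by (auto simp: partial_const intro: algebra_hull.intros)
  next
    case (alg_add f g) then show ?case
      by (auto simp: partial_add intro!: algebra_hull.alg_add)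
  next
    case (alg_mult f g) then show ?case
      by (auto simp: partial_mult intro!: algebra_hull.alg_add algebra_hull.alg_mult)
  qed
  show "\<And>f x. f \<in> algebra_hull G \<Longrightarrow> f differentiable (at x)" "\<And>f i. f \<in> algebra_hull G \<Longrightarrow> partial i f \<in> algebra_hull G"
    using D by auto
qed

lemma smooth_fun_alg_smooth: "f \<in> algebra_hull {f. smooth_fun f} \<Longrightarrow> smooth_fun f"
  by (rule smooth_fun_alg[of "{f. smooth_fun f}"])
     (auto intro: alg_base smooth_fun_differentiable smooth_fun_partial)

lemma smooth_fun_const [intro]: "smooth_fun (\<lambda>x. c)"
  and smooth_fun_add [intro]: "smooth_fun f \<Longrightarrow> smooth_fun g \<Longrightarrow> smooth_fun (\<lambda>x. f x + g x)"
  and smooth_fun_mult [intro]: "smooth_fun f \<Longrightarrow> smooth_fun g \<Longrightarrow> smooth_fun (\<lambda>x. f x * g x)"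
proof -
  show "smooth_fun (\<lambda>x. c)"
    by (rule smooth_fun_alg_smooth, rule alg_const)
  show "smooth_fun (\<lambda>x. f x + g x)" if "smooth_fun f" "smooth_fun g"
    by (rule smooth_fun_alg_smooth, rule alg_add; rule alg_base) (use that in auto)
  show "smooth_fun (\<lambda>x. f x * g x)" if "smooth_fun f" "smooth_fun g"
    by (rule smooth_fun_alg_smooth, rule alg_mult; rule alg_base) (use that in auto)
qed

lemma smooth_fun_diff [intro]: "smooth_fun f \<Longrightarrow> smooth_fun g \<Longrightarrow> smooth_fun (\<lambda>x. f x - g x)"
  using smooth_fun_add[OF _ smooth_fun_mult[OF smooth_fun_const[of "-1"]], of f g] by simp

lemma smooth_fun_sum [intro]:
  "(\<And>i. i \<in> I \<Longrightarrow> smooth_fun (f i)) \<Longrightarrow> smooth_fun (\<lambda>x. \<Sum>i\<in>I. f i x)"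
  by (induction I rule: infinite_finite_induct) auto

lemma smooth_fun_power [intro]: "smooth_fun f \<Longrightarrow> smooth_fun (\<lambda>x. f x ^ n)"
  by (induction n) auto

lemma smooth_fun_component [intro]:
  fixes i :: "'d::finite"
  shows "smooth_fun (\<lambda>x. x $ i)"
proof (rule smooth_fun_alg[where G = "{\<lambda>x. x $ i}"])
  have D: "((\<lambda>x. x $ i) has_derivative (\<lambda>h. h $ i)) (at x)" for x :: "real^'d"
    by (rule bounded_linear.has_derivative[OF bounded_linear_vec_nth]) (rule has_derivative_ident)
  show "g differentiable (at x)" if "g \<in> {\<lambda>x::real^'d. x $ i}" for g x
    using that differentiableI[OF D] by simp
  show "partial j g \<in> algebra_hull {\<lambda>x::real^'d. x $ i}" if "g \<in> {\<lambda>x::real^'d. x $ i}" for g and j :: 'd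
  proof -
    have "partial j g = (\<lambda>x. axis j 1 $ i)" using that D by (auto intro!: partial_eqI)
    then show ?thesis using algebra_hull.alg_const by simp
  qed
qed (auto intro: algebra_hull.intros)

lemma smooth_fun_affine:
  assumes "smooth_fun f"
  shows "smooth_fun (\<lambda>x. f (s *\<^sub>R x + b))"
    and "partial i (\<lambda>x. f (s *\<^sub>R x + b)) = (\<lambda>x. s * partial i f (s *\<^sub>R x + b))"
proof -
  \<comment> \<open>The pullbacks of all smooth functions are taken together, since a derivative of
    one is a constant times another.\<close>
  let ?G = "(\<lambda>f x. f (s *\<^sub>R x + b)) ` {f. smooth_fun f}"
  have D: "((\<lambda>x. f (s *\<^sub>R x + b)) has_derivative (\<lambda>h. frechet_derivative f (at (s *\<^sub>R x + b)) (s *\<^sub>R h))) (at x)"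
    if "smooth_fun f" for f x
  proof -
    have "(f has_derivative frechet_derivative f (at (s *\<^sub>R x + b))) (at (s *\<^sub>R x + b))"
      using smooth_fun_differentiable[OF that] by (simp add: frechet_derivative_works[symmetric])
    moreover have "((\<lambda>x. s *\<^sub>R x + b) has_derivative (\<lambda>h. s *\<^sub>R h)) (at x)"
      by (auto intro!: derivative_eq_intros)
    ultimately show ?thesis
      using has_derivative_compose[of "\<lambda>x. s *\<^sub>R x + b" "\<lambda>h. s *\<^sub>R h" x UNIV f] by simp
  qed
  have P: "partial i (\<lambda>x. f (s *\<^sub>R x + b)) = (\<lambda>x. s * partial i f (s *\<^sub>R x + b))" if "smooth_fun f" for f i
  proof
    fix x
    have "linear (frechet_derivative f (at (s *\<^sub>R x + b)))"
      using smooth_fun_differentiable[OF that] by (simp add: linear_frechet_derivative)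
    then show "partial i (\<lambda>x. f (s *\<^sub>R x + b)) x = s * partial i f (s *\<^sub>R x + b)"
      using partial_eqI[OF D[OF that]] by (simp add: linear_cmul partial_def)
  qed
  show "partial i (\<lambda>x. f (s *\<^sub>R x + b)) = (\<lambda>x. s * partial i f (s *\<^sub>R x + b))"
    using P assms by blast
  show "smooth_fun (\<lambda>x. f (s *\<^sub>R x + b))"
  proof (rule smooth_fun_alg[where G = ?G])
    show "g differentiable (at x)" if "g \<in> ?G" for g x
      using that D differentiable_def by blast
    show "partial i g \<in> algebra_hull ?G" if gG: "g \<in> ?G" for g i
    proof -
      obtain f where f: "smooth_fun f" "g = (\<lambda>x. f (s *\<^sub>R x + b))" using gG by auto
      show ?thesis unfolding f(2) P[OF f(1)]
        by (intro alg_mult alg_const alg_base) (use smooth_fun_partial[OF f(1)] in blast)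
    qed
    show "(\<lambda>x. f (s *\<^sub>R x + b)) \<in> algebra_hull ?G" using assms by (auto intro!: algebra_hull.alg_base)
  qed
qed

text \<open>A whole family \<open>H\<close> closed under differentiation replaces a single outer
  function, because the chain rule produces \<open>h'\<close> composed with \<open>q\<close>, which
  has to be a generator again.\<close>

lemma smooth_fun_compose:
  fixes H :: "(real \<Rightarrow> real) set"
  assumes H: "\<And>h. h \<in> H \<Longrightarrow> \<exists>h'\<in>H. \<forall>t. (h has_field_derivative h' t) (at t)"
    and h: "h \<in> H" and q: "smooth_fun q"
  shows "smooth_fun (\<lambda>x. h (q x))"
proof -
  let ?G = "(\<lambda>h x. h (q x)) ` H \<union> {f. smooth_fun f}"
  show ?thesis
  proof (rule smooth_fun_alg[where G = ?G])
    have D: "\<exists>h'\<in>H. \<forall>x. ((\<lambda>x. h (q x)) has_derivative (\<lambda>k. h' (q x) * frechet_derivative q (at x) k)) (at x)"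
      if h: "h \<in> H" for h
    proof -
      obtain h' where h': "h' \<in> H" "\<And>t. (h has_field_derivative h' t) (at t)" using H[OF h] by auto
      show ?thesis
      proof (intro bexI[OF _ h'(1)] allI)
        fix x
        have "(q has_derivative frechet_derivative q (at x)) (at x)"
          using smooth_fun_differentiable[OF q] by (simp add: frechet_derivative_works[symmetric])
        moreover have "(h has_derivative (\<lambda>k. h' (q x) * k)) (at (q x))"
          using h'(2) by (simp add: has_field_derivative_def)
        ultimately show "((\<lambda>x. h (q x)) has_derivative (\<lambda>k. h' (q x) * frechet_derivative q (at x) k)) (at x)"
          using has_derivative_compose[of q "frechet_derivative q (at x)" x UNIV h] by simp
      qed
    qed
    show "g differentiable (at x)" if "g \<in> ?G" for g x
      using that D smooth_fun_differentiable unfolding differentiable_def by blast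
    show "partial i g \<in> algebra_hull ?G" if gG: "g \<in> ?G" for g i
    proof (cases "smooth_fun g")
      case True
      then show ?thesis using smooth_fun_partial by (intro alg_base) blast
    next
      case False
      then obtain h where h: "h \<in> H" and g: "g = (\<lambda>x. h (q x))" using gG by auto
      obtain h' where h': "h' \<in> H"
        "\<And>x. ((\<lambda>x. h (q x)) has_derivative (\<lambda>k. h' (q x) * frechet_derivative q (at x) k)) (at x)"
        using D[OF h] by blast
      have "partial i g = (\<lambda>x. h' (q x) * partial i q x)"
        unfolding g using partial_eqI[OF h'(2)] by (auto simp: fun_eq_iff partial_def)
      moreover have "\<dots> \<in> algebra_hull ?G"
        by (rule alg_mult; rule alg_base) (use h'(1) smooth_fun_partial[OF q] in blast)+
      ultimately show ?thesis by simp
    qed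
    show "(\<lambda>x. h (q x)) \<in> algebra_hull ?G" using h by (auto intro!: algebra_hull.alg_base)
  qed
qed

text \<open>The flat function exp (-1/t), extended by 0, with polynomial factors in 1/t. These
  factors are exactly what differentiation creates, so the range of \<open>poly_exp\<close> is
  closed under derivatives.\<close>

definition poly_exp :: "real poly \<Rightarrow> real \<Rightarrow> real" where
  "poly_exp P t = (if t > 0 then poly P (1 / t) * exp (- (1 / t)) else 0)"

lemma poly_times_exp_tendsto_0: "((\<lambda>u. poly P u * exp (- u)) \<longlongrightarrow> (0::real)) at_top"
proof -
  have "((\<lambda>u. \<Sum>k\<le>degree P. coeff P k * (u ^ k / exp u)) \<longlongrightarrow> (\<Sum>k\<le>degree P. coeff P k * 0)) at_top"
    by (intro tendsto_intros tendsto_power_div_exp_0)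
  moreover have "(\<lambda>u. \<Sum>k\<le>degree P. coeff P k * (u ^ k / exp u)) = (\<lambda>u. poly P u * exp (- u))"
    by (simp add: poly_altdef sum_distrib_right exp_minus divide_simps fun_eq_iff)
  ultimately show ?thesis by simp
qed

lemma poly_exp_derivative:
  "(poly_exp P has_field_derivative poly_exp ([:0, 0, 1:] * (P - pderiv P)) t) (at t)"
proof -
  consider "t < 0" | "t = 0" | "t > 0" by linarith
  then show ?thesis
  proof cases
    case 1
    have "((\<lambda>t. 0) has_field_derivative 0) (at t)" by simp
    then have "(poly_exp P has_field_derivative 0) (at t)"
      by (rule has_field_derivative_transform_within_open[of _ _ _ "{..<0}"])
         (use 1 in \<open>auto simp: poly_exp_def\<close>)
    then show ?thesis using 1 by (simp add: poly_exp_def)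
  next
    case 2
    \<comment> \<open>The difference quotient at 0 is \<open>poly_exp P y / y\<close>; dividing by y
      raises the degree in 1/y by one, which is \<open>pCons 0 P\<close>.\<close>
    have "((\<lambda>y. poly (pCons 0 P) y * exp (- y)) \<longlongrightarrow> 0) at_top"
      by (rule poly_times_exp_tendsto_0)
    then have "((\<lambda>y. poly (pCons 0 P) (inverse y) * exp (- inverse y)) \<longlongrightarrow> 0) (at_right 0)"
      by (rule filterlim_compose[OF _ filterlim_inverse_at_top_right])
    then have R: "((\<lambda>y. poly_exp P y / y) \<longlongrightarrow> 0) (at_right 0)"
      by (rule Lim_transform_eventually)
         (auto simp: eventually_at_filter poly_exp_def inverse_eq_divide)
    have "((\<lambda>y. 0) \<longlongrightarrow> (0::real)) (at_left 0)" by simp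
    then have L: "((\<lambda>y. poly_exp P y / y) \<longlongrightarrow> 0) (at_left 0)"
      by (rule Lim_transform_eventually) (auto simp: eventually_at_filter poly_exp_def)
    have "((\<lambda>y. poly_exp P y / y) \<longlongrightarrow> 0) (at 0)" using L R by (rule filterlim_split_at)
    then have "(poly_exp P has_field_derivative 0) (at 0)"
      by (simp add: has_field_derivative_iff poly_exp_def[of _ 0])
    then show ?thesis using 2 by (simp add: poly_exp_def)
  next
    case 3
    define g where "g = (\<lambda>t::real. 1 / t)"
    have g: "(g has_field_derivative - (g t)\<^sup>2) (at t)"
      unfolding g_def using 3 by (auto intro!: derivative_eq_intros simp: power2_eq_square)
    have p: "((\<lambda>t. poly P (g t)) has_field_derivative poly (pderiv P) (g t) * - (g t)\<^sup>2) (at t)"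
      by (rule DERIV_chain2[OF poly_DERIV g])
    have "((\<lambda>t. exp (- g t)) has_field_derivative exp (- g t) * (g t)\<^sup>2) (at t)"
      using g by (auto intro!: derivative_eq_intros)
    from DERIV_mult[OF p this]
    have "((\<lambda>t. poly P (g t) * exp (- g t)) has_field_derivative
        poly_exp ([:0, 0, 1:] * (P - pderiv P)) t) (at t)"
      using 3 by (simp add: poly_exp_def g_def[symmetric] algebra_simps power2_eq_square)
    then show ?thesis
      by (rule has_field_derivative_transform_within_open[of _ _ _ "{0<..}"])
         (use 3 in \<open>auto simp: poly_exp_def g_def\<close>)
  qed
qed

text \<open>The argument uses the squared norm, a polynomial in the coordinates, so that smoothness
  does not break at the centre.\<close>

definition bump :: "real^'d::finite \<Rightarrow> real \<Rightarrow> real^'d \<Rightarrow> real" where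
  "bump c r x = poly_exp 1 (r\<^sup>2 - (norm (x - c))\<^sup>2)"

lemma smooth_fun_bump: "smooth_fun (bump c r)"
proof -
  have "smooth_fun (\<lambda>x. r\<^sup>2 - (\<Sum>i\<in>UNIV. (x $ i - c $ i)\<^sup>2))"
    by (intro smooth_fun_diff smooth_fun_sum smooth_fun_power smooth_fun_const smooth_fun_component)
  moreover have "(\<Sum>i\<in>UNIV. (x $ i - c $ i)\<^sup>2) = (norm (x - c))\<^sup>2" for x
    unfolding power2_norm_eq_inner inner_vec_def by (simp add: power2_eq_square)
  ultimately have "smooth_fun (\<lambda>x. r\<^sup>2 - (norm (x - c))\<^sup>2)" by simp
  then have "smooth_fun (\<lambda>x. poly_exp 1 (r\<^sup>2 - (norm (x - c))\<^sup>2))"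
    by (rule smooth_fun_compose[where H = "range poly_exp", rotated 2])
       (use poly_exp_derivative in blast)+
  then show ?thesis by (simp add: bump_def[abs_def])
qed

lemma bump_nonneg: "0 \<le> bump c r x" and bump_less_1: "bump c r x < 1"
  by (auto simp: bump_def poly_exp_def)

lemma bump_pos_iff:
  assumes "r > 0"
  shows "0 < bump c r x \<longleftrightarrow> x \<in> ball c r"
proof -
  have "(norm (x - c))\<^sup>2 < r\<^sup>2 \<longleftrightarrow> norm (x - c) < r"
    using assms by (meson norm_ge_zero less_imp_le power2_less_imp_less power_strict_mono pos2)
  then show ?thesis by (simp add: bump_def poly_exp_def dist_norm norm_minus_commute)
qed

lemma smooth_fun_continuous: "smooth_fun f \<Longrightarrow> continuous_on S f"
  by (meson continuous_at_imp_continuous_on differentiable_imp_continuous_within smooth_fun_differentiable)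

lemma smooth_fun_borel [measurable_dest]: "smooth_fun f \<Longrightarrow> f \<in> borel_measurable borel"
  by (intro borel_measurable_continuous_onI smooth_fun_continuous)

section \<open>Test functions: supports, closure properties, approximate indicators\<close>

lemma test_functionsI:
  assumes "smooth_fun \<phi>" "compact L" "L \<subseteq> S" "\<And>x. x \<notin> L \<Longrightarrow> \<phi> x = 0"
  shows "\<phi> \<in> test_functions S"
proof -
  have "{x. \<phi> x \<noteq> 0} \<subseteq> L" using assms(4) by auto
  then have "closure {x. \<phi> x \<noteq> 0} \<subseteq> L"
    using assms(2) by (simp add: closure_minimal compact_imp_closed)
  moreover have "compact (closure {x. \<phi> x \<noteq> 0})"
    unfolding compact_closure
    using bounded_subset[OF compact_imp_bounded[OF assms(2)] \<open>{x. \<phi> x \<noteq> 0} \<subseteq> L\<close>] .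
  ultimately show ?thesis using assms by (auto simp: test_functions_def smooth_fun_def)
qed

text \<open>The complement of the closed support is open, so \<open>\<phi>\<close> vanishes near
  each of its points and hence so do all derivatives; one compact set serves every order.\<close>

lemma test_functionsE:
  assumes "\<phi> \<in> test_functions S"
  obtains L where "smooth_fun \<phi>" "compact L" "L \<subseteq> S" "\<And>x js. x \<notin> L \<Longrightarrow> partials js \<phi> x = 0"
proof -
  let ?L = "closure {x. \<phi> x \<noteq> 0}"
  have "\<forall>x. x \<notin> ?L \<longrightarrow> partials js \<phi> x = 0" for js
  proof (induction js)
    case Nil
    then show ?case using closure_subset[of "{x. \<phi> x \<noteq> 0}"] by auto
  next
    case (Cons j js)
    show ?case
    proof (intro allI impI)
      fix x assume x: "x \<notin> ?L"
      have "((\<lambda>x. 0) has_derivative (\<lambda>h. 0)) (at x)" by simp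
      then have "(partials js \<phi> has_derivative (\<lambda>h. 0)) (at x)"
        by (rule has_derivative_transform_within_open[of _ _ _ _ "- ?L"]) (use x Cons in auto)
      then show "partials (j # js) \<phi> x = 0" by (simp add: partial_eqI)
    qed
  qed
  then show ?thesis
    using assms that[of ?L] by (auto simp: test_functions_def smooth_fun_def)
qed

lemma test_functions_mono: "S \<subseteq> T \<Longrightarrow> test_functions S \<subseteq> test_functions T"
  by (auto simp: test_functions_def)

lemma test_functions_add:
  assumes "\<phi> \<in> test_functions S" "\<psi> \<in> test_functions S"
  shows "(\<lambda>x. \<phi> x + \<psi> x) \<in> test_functions S"
proof -
  from test_functionsE[OF assms(1)] obtain L where L: "smooth_fun \<phi>" "compact L" "L \<subseteq> S"
    "\<And>x js. x \<notin> L \<Longrightarrow> partials js \<phi> x = 0" by blast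
  from test_functionsE[OF assms(2)] obtain M where M: "smooth_fun \<psi>" "compact M" "M \<subseteq> S"
    "\<And>x js. x \<notin> M \<Longrightarrow> partials js \<psi> x = 0" by blast
  show ?thesis
    by (rule test_functionsI[of _ "L \<union> M"])
       (use L M L(4)[of _ "[]"] M(4)[of _ "[]"] in auto)
qed

lemma test_functions_mult:
  assumes "\<phi> \<in> test_functions S" "smooth_fun f"
  shows "(\<lambda>x. f x * \<phi> x) \<in> test_functions S"
proof -
  from test_functionsE[OF assms(1)] obtain L where L: "smooth_fun \<phi>" "compact L" "L \<subseteq> S"
    "\<And>x js. x \<notin> L \<Longrightarrow> partials js \<phi> x = 0" by blast
  show ?thesis
    by (rule test_functionsI[of _ L]) (use L L(4)[of _ "[]"] assms(2) in auto)
qed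

lemma test_functions_partials:
  assumes "\<phi> \<in> test_functions S"
  shows "partials js \<phi> \<in> test_functions S"
proof -
  from test_functionsE[OF assms(1)] obtain L where L: "smooth_fun \<phi>" "compact L" "L \<subseteq> S"
    "\<And>x js. x \<notin> L \<Longrightarrow> partials js \<phi> x = 0" by blast
  show ?thesis
    by (rule test_functionsI[of _ L]) (use L smooth_fun_partials in auto)
qed

lemma test_functions_sum:
  assumes "\<And>i. i \<in> I \<Longrightarrow> \<phi> i \<in> test_functions S"
  shows "(\<lambda>x. \<Sum>i\<in>I. \<phi> i x) \<in> test_functions S"
  using assms
proof (induction I rule: infinite_finite_induct)
  case (insert i I)
  then show ?case using test_functions_add[of "\<phi> i" S "\<lambda>x. \<Sum>i\<in>I. \<phi> i x"] by simp
qed (auto intro!: test_functionsI[of _ "{}"])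

lemma test_functions_bounded:
  assumes "\<phi> \<in> test_functions S"
  obtains M where "0 \<le> M" "\<And>x. \<bar>\<phi> x\<bar> \<le> M"
proof -
  from test_functionsE[OF assms(1)] obtain L where L: "smooth_fun \<phi>" "compact L" "L \<subseteq> S"
    "\<And>x js. x \<notin> L \<Longrightarrow> partials js \<phi> x = 0" by blast
  have "compact (\<phi> ` L)" using L by (intro compact_continuous_image smooth_fun_continuous)
  then obtain M where M: "\<And>x. x \<in> L \<Longrightarrow> \<bar>\<phi> x\<bar> \<le> M"
    using compact_imp_bounded[of "\<phi> ` L"] unfolding bounded_iff by auto
  show ?thesis
  proof (rule that[of "max M 0"])
    show "\<bar>\<phi> x\<bar> \<le> max M 0" for x
      using M[of x] L(4)[of x "[]"] by (cases "x \<in> L") auto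
  qed simp
qed

text \<open>A finite sum of bumps, scaled into [0, 1], is positive on \<open>C\<close> and by
  compactness at least some m > 0 there. The map s \<mapsto> 1 - (1 - s)^n fixes 0, preserves [0, 1]
  and sends [m, 1] close to 1 for large n, so no convolution with a mollifier enters.\<close>

lemma test_function_near_indicator:
  fixes C U :: "(real^'d::finite) set"
  assumes C: "compact C" and U: "open U" "C \<subseteq> U" and e: "e > 0"
  obtains \<phi> where "\<phi> \<in> test_functions U" "\<And>x. 0 \<le> \<phi> x" "\<And>x. \<phi> x \<le> 1"
    "\<And>x. x \<in> C \<Longrightarrow> 1 - e \<le> \<phi> x"
proof -
  have "\<forall>x\<in>C. \<exists>r>0. cball x r \<subseteq> U" using U open_contains_cball by blast
  then obtain r where r: "\<And>x. x \<in> C \<Longrightarrow> r x > 0 \<and> cball x (r x) \<subseteq> U" by metis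
  have cov: "C \<subseteq> (\<Union>x\<in>C. ball x (r x))" using r by force
  obtain I where I: "I \<subseteq> C" "finite I" "C \<subseteq> (\<Union>x\<in>I. ball x (r x))"
    using compactE_image[OF C _ cov] by blast
  \<comment> \<open>Larger than the number of balls, each bump being below 1; the summand 1 keeps
    \<open>N\<close> positive for an empty cover.\<close>
  define N where "N = real (card I) + 1"
  define b where "b = (\<lambda>x. (1 / N) * (\<Sum>c\<in>I. bump c (r c) x))"
  have N: "N > 0" by (simp add: N_def)
  have sb: "smooth_fun b" unfolding b_def by (intro smooth_fun_mult smooth_fun_sum smooth_fun_const smooth_fun_bump)
  have b0: "0 \<le> b x" for x unfolding b_def using N by (intro mult_nonneg_nonneg sum_nonneg bump_nonneg) auto
  have b1: "b x \<le> 1" for x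
  proof -
    have "(\<Sum>c\<in>I. bump c (r c) x) \<le> (\<Sum>c\<in>I. 1)" by (intro sum_mono less_imp_le bump_less_1)
    also have "\<dots> \<le> N" by (simp add: N_def)
    finally show ?thesis unfolding b_def using N by (simp add: field_simps)
  qed
  have bpos: "b x > 0" if xC: "x \<in> C" for x
  proof -
    obtain c where c: "c \<in> I" "x \<in> ball c (r c)" using I(3) xC by blast
    then have "0 < bump c (r c) x" using bump_pos_iff r I by blast
    then have "0 < (\<Sum>c\<in>I. bump c (r c) x)"
      using c I by (intro sum_pos2[of I c]) (auto simp: bump_nonneg)
    then show ?thesis unfolding b_def using N by simp
  qed
  obtain m where m: "0 < m" "m \<le> 1" "\<And>x. x \<in> C \<Longrightarrow> m \<le> b x"
  proof (cases "C = {}")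
    case False
    obtain x0 where "x0 \<in> C" "\<And>x. x \<in> C \<Longrightarrow> b x0 \<le> b x"
      using continuous_attains_inf[OF C False smooth_fun_continuous[OF sb]] by auto
    then show ?thesis using that[of "b x0"] bpos b1 by blast
  qed (use that[of 1] in auto)
  have "(\<lambda>n. (1 - m) ^ n) \<longlonglongrightarrow> 0" using m by (intro LIMSEQ_realpow_zero) auto
  then obtain n where n: "(1 - m) ^ n < e" "n > 0"
    using order_tendstoD(2)[OF _ e] eventually_conj[OF _ eventually_gt_at_top[of 0]]
    by (metis (mono_tags, lifting) eventually_sequentially order_refl)
  define \<phi> where "\<phi> = (\<lambda>x. 1 - (1 - b x) ^ n)"
  have L: "compact (\<Union>c\<in>I. cball c (r c))" using I by (intro compact_UN) auto
  show ?thesis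
  proof (rule that[of \<phi>])
    show "\<phi> \<in> test_functions U"
    proof (rule test_functionsI[OF _ L])
      show "smooth_fun \<phi>" unfolding \<phi>_def using sb by (intro smooth_fun_diff smooth_fun_power smooth_fun_const)
      show "(\<Union>c\<in>I. cball c (r c)) \<subseteq> U" using I r by blast
      show "\<phi> x = 0" if x: "x \<notin> (\<Union>c\<in>I. cball c (r c))" for x
      proof -
        have "bump c (r c) x = 0" if "c \<in> I" for c
        proof -
          have "x \<notin> ball c (r c)" using x that ball_subset_cball by blast
          then have "\<not> 0 < bump c (r c) x" using bump_pos_iff r I that by blast
          then show ?thesis using bump_nonneg[of c "r c" x] by simp
        qed
        then show ?thesis using n(2) by (simp add: \<phi>_def b_def)
      qed
    qed
    show "0 \<le> \<phi> x" "\<phi> x \<le> 1" for x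
      unfolding \<phi>_def using b0[of x] b1[of x] by (auto intro: power_le_one)
    show "1 - e \<le> \<phi> x" if "x \<in> C" for x
    proof -
      have "(1 - b x) ^ n \<le> (1 - m) ^ n" using m(3)[OF that] b1[of x] by (intro power_mono) auto
      then show ?thesis using n(1) by (simp add: \<phi>_def)
    qed
  qed
qed

section \<open>Integration by parts for test functions\<close>

lemma lebesgue_on_support:
  fixes f :: "'a::euclidean_space \<Rightarrow> 'b::euclidean_space"
  assumes "S \<in> sets lebesgue" "T \<in> sets lebesgue" "T \<subseteq> S" "\<And>x. x \<notin> T \<Longrightarrow> f x = 0"
  shows "integrable (lebesgue_on S) f \<longleftrightarrow> integrable (lebesgue_on T) f"
    and "integral\<^sup>L (lebesgue_on S) f = integral\<^sup>L (lebesgue_on T) f"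
proof -
  have "(\<lambda>x. indicat_real S x *\<^sub>R f x) = (\<lambda>x. indicat_real T x *\<^sub>R f x)"
    using assms(3,4) by (fastforce simp: indicator_def fun_eq_iff)
  then show "integrable (lebesgue_on S) f \<longleftrightarrow> integrable (lebesgue_on T) f"
    "integral\<^sup>L (lebesgue_on S) f = integral\<^sup>L (lebesgue_on T) f"
    using assms(1,2) by (simp_all add: integrable_restrict_space integral_restrict_space)
qed

lemma integrable_mult_bounded:
  fixes u \<phi> :: "'a \<Rightarrow> real"
  assumes "integrable M u" "\<phi> \<in> borel_measurable M" "\<And>x. \<bar>\<phi> x\<bar> \<le> c"
  shows "integrable M (\<lambda>x. u x * \<phi> x)"
proof (rule Bochner_Integration.integrable_bound)
  show "integrable M (\<lambda>x. c * u x)" using assms(1) by simp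
  show "(\<lambda>x. u x * \<phi> x) \<in> borel_measurable M" using assms(1,2) by simp
  have "\<bar>u x * \<phi> x\<bar> \<le> \<bar>c * u x\<bar>" for x
  proof -
    have "\<bar>u x\<bar> * \<bar>\<phi> x\<bar> \<le> \<bar>u x\<bar> * \<bar>c\<bar>"
      using assms(3)[of x] by (intro mult_left_mono) auto
    then show ?thesis by (simp add: abs_mult mult.commute)
  qed
  then show "AE x in M. norm (u x * \<phi> x) \<le> norm (c * u x)" by simp
qed

lemma smooth_fun_measurable_lebesgue_on: "smooth_fun f \<Longrightarrow> f \<in> borel_measurable (lebesgue_on S)"
  using measurable_completion[of f lborel borel] smooth_fun_borel[of f]
  by (intro measurable_restrict_space1) simp

lemma test_functions_smooth: "\<phi> \<in> test_functions S \<Longrightarrow> smooth_fun \<phi>"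
  by (auto simp: test_functions_def smooth_fun_def)

lemma test_functions_integrable:
  assumes "\<phi> \<in> test_functions S"
  shows "integrable lborel \<phi>" "integrable lebesgue \<phi>"
    "integral\<^sup>L lebesgue \<phi> = integral\<^sup>L lborel \<phi>"
proof -
  from test_functionsE[OF assms(1)] obtain L where L: "smooth_fun \<phi>" "compact L" "L \<subseteq> S"
    "\<And>x js. x \<notin> L \<Longrightarrow> partials js \<phi> x = 0" by blast
  have "integrable lborel (\<lambda>x. indicator L x *\<^sub>R \<phi> x)"
    using L by (intro borel_integrable_compact smooth_fun_continuous)
  also have "(\<lambda>x. indicator L x *\<^sub>R \<phi> x) = \<phi>"
    using L(4)[of _ "[]"] by (auto simp: indicator_def fun_eq_iff)
  finally show i: "integrable lborel \<phi>" .
  have m: "\<phi> \<in> lborel \<rightarrow>\<^sub>M borel" using smooth_fun_borel[OF L(1)] by simp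
  show "integrable lebesgue \<phi>" using i m by (simp add: integrable_completion)
  show "integral\<^sup>L lebesgue \<phi> = integral\<^sup>L lborel \<phi>" using m by (simp add: integral_completion)
qed

lemma integrable_lebesgue_onI: "S \<in> sets lebesgue \<Longrightarrow> integrable lebesgue f \<Longrightarrow> integrable (lebesgue_on S) f"
  for f :: "'a::euclidean_space \<Rightarrow> 'b::euclidean_space"
  by (simp add: integrable_restrict_space integrable_mult_indicator)

lemma integrable_test_function_mult:
  assumes S: "open S" and u: "locally_integrable S u" and \<phi>: "\<phi> \<in> test_functions S"
  shows "integrable (lebesgue_on S) (\<lambda>x. u x * \<phi> x)"
proof -
  from test_functionsE[OF \<phi>] obtain L where L: "smooth_fun \<phi>" "compact L" "L \<subseteq> S"
    "\<And>x js. x \<notin> L \<Longrightarrow> partials js \<phi> x = 0" by blast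
  from test_functions_bounded[OF \<phi>] obtain c where c: "\<And>x. \<bar>\<phi> x\<bar> \<le> c" by blast
  have "integrable (lebesgue_on L) (\<lambda>x. u x * \<phi> x)"
    using u L c unfolding locally_integrable_def
    by (intro integrable_mult_bounded smooth_fun_measurable_lebesgue_on) auto
  then show ?thesis
    using L L(4)[of _ "[]"] S
    by (subst lebesgue_on_support(1)[of S L]) (auto intro: lmeasurable_compact fmeasurableD)
qed

lemma locally_integrable_continuous:
  assumes "continuous_on UNIV f"
  shows "locally_integrable S f"
  unfolding locally_integrable_def
proof (intro allI impI, elim conjE)
  fix L :: "(real^'a) set" assume L: "compact L"
  have "integrable lborel (\<lambda>x. indicator L x *\<^sub>R f x)"
    using L assms continuous_on_subset by (intro borel_integrable_compact) auto
  then have "integrable lebesgue (\<lambda>x. indicator L x *\<^sub>R f x)"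
    using integrable_completion[OF borel_measurable_integrable] by blast
  then show "integrable (lebesgue_on L) f"
    using L by (simp add: integrable_restrict_space lmeasurable_compact fmeasurableD)
qed

lemma locally_integrable_diff:
  "locally_integrable S u \<Longrightarrow> locally_integrable S v \<Longrightarrow> locally_integrable S (\<lambda>x. u x - v x)"
  and locally_integrable_mult: "locally_integrable S u \<Longrightarrow> locally_integrable S (\<lambda>x. c * u x)"
  by (auto simp: locally_integrable_def)

lemma locally_integrable_subset: "T \<subseteq> S \<Longrightarrow> locally_integrable S u \<Longrightarrow> locally_integrable T u"
  by (auto simp: locally_integrable_def)

lemma locally_integrable_L2:
  assumes "S \<in> sets lebesgue" "u \<in> L2 S"
  shows "locally_integrable S u"
  unfolding locally_integrable_def
proof (intro allI impI, elim conjE)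
  fix L :: "(real^'a) set" assume L: "compact L" "L \<subseteq> S"
  then have Ll: "L \<in> lmeasurable" by (simp add: lmeasurable_compact)
  show "integrable (lebesgue_on L) u"
    by (rule L2_integrable[OF Ll L2_subset[OF assms(1) _ L(2) assms(2)]]) (use Ll in auto)
qed

lemma smooth_fun_line_derivative:
  assumes "smooth_fun f"
  shows "((\<lambda>t. f (x + t *\<^sub>R axis i 1)) has_field_derivative partial i f (x + t *\<^sub>R axis i 1)) (at t)"
proof -
  let ?y = "x + t *\<^sub>R axis i 1"
  have "(f has_derivative frechet_derivative f (at ?y)) (at ?y)"
    using smooth_fun_differentiable[OF assms] by (simp add: frechet_derivative_works[symmetric])
  moreover have "((\<lambda>t. x + t *\<^sub>R axis i 1) has_derivative (\<lambda>h. h *\<^sub>R axis i 1)) (at t)"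
    by (auto intro!: derivative_eq_intros)
  ultimately have "((\<lambda>t. f (x + t *\<^sub>R axis i 1)) has_derivative
      (\<lambda>h. frechet_derivative f (at ?y) (h *\<^sub>R axis i 1))) (at t)"
    using has_derivative_compose[of "\<lambda>t. x + t *\<^sub>R axis i 1" "\<lambda>h. h *\<^sub>R axis i 1" t UNIV f] by simp
  moreover have "(\<lambda>h. frechet_derivative f (at ?y) (h *\<^sub>R axis i 1)) = (\<lambda>h. partial i f ?y * h)"
    using linear_frechet_derivative[OF smooth_fun_differentiable[OF assms]]
    by (simp add: linear_cmul partial_def fun_eq_iff)
  ultimately show ?thesis by (simp add: has_field_derivative_def)
qed

text \<open>Difference quotients have integral zero by translation invariance of Lebesgue measure;
  they are uniformly bounded with supports in one compact set, so the limit has integral zero as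
  well.\<close>

lemma integral_partial_test_function:
  assumes \<phi>: "\<phi> \<in> test_functions S"
  shows "(\<integral>x. partial i \<phi> x \<partial>lebesgue) = 0"
proof -
  from test_functionsE[OF \<phi>] obtain L where L: "smooth_fun \<phi>" "compact L" "L \<subseteq> S"
    "\<And>x js. x \<notin> L \<Longrightarrow> partials js \<phi> x = 0" by blast
  have p\<phi>: "partial i \<phi> \<in> test_functions S" using test_functions_partials[OF \<phi>, of "[i]"] by simp
  from test_functions_bounded[OF p\<phi>] obtain c where c: "\<And>x. \<bar>partial i \<phi> x\<bar> \<le> c" by blast
  define h where "h = (\<lambda>n. 1 / real (Suc n))"
  define e :: "real^'a" where "e = axis i 1"
  define s where "s = (\<lambda>n x. (\<phi> (h n *\<^sub>R e + x) - \<phi> x) / h n)"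
  \<comment> \<open>All steps satisfy h n \<le> 1, so the unit enlargement of the support carries
    every difference quotient.\<close>
  define L' where "L' = {x + y | x y. x \<in> L \<and> y \<in> cball 0 1}"
  have L': "compact L'" unfolding L'_def using L(2) by (intro compact_sums compact_cball)
  have ne: "norm e = 1" by (simp add: e_def)
  have h: "0 < h n" "h n \<le> 1" for n by (auto simp: h_def)
  have trans_int: "integrable lborel (\<lambda>x. \<phi> (v + x))"
    and trans: "(\<integral>x. \<phi> (v + x) \<partial>lborel) = (\<integral>x. \<phi> x \<partial>lborel)" for v
  proof -
    have mm: "(+) v \<in> lborel \<rightarrow>\<^sub>M borel" "\<phi> \<in> borel_measurable borel"
      using smooth_fun_borel[OF L(1)] by auto
    have "integrable (distr lborel borel ((+) v)) \<phi>"
      using test_functions_integrable(1)[OF \<phi>] by (simp add: lborel_distr_plus)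
    then show "integrable lborel (\<lambda>x. \<phi> (v + x))" using integrable_distr[OF mm(1)] by blast
    show "(\<integral>x. \<phi> (v + x) \<partial>lborel) = (\<integral>x. \<phi> x \<partial>lborel)"
      using integral_distr[OF mm] by (simp add: lborel_distr_plus)
  qed
  have s0: "(\<integral>x. s n x \<partial>lborel) = 0" for n
    unfolding s_def using trans_int[of "h n *\<^sub>R e"] test_functions_integrable(1)[OF \<phi>]
    by (simp add: trans)
  have "(\<lambda>n. \<integral>x. s n x \<partial>lborel) \<longlonglongrightarrow> (\<integral>x. partial i \<phi> x \<partial>lborel)"
  proof (rule integral_dominated_convergence)
    show "partial i \<phi> \<in> borel_measurable lborel"
      using smooth_fun_borel[OF test_functions_smooth[OF p\<phi>]] by simp
    show "s n \<in> borel_measurable lborel" for n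
      unfolding s_def using borel_measurable_integrable[OF trans_int[of "h n *\<^sub>R e"]]
        borel_measurable_integrable[OF test_functions_integrable(1)[OF \<phi>]] by simp
    show "integrable lborel (\<lambda>x. indicator L' x *\<^sub>R c)"
      using L' by (intro borel_integrable_compact continuous_on_const)
    show "AE x in lborel. (\<lambda>n. s n x) \<longlonglongrightarrow> partial i \<phi> x"
    proof (rule AE_I2)
      fix x
      have "((\<lambda>t. (\<phi> (x + t *\<^sub>R e) - \<phi> x) / t) \<longlongrightarrow> partial i \<phi> x) (at 0)"
        using smooth_fun_line_derivative[OF L(1), of x i 0]
        by (simp add: has_field_derivative_iff e_def)
      moreover have "filterlim h (at 0) sequentially"
        unfolding filterlim_at using h(1) LIMSEQ_inverse_real_of_nat
        by (auto simp: h_def inverse_eq_divide less_le intro!: always_eventually)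
      ultimately have "(\<lambda>n. (\<phi> (x + h n *\<^sub>R e) - \<phi> x) / h n) \<longlonglongrightarrow> partial i \<phi> x"
        by (rule filterlim_compose)
      then show "(\<lambda>n. s n x) \<longlonglongrightarrow> partial i \<phi> x" by (simp add: s_def add.commute)
    qed
    show "AE x in lborel. norm (s n x) \<le> indicator L' x *\<^sub>R c" for n
    proof (rule AE_I2)
      fix x
      obtain z where z: "\<phi> (x + h n *\<^sub>R e) - \<phi> (x + 0 *\<^sub>R e) = (h n - 0) * partial i \<phi> (x + z *\<^sub>R e)"
        using MVT2[OF h(1)[of n], of "\<lambda>t. \<phi> (x + t *\<^sub>R e)" "\<lambda>t. partial i \<phi> (x + t *\<^sub>R e)"]
          smooth_fun_line_derivative[OF L(1), of x i] unfolding e_def by blast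
      then have "s n x = partial i \<phi> (x + z *\<^sub>R e)"
        using h(1)[of n] by (simp add: s_def add.commute)
      then have "\<bar>s n x\<bar> \<le> c" using c by simp
      moreover have "s n x = 0" if "x \<notin> L'"
      proof -
        have "x \<notin> L" using that by (force simp: L'_def)
        moreover have "x + h n *\<^sub>R e \<notin> L"
        proof
          assume "x + h n *\<^sub>R e \<in> L"
          moreover have "x = (x + h n *\<^sub>R e) + (- (h n *\<^sub>R e))" by simp
          moreover have "- (h n *\<^sub>R e) \<in> cball 0 1" using h[of n] ne by simp
          ultimately show False using that unfolding L'_def by blast
        qed
        ultimately show ?thesis using L(4)[of _ "[]"] by (simp add: s_def add.commute)
      qed
      ultimately show "norm (s n x) \<le> indicator L' x *\<^sub>R c" by (auto simp: indicator_def)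
    qed
  qed
  then have "(\<integral>x. partial i \<phi> x \<partial>lborel) = 0" by (simp add: s0 LIMSEQ_const_iff)
  then show ?thesis using test_functions_integrable(3)[OF p\<phi>] by simp
qed

lemma integral_lebesgue_on_test_function:
  assumes "open S" "\<phi> \<in> test_functions S"
  shows "(LINT x|lebesgue_on S. \<phi> x) = (\<integral>x. \<phi> x \<partial>lebesgue)"
proof -
  from test_functionsE[OF assms(2)] obtain L where L: "smooth_fun \<phi>" "compact L" "L \<subseteq> S"
    "\<And>x js. x \<notin> L \<Longrightarrow> partials js \<phi> x = 0" by blast
  have "(LINT x|lebesgue_on UNIV. \<phi> x) = (LINT x|lebesgue_on S. \<phi> x)"
    by (rule lebesgue_on_support(2)) (use L L(4)[of _ "[]"] assms(1) in auto)
  then show ?thesis by (simp add: lebesgue_on_UNIV_eq)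
qed

lemma test_function_integration_by_parts:
  assumes S: "open S" and f: "smooth_fun f" and \<phi>: "\<phi> \<in> test_functions S"
  shows "(LINT x|lebesgue_on S. f x * partial i \<phi> x) = - (LINT x|lebesgue_on S. partial i f x * \<phi> x)"
proof -
  have p\<phi>: "partial i \<phi> \<in> test_functions S" using test_functions_partials[OF \<phi>, of "[i]"] by simp
  have t: "(\<lambda>x. f x * \<phi> x) \<in> test_functions S" by (rule test_functions_mult[OF \<phi> f])
  have t': "partial i (\<lambda>x. f x * \<phi> x) \<in> test_functions S"
    using test_functions_partials[OF t, of "[i]"] by simp
  have eq: "partial i (\<lambda>x. f x * \<phi> x) = (\<lambda>x. f x * partial i \<phi> x + partial i f x * \<phi> x)"
    using f test_functions_smooth[OF \<phi>] by (intro partial_mult smooth_fun_differentiable)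
  have 1: "(\<lambda>x. f x * partial i \<phi> x) \<in> test_functions S" by (rule test_functions_mult[OF p\<phi> f])
  have 2: "(\<lambda>x. partial i f x * \<phi> x) \<in> test_functions S"
    by (rule test_functions_mult[OF \<phi> smooth_fun_partial[OF f]])
  have "0 = (LINT x|lebesgue_on S. f x * partial i \<phi> x + partial i f x * \<phi> x)"
    using integral_partial_test_function[OF t, of i]
      integral_lebesgue_on_test_function[OF S t'] unfolding eq by simp
  also have "\<dots> = (LINT x|lebesgue_on S. f x * partial i \<phi> x) + (LINT x|lebesgue_on S. partial i f x * \<phi> x)"
    using 1 2 test_functions_integrable(2) S
    by (intro Bochner_Integration.integral_add integrable_lebesgue_onI) auto
  finally show ?thesis by simp
qed

text \<open>Integration by parts removes the outermost direction of \<open>partials js\<close>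
  first, and on \<open>f\<close> that direction is applied first, hence innermost. This is the
  reason for \<open>rev\<close>.\<close>

lemma is_weak_deriv_smooth:
  assumes S: "open S" and f: "smooth_fun f"
  shows "is_weak_deriv S js f (partials (rev js) f)"
proof -
  have "\<forall>\<phi>\<in>test_functions S. (LINT x|lebesgue_on S. f x * partials js \<phi> x)
      = (- 1) ^ length js * (LINT x|lebesgue_on S. partials (rev js) f x * \<phi> x)"
    using f
  proof (induction js arbitrary: f)
    case (Cons i js)
    show ?case
    proof
      fix \<phi> assume \<phi>: "\<phi> \<in> test_functions S"
      have "(LINT x|lebesgue_on S. f x * partials (i # js) \<phi> x)
          = - (LINT x|lebesgue_on S. partial i f x * partials js \<phi> x)"
        using test_function_integration_by_parts[OF S Cons.prems test_functions_partials[OF \<phi>]] by simp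
      also have "\<dots> = - ((- 1) ^ length js * (LINT x|lebesgue_on S. partials (rev js) (partial i f) x * \<phi> x))"
        using Cons.IH[OF smooth_fun_partial[OF Cons.prems]] \<phi> by simp
      also have "partials (rev js) (partial i f) = partials (rev (i # js)) f"
        by (simp add: partials_append)
      finally show "(LINT x|lebesgue_on S. f x * partials (i # js) \<phi> x)
          = (- 1) ^ length (i # js) * (LINT x|lebesgue_on S. partials (rev (i # js)) f x * \<phi> x)"
        by simp
    qed
  qed simp
  then show ?thesis
    unfolding is_weak_deriv_def using f smooth_fun_partials[OF f]
    by (auto intro!: locally_integrable_continuous smooth_fun_continuous)
qed

section \<open>The fundamental lemma and weak derivatives\<close>

lemma compact_in_sets_lebesgue: "compact S \<Longrightarrow> S \<in> sets lebesgue"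
  by (simp add: lmeasurable_compact fmeasurableD)

text \<open>The common compact \<open>L\<close> is the point: it lets dominated convergence work
  with a merely locally integrable factor. The functions are near 1 on \<open>C\<close> up to 1 / (k
  + 1) and supported in neighbourhoods of radius e / (k + 1), which gives the limit both on and off
  \<open>C\<close>.\<close>

lemma test_functions_tendsto_indicator:
  fixes C S :: "(real^'d::finite) set"
  assumes C: "compact C" and S: "open S" "C \<subseteq> S"
  obtains \<psi> L where "compact L" "L \<subseteq> S" "C \<subseteq> L" "\<And>k. \<psi> k \<in> test_functions S"
    "\<And>k x. 0 \<le> \<psi> k x" "\<And>k x. \<psi> k x \<le> 1" "\<And>k x. x \<notin> L \<Longrightarrow> \<psi> k x = 0"
    "\<And>x. (\<lambda>k::nat. \<psi> k x) \<longlonglongrightarrow> indicator C x"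
proof -
  obtain e where e: "e > 0" "(\<Union>x\<in>C. cball x e) \<subseteq> S"
    using compact_subset_open_imp_cball_epsilon_subset[OF C S] by blast
  define L where "L = {x + y | x y. x \<in> C \<and> y \<in> cball 0 e}"
  have L: "compact L" unfolding L_def using C by (intro compact_sums compact_cball)
  have LU: "L = (\<Union>x\<in>C. cball x e)"
  proof (intro equalityI subsetI)
    fix z assume "z \<in> (\<Union>x\<in>C. cball x e)"
    then obtain x where "x \<in> C" "z \<in> cball x e" by blast
    then have "z = x + (z - x)" "x \<in> C" "z - x \<in> cball 0 e"
      by (auto simp: dist_norm norm_minus_commute)
    then show "z \<in> L" unfolding L_def by blast
  next
    fix z assume "z \<in> L"
    then obtain x y where "x \<in> C" "y \<in> cball 0 e" "z = x + y" unfolding L_def by blast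
    then have "z \<in> cball x e" by (simp add: dist_norm)
    then show "z \<in> (\<Union>x\<in>C. cball x e)" using \<open>x \<in> C\<close> by blast
  qed
  define U where "U = (\<lambda>k::nat. \<Union>x\<in>C. ball x (e / Suc k))"
  have U: "open (U k)" "C \<subseteq> U k" for k using e(1) by (auto simp: U_def)
  have UL: "U k \<subseteq> L" for k
  proof -
    have "e / Suc k \<le> e" using e(1) by (simp add: field_simps)
    then show ?thesis unfolding U_def LU by force
  qed
  have "\<exists>\<phi>. \<phi> \<in> test_functions (U k) \<and> (\<forall>x. 0 \<le> \<phi> x) \<and> (\<forall>x. \<phi> x \<le> 1) \<and>
      (\<forall>x\<in>C. 1 - 1 / Suc k \<le> \<phi> x)" for k
    using test_function_near_indicator[OF C U(1)[of k] U(2)[of k], of "1 / Suc k"] by (metis of_nat_0_less_iff zero_less_Suc zero_less_divide_1_iff)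
  then obtain \<psi> where \<psi>: "\<And>k. \<psi> k \<in> test_functions (U k)" "\<And>k x. 0 \<le> \<psi> k x" "\<And>k x. \<psi> k x \<le> 1"
      "\<And>k x. x \<in> C \<Longrightarrow> 1 - 1 / Suc k \<le> \<psi> k x" by metis
  have z: "\<psi> k x = 0" if "x \<notin> U k" for k x
    using \<psi>(1)[of k] that closure_subset[of "{x. \<psi> k x \<noteq> 0}"] by (auto simp: test_functions_def)
  show ?thesis
  proof (rule that[OF L])
    show LS: "L \<subseteq> S" using e LU by simp
    show "C \<subseteq> L" unfolding LU using e(1) by force
    show "\<psi> k \<in> test_functions S" for k
      using \<psi>(1) test_functions_mono[of "U k" S] UL[of k] LS by blast
    show "0 \<le> \<psi> k x" "\<psi> k x \<le> 1" for k x by (rule \<psi>)+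
    show "\<psi> k x = 0" if "x \<notin> L" for k x using z UL that by blast
    show "(\<lambda>k. \<psi> k x) \<longlonglongrightarrow> indicator C x" for x
    proof (cases "x \<in> C")
      case True
      have "(\<lambda>k. 1 - 1 / real (Suc k)) \<longlonglongrightarrow> 1 - 0"
        by (intro tendsto_intros LIMSEQ_inverse_real_of_nat[unfolded inverse_eq_divide])
      then have "(\<lambda>k. \<psi> k x) \<longlonglongrightarrow> 1"
        using \<psi>(3)[of _ x] \<psi>(4)[OF True]
        by (intro tendsto_sandwich[of "\<lambda>k. 1 - 1 / real (Suc k)" "\<lambda>k. \<psi> k x" sequentially "\<lambda>_. 1" 1]
            always_eventually allI) simp_all
      then show ?thesis using True by simp
    next
      case False
      have "open (- C)" using C by (simp add: compact_imp_closed open_Compl)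
      then obtain r where r: "r > 0" "ball x r \<subseteq> - C" using False openE by blast
      have "(\<lambda>k. e * (1 / real (Suc k))) \<longlonglongrightarrow> e * 0"
        by (intro tendsto_intros LIMSEQ_inverse_real_of_nat[unfolded inverse_eq_divide])
      then have "\<forall>\<^sub>F k in sequentially. e * (1 / real (Suc k)) < r"
        using r(1) by (simp add: order_tendstoD(2))
      then have "\<forall>\<^sub>F k in sequentially. \<psi> k x = 0"
      proof eventually_elim
        case (elim k)
        have "x \<notin> U k"
        proof
          assume "x \<in> U k"
          then obtain c where "c \<in> C" "dist c x < e / Suc k" by (auto simp: U_def)
          then have "c \<in> ball x r" using elim by (simp add: dist_commute)
          then show False using r(2) \<open>c \<in> C\<close> by auto
        qed
        then show ?case by (rule z)
      qed
      then have "(\<lambda>k. \<psi> k x) \<longlonglongrightarrow> 0" by (rule tendsto_eventually)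
      then show ?thesis using False by simp
    qed
  qed
qed

text \<open>Approximating indicators by test functions gives a nonpositive integral of
  \<open>v\<close> over every compact subset. If {v > 0} had positive measure inside some compact
  set, inner regularity would supply a compact subset of positive measure on which \<open>v\<close>
  is positive.\<close>

lemma AE_nonpos_of_test_functions:
  fixes S :: "(real^'d::finite) set"
  assumes S: "open S" and v: "locally_integrable S v"
    and le: "\<And>\<phi>. \<phi> \<in> test_functions S \<Longrightarrow> (\<And>x. 0 \<le> \<phi> x) \<Longrightarrow> (LINT x|lebesgue_on S. v x * \<phi> x) \<le> 0"
  shows "AE x in lebesgue_on S. v x \<le> 0"
proof -
  have comp: "(LINT x|lebesgue_on C. v x) \<le> 0" if C: "compact C" "C \<subseteq> S" for C
  proof -
    obtain \<psi> L where L: "compact L" "L \<subseteq> S" "C \<subseteq> L" and \<psi>: "\<And>k. \<psi> k \<in> test_functions S"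
      "\<And>k x. 0 \<le> \<psi> k x" "\<And>k x. \<psi> k x \<le> 1" "\<And>k x. x \<notin> L \<Longrightarrow> \<psi> k x = 0"
      "\<And>x. (\<lambda>k::nat. \<psi> k x) \<longlonglongrightarrow> indicator C x"
      using test_functions_tendsto_indicator[OF C(1) S C(2)] by metis
    have Ls: "L \<in> sets lebesgue" "C \<in> sets lebesgue" using L C by (auto intro: compact_in_sets_lebesgue)
    have vL: "integrable (lebesgue_on L) v" using v L by (simp add: locally_integrable_def)
    have "(\<lambda>k. LINT x|lebesgue_on L. v x * \<psi> k x) \<longlonglongrightarrow> (LINT x|lebesgue_on L. v x * indicator C x)"
    proof (rule integral_dominated_convergence[where w = "\<lambda>x. \<bar>v x\<bar>"])
      show "(\<lambda>x. v x * indicator C x) \<in> borel_measurable (lebesgue_on L)"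
        using vL Ls by (intro borel_measurable_times borel_measurable_indicator)
          (auto simp: sets_restrict_space_iff L(3))
      show "(\<lambda>x. v x * \<psi> k x) \<in> borel_measurable (lebesgue_on L)" for k
        using vL smooth_fun_measurable_lebesgue_on[OF test_functions_smooth[OF \<psi>(1)]] by simp
      show "AE x in lebesgue_on L. (\<lambda>k. v x * \<psi> k x) \<longlonglongrightarrow> v x * indicator C x"
        by (intro AE_I2 tendsto_intros \<psi>)
      show "AE x in lebesgue_on L. norm (v x * \<psi> k x) \<le> \<bar>v x\<bar>" for k
        using \<psi>(2,3)[of k] by (intro AE_I2) (auto simp: abs_mult intro!: mult_left_le)
    qed (use vL in simp)
    moreover have "(LINT x|lebesgue_on L. v x * \<psi> k x) \<le> 0" for k
    proof -
      have "(LINT x|lebesgue_on S. v x * \<psi> k x) = (LINT x|lebesgue_on L. v x * \<psi> k x)"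
        by (rule lebesgue_on_support(2)) (use S Ls L \<psi>(4) in auto)
      then show ?thesis using le[OF \<psi>(1)[of k] \<psi>(2)[of k]] by simp
    qed
    ultimately have "(LINT x|lebesgue_on L. v x * indicator C x) \<le> 0"
      by (intro LIMSEQ_le_const2) auto
    also have "(LINT x|lebesgue_on L. v x * indicator C x) = (LINT x|lebesgue_on C. v x * indicator C x)"
      by (rule lebesgue_on_support(2)) (use Ls L in auto)
    also have "\<dots> = (LINT x|lebesgue_on C. v x)"
      by (rule Bochner_Integration.integral_cong) (auto simp: space_restrict_space)
    finally show ?thesis .
  qed
  have K: "AE x in lebesgue_on K. v x \<le> 0" if K: "compact K" "K \<subseteq> S" for K
  proof -
    let ?A = "{x \<in> K. v x > 0}"
    have Ks: "K \<in> sets lebesgue" using K by (simp add: compact_in_sets_lebesgue)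
    have vK: "integrable (lebesgue_on K) v" using v K by (simp add: locally_integrable_def)
    have "{x \<in> space (lebesgue_on K). v x > 0} \<in> sets (lebesgue_on K)"
      using vK by (intro borel_measurable_less) auto
    then have A: "?A \<in> sets lebesgue" using Ks by (simp add: space_restrict_space sets_restrict_space_iff)
    have "emeasure lebesgue ?A = 0"
    proof (rule ccontr)
      assume "emeasure lebesgue ?A \<noteq> 0"
      have fin: "?A \<in> lmeasurable" 
        by (rule bounded_set_imp_lmeasurable[OF bounded_subset[OF compact_imp_bounded[OF K(1)]] A]) auto
      define m where "m = measure lebesgue ?A"
      have em: "emeasure lebesgue ?A = ennreal m" using fin by (simp add: m_def emeasure_eq_measure2)
      then have "m > 0" using \<open>emeasure lebesgue ?A \<noteq> 0\<close> by (simp add: m_def zero_less_measure_iff)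
      \<comment> \<open>\<open>T\<close> misses less than the full measure m of the set. Once
        \<open>T\<close> is shown to be null, the missed part has measure m, a
        contradiction.\<close>
      from sets_lebesgue_inner_closed[OF A this]
      obtain T where T: "closed T" "T \<subseteq> ?A" and "?A - T \<in> lmeasurable"
        and "emeasure lebesgue (?A - T) < ennreal m" .
      note T = T this(4)
      have "bounded T" by (rule bounded_subset[OF compact_imp_bounded[OF K(1)]]) (use T(2) in auto)
      then have cT: "compact T" using T(1) by (simp add: compact_eq_bounded_closed)
      have Ts: "T \<in> sets lebesgue" using cT by (rule compact_in_sets_lebesgue)
      have vT: "integrable (lebesgue_on T) v" using v K T cT by (auto simp: locally_integrable_def)
      have pos: "AE x in lebesgue_on T. 0 \<le> v x"
        using AE_in_lebesgue_on[of T] by eventually_elim (use T in auto)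
      have "(LINT x|lebesgue_on T. v x) = 0"
        using comp[OF cT] T K integral_nonneg_AE[OF pos] by force
      then have "AE x in lebesgue_on T. v x = 0"
        using integral_nonneg_eq_0_iff_AE[OF vT pos] by simp
      then have "AE x in lebesgue_on T. False"
        using AE_in_lebesgue_on[of T] by eventually_elim (use T in auto)
      then have "AE x in lebesgue. x \<notin> T" using Ts by (simp add: AE_lebesgue_on_iff)
      then have T0: "T \<in> null_sets lebesgue" using AE_iff_null_sets[OF Ts] by simp
      have "emeasure lebesgue ?A = emeasure lebesgue (?A - T)"
        using emeasure_Diff_null_set[OF T0 A] by simp
      then show False using T(3) em by simp
    qed
    then have "?A \<in> null_sets lebesgue" using A by auto
    from AE_not_in[OF this] show ?thesis
      unfolding AE_lebesgue_on_iff[OF Ks] by eventually_elim auto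
  qed
  obtain C where C: "\<And>n::nat. compact (C n)" "\<And>n. C n \<subseteq> S" "\<Union>(range C) = S"
    using open_Union_compact_subsets[OF S] by metis
  have "AE x in lebesgue. \<forall>n. x \<in> C n \<longrightarrow> v x \<le> 0"
    unfolding AE_all_countable
    using K[OF C(1,2)] C(1) by (simp add: AE_lebesgue_on_iff compact_in_sets_lebesgue)
  then show ?thesis
    using S C(3) by (subst AE_lebesgue_on_iff) (auto elim!: eventually_mono)
qed

lemma fundamental_lemma:
  fixes S :: "(real^'d::finite) set"
  assumes S: "open S" and v: "locally_integrable S v"
    and z: "\<And>\<phi>. \<phi> \<in> test_functions S \<Longrightarrow> (LINT x|lebesgue_on S. v x * \<phi> x) = 0"
  shows "AE x in lebesgue_on S. v x = 0"
proof -
  have 1: "AE x in lebesgue_on S. v x \<le> 0"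
    using z by (intro AE_nonpos_of_test_functions[OF S v]) auto
  have 2: "AE x in lebesgue_on S. -1 * v x \<le> 0"
    by (rule AE_nonpos_of_test_functions[OF S locally_integrable_mult[OF v]]) (use z in simp)
  from 1 2 show ?thesis by eventually_elim simp
qed

text \<open>Duality between L1 and Linf, reduced to the one-sided statement for v - c and -v - c.
  Nonnegative test functions suffice, so their L1 norm is simply the integral.\<close>

lemma AE_le_of_test_functions:
  fixes S :: "(real^'d::finite) set"
  assumes S: "open S" and v: "locally_integrable S v"
    and le: "\<And>\<phi>. \<phi> \<in> test_functions S \<Longrightarrow> (\<And>x. 0 \<le> \<phi> x) \<Longrightarrow>
      \<bar>LINT x|lebesgue_on S. v x * \<phi> x\<bar> \<le> c * (LINT x|lebesgue_on S. \<phi> x)"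
  shows "AE x in lebesgue_on S. \<bar>v x\<bar> \<le> c"
proof -
  have cc: "locally_integrable S (\<lambda>x. c)" by (intro locally_integrable_continuous continuous_on_const)
  have eq: "(LINT x|lebesgue_on S. (s * v x - c) * \<phi> x)
      = s * (LINT x|lebesgue_on S. v x * \<phi> x) - c * (LINT x|lebesgue_on S. \<phi> x)"
    if "\<phi> \<in> test_functions S" for s \<phi>
    using integrable_test_function_mult[OF S v that] integrable_test_function_mult[OF S cc that]
      Bochner_Integration.integral_diff[of "lebesgue_on S" "\<lambda>x. s * (v x * \<phi> x)" "\<lambda>x. c * \<phi> x"]
    by (simp add: algebra_simps)
  have "AE x in lebesgue_on S. s * v x - c \<le> 0" if s: "s = 1 \<or> s = -1" for s
  proof (rule AE_nonpos_of_test_functions[OF S])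
    show "locally_integrable S (\<lambda>x. s * v x - c)"
      by (intro locally_integrable_diff locally_integrable_mult v cc)
    fix \<phi> assume \<phi>: "\<phi> \<in> test_functions S" "\<And>x. 0 \<le> \<phi> x"
    show "(LINT x|lebesgue_on S. (s * v x - c) * \<phi> x) \<le> 0"
      using le[OF \<phi>] s unfolding eq[OF \<phi>(1)] by auto
  qed
  from this[OF disjI1[OF refl]] this[OF disjI2[OF refl]] show ?thesis by eventually_elim auto
qed

section \<open>Weak derivatives: uniqueness, restriction, Sobolev norms\<close>

lemma is_weak_deriv_locally_integrable:
  "is_weak_deriv S js u v \<Longrightarrow> locally_integrable S u"
  "is_weak_deriv S js u v \<Longrightarrow> locally_integrable S v"
  by (auto simp: is_weak_deriv_def)

lemma is_weak_deriv_unique: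
  assumes S: "open S" and v: "is_weak_deriv S js u v" and w: "is_weak_deriv S js u w"
  shows "AE x in lebesgue_on S. v x = w x"
proof -
  have lv: "locally_integrable S v" and lw: "locally_integrable S w"
    using v w by (auto simp: is_weak_deriv_def)
  have "AE x in lebesgue_on S. v x - w x = 0"
  proof (rule fundamental_lemma[OF S locally_integrable_diff[OF lv lw]])
    fix \<phi> assume \<phi>: "\<phi> \<in> test_functions S"
    have "(LINT x|lebesgue_on S. (v x - w x) * \<phi> x)
        = (LINT x|lebesgue_on S. v x * \<phi> x) - (LINT x|lebesgue_on S. w x * \<phi> x)"
      unfolding left_diff_distrib
      by (intro Bochner_Integration.integral_diff integrable_test_function_mult S lv lw \<phi>)
    also have "(- 1) ^ length js * \<dots> = (0::real)"
      using v w \<phi> by (simp add: is_weak_deriv_def right_diff_distrib)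
    finally show "(LINT x|lebesgue_on S. (v x - w x) * \<phi> x) = 0" by simp
  qed
  then show ?thesis by eventually_elim simp
qed

text \<open>Ties the representative picked by \<open>SOME\<close> in \<open>weak_deriv\<close> to
  any weak derivative known explicitly.\<close>

lemma weak_deriv_AE:
  assumes "open S" "is_weak_deriv S js u v"
  shows "AE x in lebesgue_on S. weak_deriv S js u x = v x"
    and "is_weak_deriv S js u (weak_deriv S js u)"
proof -
  show "is_weak_deriv S js u (weak_deriv S js u)"
    unfolding weak_deriv_def using assms(2) by (rule someI[where P = "is_weak_deriv S js u"])
  from is_weak_deriv_unique[OF assms(1) this assms(2)]
  show "AE x in lebesgue_on S. weak_deriv S js u x = v x" .
qed

lemma is_weak_deriv_Nil: "locally_integrable S u \<Longrightarrow> is_weak_deriv S [] u u"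
  by (simp add: is_weak_deriv_def)

lemma is_weak_deriv_subset:
  assumes S: "open S" and T: "open T" "T \<subseteq> S" and v: "is_weak_deriv S js u v"
  shows "is_weak_deriv T js u v"
  unfolding is_weak_deriv_def
proof (intro conjI ballI)
  show "locally_integrable T u" "locally_integrable T v"
    using v T locally_integrable_subset by (auto simp: is_weak_deriv_def)
  fix \<phi> assume \<phi>: "\<phi> \<in> test_functions T"
  from test_functionsE[OF \<phi>] obtain L where L: "smooth_fun \<phi>" "compact L" "L \<subseteq> T"
    "\<And>x js. x \<notin> L \<Longrightarrow> partials js \<phi> x = 0" by blast
  have z: "\<phi> x = 0" "partials js \<phi> x = 0" if "x \<notin> T" for x
    using L(3) L(4)[of x "[]"] L(4)[of x js] that by auto
  have "(LINT x|lebesgue_on S. u x * partials js \<phi> x) = (LINT x|lebesgue_on T. u x * partials js \<phi> x)"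
    by (rule lebesgue_on_support(2)) (use S T z in auto)
  moreover have "(LINT x|lebesgue_on S. v x * \<phi> x) = (LINT x|lebesgue_on T. v x * \<phi> x)"
    by (rule lebesgue_on_support(2)) (use S T z in auto)
  ultimately show "(LINT x|lebesgue_on T. u x * partials js \<phi> x)
      = (- 1) ^ length js * (LINT x|lebesgue_on T. v x * \<phi> x)"
    using v \<phi> test_functions_mono[OF T(2)] by (auto simp: is_weak_deriv_def)
qed

lemma is_weak_deriv_diff_mult:
  assumes S: "open S" and v: "is_weak_deriv S js u v" and v': "is_weak_deriv S js u' v'"
  shows "is_weak_deriv S js (\<lambda>x. u x - c * u' x) (\<lambda>x. v x - c * v' x)"
  unfolding is_weak_deriv_def
proof (intro conjI ballI)
  note l = is_weak_deriv_locally_integrable[OF v] is_weak_deriv_locally_integrable[OF v']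
  show "locally_integrable S (\<lambda>x. u x - c * u' x)" "locally_integrable S (\<lambda>x. v x - c * v' x)"
    by (intro locally_integrable_diff locally_integrable_mult l)+
  have eq: "(LINT x|lebesgue_on S. (u x - c * u' x) * \<phi> x)
      = (LINT x|lebesgue_on S. u x * \<phi> x) - c * (LINT x|lebesgue_on S. u' x * \<phi> x)"
    if "\<phi> \<in> test_functions S" "locally_integrable S u" "locally_integrable S u'" for \<phi> u u'
    using integrable_test_function_mult[OF S that(2,1)] integrable_test_function_mult[OF S that(3,1)]
      Bochner_Integration.integral_diff[of "lebesgue_on S" "\<lambda>x. u x * \<phi> x" "\<lambda>x. c * (u' x * \<phi> x)"]
    by (simp add: algebra_simps)
  fix \<phi> assume \<phi>: "\<phi> \<in> test_functions S"
  show "(LINT x|lebesgue_on S. (u x - c * u' x) * partials js \<phi> x)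
      = (- 1) ^ length js * (LINT x|lebesgue_on S. (v x - c * v' x) * \<phi> x)"
    using v v' \<phi> by (simp add: eq l test_functions_partials is_weak_deriv_def right_diff_distrib mult.left_commute)
qed

lemma Hk_weak_deriv:
  assumes S: "open S" and u: "u \<in> Hk k S" and js: "length js \<le> k"
  shows "is_weak_deriv S js u (weak_deriv S js u)" "weak_deriv S js u \<in> L2 S"
proof -
  obtain v where v: "v \<in> L2 S" "is_weak_deriv S js u v" using u js by (auto simp: Hk_def)
  show "is_weak_deriv S js u (weak_deriv S js u)" using weak_deriv_AE[OF S v(2)] by simp
  show "weak_deriv S js u \<in> L2 S"
    using L2_cong_AE[OF _ weak_deriv_AE(1)[OF S v(2)]] v(1) S by simp
qed

lemma finite_lists_le: "finite {js :: 'd::finite list. length js \<le> k}"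
  using finite_lists_length_le[of "UNIV :: 'd set" k] by simp

lemma L2_norm_weak_deriv_le_Hk_norm:
  assumes "length js \<le> k"
  shows "L2_norm S (weak_deriv S js u) \<le> Hk_norm k S u"
proof -
  have "(L2_norm S (weak_deriv S js u))\<^sup>2 \<le> (\<Sum>js\<in>{js. length js \<le> k}. (L2_norm S (weak_deriv S js u))\<^sup>2)"
    using assms by (intro member_le_sum finite_lists_le) auto
  then show ?thesis unfolding Hk_norm_def by (intro real_le_rsqrt)
qed

lemma L2_norm_le_Hk_norm:
  assumes "open S" "u \<in> L2 S"
  shows "L2_norm S u \<le> Hk_norm k S u"
proof -
  have "L2_norm S u = L2_norm S (weak_deriv S [] u)"
    using weak_deriv_AE(1)[OF assms(1) is_weak_deriv_Nil[OF locally_integrable_L2[OF _ assms(2)]]] assms(1)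
    by (intro L2_norm_cong_AE[symmetric]) auto
  then show ?thesis using L2_norm_weak_deriv_le_Hk_norm[of "[]"] by simp
qed

lemma Hk_norm_mono: "k \<le> l \<Longrightarrow> Hk_norm k S u \<le> Hk_norm l S u"
  unfolding Hk_norm_def
  by (intro real_sqrt_le_mono sum_mono2 finite_lists_le) auto

lemma Hk_norm_nonneg: "0 \<le> Hk_norm k S u"
  by (simp add: Hk_norm_def sum_nonneg)

lemma Hk_mono: "k \<le> l \<Longrightarrow> Hk l S \<subseteq> Hk k S"
  by (auto simp: Hk_def)

lemma test_functions_L2:
  assumes "open S" "\<phi> \<in> test_functions S"
  shows "\<phi> \<in> L2 S"
proof -
  have "(\<lambda>x. \<phi> x * \<phi> x) \<in> test_functions S"
    by (rule test_functions_mult[OF assms(2) test_functions_smooth[OF assms(2)]])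
  then have "integrable (lebesgue_on S) (\<lambda>x. \<phi> x * \<phi> x)"
    using assms(1) by (intro integrable_lebesgue_onI test_functions_integrable(2)) auto
  then show ?thesis
    using smooth_fun_measurable_lebesgue_on[OF test_functions_smooth[OF assms(2)]]
    by (simp add: L2_def power2_eq_square)
qed

lemma test_functions_in_H20:
  assumes S: "open S" and \<phi>: "\<phi> \<in> test_functions S"
  shows "\<phi> \<in> H20 S"
proof -
  have "\<exists>v\<in>L2 S. is_weak_deriv S js \<phi> v" for js
    using is_weak_deriv_smooth[OF S test_functions_smooth[OF \<phi>], of js]
      test_functions_L2[OF S test_functions_partials[OF \<phi>]] by blast
  then have "\<phi> \<in> Hk 2 S" using test_functions_L2[OF S \<phi>] by (simp add: Hk_def)
  moreover have "Hk_norm 2 S (\<lambda>x. \<phi> x - \<phi> x) = 0"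
  proof -
    have 0: "is_weak_deriv S js (\<lambda>x. 0) (\<lambda>x. 0)" for js
      using locally_integrable_continuous[of "\<lambda>x. 0" S] by (simp add: is_weak_deriv_def)
    have "L2_norm S (weak_deriv S js (\<lambda>x. 0)) = L2_norm S (\<lambda>x. 0 :: real)" for js
      using S weak_deriv_AE(1)[OF S 0] by (intro L2_norm_cong_AE) auto
    then have "L2_norm S (weak_deriv S js (\<lambda>x. 0)) = 0" for js by (simp add: L2_norm_def)
    then show ?thesis by (simp add: Hk_norm_def)
  qed
  ultimately show ?thesis unfolding H20_def using \<phi> by (auto intro!: bexI[of _ \<phi>])
qed

section \<open>Density of test functions in the space of square-integrable functions\<close>

lemma tendsto_0_imp_ex_le:
  fixes X :: "nat \<Rightarrow> real"
  assumes "X \<longlonglongrightarrow> 0" "e > 0"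
  shows "\<exists>k. X k \<le> e"
proof -
  obtain N where "\<And>n. n \<ge> N \<Longrightarrow> norm (X n - 0) < e" using LIMSEQ_D[OF assms] by blast
  from this[of N] have "X N \<le> e" by simp
  then show ?thesis ..
qed

text \<open>Membership in the L2 closure of the test functions, as a predicate stable under sums,
  multiples and limits; this leads from indicators over simple functions to all of L2.\<close>

definition test_approximable :: "(real^'d::finite) set \<Rightarrow> (real^'d \<Rightarrow> real) \<Rightarrow> bool" where
  "test_approximable S f \<longleftrightarrow> f \<in> L2 S \<and> (\<forall>e>0. \<exists>\<phi>\<in>test_functions S. L2_norm S (\<lambda>x. f x - \<phi> x) \<le> e)"

lemma test_approximable_limit:
  assumes S: "open S" and f: "f \<in> L2 S"
    and ap: "\<And>e. e > 0 \<Longrightarrow> \<exists>g. test_approximable S g \<and> L2_norm S (\<lambda>x. f x - g x) \<le> e"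
  shows "test_approximable S f"
  unfolding test_approximable_def
proof (intro conjI allI impI f)
  fix e :: real assume "e > 0"
  then obtain g where g: "test_approximable S g" "L2_norm S (\<lambda>x. f x - g x) \<le> e / 2"
    using ap[of "e / 2"] by auto
  then obtain \<phi> where \<phi>: "\<phi> \<in> test_functions S" "L2_norm S (\<lambda>x. g x - \<phi> x) \<le> e / 2"
    using \<open>e > 0\<close> unfolding test_approximable_def by (metis half_gt_zero)
  have gL: "g \<in> L2 S" using g by (simp add: test_approximable_def)
  have "L2_norm S (\<lambda>x. (f x - g x) + (g x - \<phi> x)) \<le> L2_norm S (\<lambda>x. f x - g x) + L2_norm S (\<lambda>x. g x - \<phi> x)"
    by (intro L2_norm_triangle L2_diff f gL test_functions_L2[OF S \<phi>(1)])
  also have "\<dots> \<le> e" using g \<phi> by simp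
  finally show "\<exists>\<phi>\<in>test_functions S. L2_norm S (\<lambda>x. f x - \<phi> x) \<le> e"
    using \<phi>(1) by (auto intro!: bexI[of _ \<phi>])
qed

lemma test_approximable_add:
  assumes S: "open S" and f: "test_approximable S f" and g: "test_approximable S g"
  shows "test_approximable S (\<lambda>x. f x + g x)"
  unfolding test_approximable_def
proof (intro conjI allI impI)
  have fL: "f \<in> L2 S" and gL: "g \<in> L2 S" using f g by (auto simp: test_approximable_def)
  then show "(\<lambda>x. f x + g x) \<in> L2 S" by (rule L2_add)
  fix e :: real assume "e > 0"
  then obtain \<phi> \<psi> where \<phi>: "\<phi> \<in> test_functions S" "L2_norm S (\<lambda>x. f x - \<phi> x) \<le> e / 2"
    and \<psi>: "\<psi> \<in> test_functions S" "L2_norm S (\<lambda>x. g x - \<psi> x) \<le> e / 2"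
    using f g unfolding test_approximable_def by (metis half_gt_zero)
  have "L2_norm S (\<lambda>x. (f x - \<phi> x) + (g x - \<psi> x)) \<le> L2_norm S (\<lambda>x. f x - \<phi> x) + L2_norm S (\<lambda>x. g x - \<psi> x)"
    by (intro L2_norm_triangle L2_diff fL gL test_functions_L2[OF S] \<phi> \<psi>)
  also have "\<dots> \<le> e" using \<phi> \<psi> by simp
  also have "(\<lambda>x. (f x - \<phi> x) + (g x - \<psi> x)) = (\<lambda>x. (f x + g x) - (\<phi> x + \<psi> x))"
    by (auto simp: algebra_simps)
  finally show "\<exists>\<phi>\<in>test_functions S. L2_norm S (\<lambda>x. (f x + g x) - \<phi> x) \<le> e"
    using test_functions_add[OF \<phi>(1) \<psi>(1)] by (intro bexI[of _ "\<lambda>x. \<phi> x + \<psi> x"])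
qed

lemma test_approximable_mult:
  assumes S: "open S" and f: "test_approximable S f"
  shows "test_approximable S (\<lambda>x. c * f x)"
  unfolding test_approximable_def
proof (intro conjI allI impI)
  show "(\<lambda>x. c * f x) \<in> L2 S" using f by (auto simp: test_approximable_def intro: L2_mult)
  fix e :: real assume "e > 0"
  then have "e / (\<bar>c\<bar> + 1) > 0" by (simp add: divide_pos_pos add_nonneg_pos)
  then obtain \<phi> where \<phi>: "\<phi> \<in> test_functions S" "L2_norm S (\<lambda>x. f x - \<phi> x) \<le> e / (\<bar>c\<bar> + 1)"
    using f unfolding test_approximable_def by blast
  have "L2_norm S (\<lambda>x. c * f x - c * \<phi> x) = \<bar>c\<bar> * L2_norm S (\<lambda>x. f x - \<phi> x)"
    by (subst L2_norm_mult[symmetric]) (simp add: right_diff_distrib)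
  also have "\<dots> \<le> \<bar>c\<bar> * (e / (\<bar>c\<bar> + 1))" using \<phi>(2) by (intro mult_left_mono) auto
  also have "\<dots> \<le> e" using \<open>e > 0\<close> by (simp add: field_simps)
  finally show "\<exists>\<phi>\<in>test_functions S. L2_norm S (\<lambda>x. c * f x - \<phi> x) \<le> e"
    using test_functions_mult[OF \<phi>(1) smooth_fun_const, of c] by (intro bexI[of _ "\<lambda>x. c * \<phi> x"])
qed

lemma test_approximable_sum:
  assumes S: "open S" and f: "\<And>i. i \<in> I \<Longrightarrow> test_approximable S (f i)"
  shows "test_approximable S (\<lambda>x. \<Sum>i\<in>I. f i x)"
proof -
  have 0: "test_approximable S (\<lambda>x. 0)"
  proof -
    have "(\<lambda>x. 0) \<in> test_functions S" by (rule test_functionsI[of _ "{}"]) auto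
    then show ?thesis
      by (auto simp: test_approximable_def L2_zero L2_norm_def intro!: bexI[of _ "\<lambda>x. 0"])
  qed
  from f show ?thesis
  proof (induction I rule: infinite_finite_induct)
    case (insert i I)
    then show ?case using test_approximable_add[OF S, of "f i" "\<lambda>x. \<Sum>i\<in>I. f i x"] by simp
  qed (simp_all add: 0)
qed

lemma L2_dominated_convergence:
  fixes f :: "'a::euclidean_space \<Rightarrow> real"
  assumes w: "w \<in> L2 S" and f: "f \<in> borel_measurable (lebesgue_on S)"
    and s: "\<And>k. s k \<in> borel_measurable (lebesgue_on S)"
    and lim: "AE x in lebesgue_on S. (\<lambda>k. s k x) \<longlonglongrightarrow> f x"
    and le: "\<And>k. AE x in lebesgue_on S. \<bar>f x - s k x\<bar> \<le> \<bar>w x :: real\<bar>"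
  shows "(\<lambda>k. L2_norm S (\<lambda>x. f x - s k x)) \<longlonglongrightarrow> 0"
proof -
  have "(\<lambda>k. LINT x|lebesgue_on S. (norm (f x - s k x))\<^sup>2) \<longlonglongrightarrow> (LINT x|lebesgue_on S. 0)"
  proof (rule integral_dominated_convergence[where w = "\<lambda>x. (norm (w x))\<^sup>2"])
    show "AE x in lebesgue_on S. (\<lambda>k. (norm (f x - s k x))\<^sup>2) \<longlonglongrightarrow> 0"
      using lim
    proof eventually_elim
      case (elim x)
      have "(\<lambda>k. (norm (f x - s k x))\<^sup>2) \<longlonglongrightarrow> (norm (f x - f x))\<^sup>2"
        by (intro tendsto_intros elim)
      then show ?case by simp
    qed
    show "AE x in lebesgue_on S. norm ((norm (f x - s k x))\<^sup>2) \<le> (norm (w x))\<^sup>2" for k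
      using le[of k] by eventually_elim (auto simp: abs_le_square_iff[symmetric])
  qed (use L2_D[OF w] f s in auto)
  from tendsto_real_sqrt[OF this] show ?thesis by (simp add: L2_norm_def)
qed

lemma test_approximable_indicator:
  assumes S: "open S" "bounded S" and A: "A \<in> sets lebesgue" "A \<subseteq> S"
  shows "test_approximable S (indicator A)"
proof (rule test_approximable_limit[OF S(1)])
  have Sm: "S \<in> lmeasurable" using S by (simp add: lmeasurable_open)
  have ind: "indicat_real B \<in> L2 S" if "B \<in> sets lebesgue" for B
  proof (rule L2_bounded[OF Sm, of _ 1])
    show "indicat_real B \<in> borel_measurable (lebesgue_on S)"
      using that by (intro measurable_restrict_space1 borel_measurable_indicator)
  qed (auto simp: indicator_def)
  show "indicat_real A \<in> L2 S" using A ind by simp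
  fix e :: real assume e: "e > 0"
  \<comment> \<open>The tolerance is squared because the L2 norm of an indicator is the square root
    of the measure.\<close>
  from sets_lebesgue_inner_closed[OF A(1), of "e\<^sup>2"] e
  obtain T where T: "closed T" "T \<subseteq> A" "A - T \<in> lmeasurable"
    and Te: "emeasure lebesgue (A - T) < ennreal (e\<^sup>2)" by (metis zero_less_power)
  have "compact T" using T S A bounded_subset[OF S(2)] by (simp add: compact_eq_bounded_closed)
  have Ts: "T \<in> sets lebesgue" using T(1) by simp
  obtain \<psi> L where \<psi>: "\<And>k. \<psi> k \<in> test_functions S"
    "\<And>k x. 0 \<le> \<psi> k x" "\<And>k x. \<psi> k x \<le> 1"
    "\<And>x. (\<lambda>k::nat. \<psi> k x) \<longlonglongrightarrow> indicator T x"
    using test_functions_tendsto_indicator[OF \<open>compact T\<close> S(1)] T(2) A(2) by (metis subset_trans)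
  have "(\<lambda>k. L2_norm S (\<lambda>x. indicator T x - \<psi> k x)) \<longlonglongrightarrow> 0"
  proof (rule L2_dominated_convergence[where w = "\<lambda>x. 1"])
    show "(\<lambda>x. 1) \<in> L2 S" by (rule L2_const[OF Sm])
    show "indicat_real T \<in> borel_measurable (lebesgue_on S)" using ind[OF Ts] by (rule L2_D)
    show "\<psi> k \<in> borel_measurable (lebesgue_on S)" for k
      by (rule smooth_fun_measurable_lebesgue_on[OF test_functions_smooth[OF \<psi>(1)]])
    show "AE x in lebesgue_on S. \<bar>indicator T x - \<psi> k x\<bar> \<le> \<bar>1\<bar>" for k
      using \<psi>(2,3)[of k] by (intro AE_I2) (auto simp: indicator_def)
  qed (use \<psi>(4) in auto)
  then have lim: "\<exists>k. L2_norm S (\<lambda>x. indicator T x - \<psi> k x) \<le> e'" if "e' > 0" for e'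
    by (rule tendsto_0_imp_ex_le[OF _ that])
  have "test_approximable S (indicator T)"
    unfolding test_approximable_def using ind[OF Ts] lim \<psi>(1) by blast
  moreover have "L2_norm S (\<lambda>x. indicat_real A x - indicator T x) \<le> e"
  proof -
    have "(LINT x|lebesgue_on S. (norm (indicat_real A x - indicator T x))\<^sup>2) = (LINT x|lebesgue_on S. indicator (A - T) x)"
      using T(2) by (intro Bochner_Integration.integral_cong) (auto simp: indicator_def)
    also have "\<dots> = measure lebesgue (A - T)"
    proof -
      have "(A - T) \<inter> S = A - T" using A(2) by auto
      moreover have "measure (lebesgue_on S) (A - T) = measure lebesgue (A - T)"
        by (rule measure_restrict_space) (use S A in auto)
      ultimately show ?thesis
        using S A Ts by (simp add: space_restrict_space Int_commute)
    qed
    also have "\<dots> \<le> e\<^sup>2"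
    proof -
      have "ennreal (measure lebesgue (A - T)) < ennreal (e\<^sup>2)"
        using Te T(3) by (simp add: emeasure_eq_measure2)
      then show ?thesis by (simp add: ennreal_less_iff)
    qed
    finally have "(L2_norm S (\<lambda>x. indicat_real A x - indicator T x))\<^sup>2 \<le> e\<^sup>2"
      unfolding L2_norm_square .
    then show ?thesis by (rule power2_le_imp_le) (use e in simp)
  qed
  ultimately show "\<exists>g. test_approximable S g \<and> L2_norm S (\<lambda>x. indicator A x - g x) \<le> e" by blast
qed

lemma test_approximable_L2:
  assumes S: "open S" "bounded S" and f: "f \<in> L2 S"
  shows "test_approximable S f"
proof (rule test_approximable_limit[OF S(1) f])
  have Sm: "S \<in> sets lebesgue" using S by simp
  fix e :: real assume e: "e > 0"
  have fm: "f \<in> borel_measurable (lebesgue_on S)" using f by (rule L2_D)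
  obtain F where F0: "\<forall>i. simple_function (lebesgue_on S) (F i)"
    "\<forall>x\<in>S. (\<lambda>i::nat. F i x) \<longlonglongrightarrow> f x" "\<forall>i. \<forall>x\<in>S. \<bar>F i x\<bar> \<le> 2 * \<bar>f x\<bar>"
    using borel_measurable_implies_sequence_metric[OF fm, of 0] by (auto simp: space_restrict_space)
  then have F: "\<And>i. simple_function (lebesgue_on S) (F i)"
    "\<And>x. x \<in> S \<Longrightarrow> (\<lambda>i. F i x) \<longlonglongrightarrow> f x" "\<And>i x. x \<in> S \<Longrightarrow> \<bar>F i x\<bar> \<le> 2 * \<bar>f x\<bar>"
    by auto
  have ap: "test_approximable S (F i)" for i
  proof -
    let ?Y = "F i ` S"
    let ?A = "\<lambda>y. F i -` {y} \<inter> S"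
    have fin: "finite ?Y" using F(1)[of i] by (simp add: simple_function_def space_restrict_space)
    have A: "?A y \<in> sets lebesgue" if "y \<in> ?Y" for y
      using F(1)[of i] that Sm by (auto simp: simple_function_def space_restrict_space sets_restrict_space_iff)
    have s: "test_approximable S (\<lambda>x. \<Sum>y\<in>?Y. y * indicator (?A y) x)"
      by (intro test_approximable_sum test_approximable_mult test_approximable_indicator S) (use A in auto)
    have "(\<Sum>y\<in>?Y. y * indicator (?A y) x) = F i x" if "x \<in> S" for x
    proof -
      have "(\<Sum>y\<in>?Y. y * indicator (?A y) x) = (\<Sum>y\<in>?Y. if y = F i x then y else 0)"
        using that by (intro sum.cong) (auto simp: indicator_def)
      also have "\<dots> = F i x" using fin that by simp
      finally show ?thesis .
    qed
    then have ae: "AE x in lebesgue_on S. (\<Sum>y\<in>?Y. y * indicator (?A y) x) = F i x"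
      by (intro AE_I2) (simp add: space_restrict_space)
    have "L2_norm S (\<lambda>x. (\<Sum>y\<in>?Y. y * indicator (?A y) x) - \<phi> x) = L2_norm S (\<lambda>x. F i x - \<phi> x)" for \<phi>
      by (rule L2_norm_cong_AE[OF Sm]) (use ae in eventually_elim, simp)
    then show ?thesis
      using s L2_cong_AE[OF Sm ae] by (simp add: test_approximable_def)
  qed
  \<comment> \<open>The simple functions satisfy |F k| \<le> 2 |f|, so 3 |f| dominates the
    difference.\<close>
  have "(\<lambda>k. L2_norm S (\<lambda>x. f x - F k x)) \<longlonglongrightarrow> 0"
  proof (rule L2_dominated_convergence[where w = "\<lambda>x. 3 * f x"])
    show "(\<lambda>x. 3 * f x) \<in> L2 S" using f by (rule L2_mult)
    show "F k \<in> borel_measurable (lebesgue_on S)" for k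
      using F(1) by (rule borel_measurable_simple_function)
    show "AE x in lebesgue_on S. (\<lambda>k. F k x) \<longlonglongrightarrow> f x"
      using F(2) by (intro AE_I2) (simp add: space_restrict_space)
    show "AE x in lebesgue_on S. \<bar>f x - F k x\<bar> \<le> \<bar>3 * f x\<bar>" for k
    proof (rule AE_I2)
      fix x assume "x \<in> space (lebesgue_on S)"
      then have "\<bar>F k x\<bar> \<le> 2 * \<bar>f x\<bar>" using F(3) by (simp add: space_restrict_space)
      then show "\<bar>f x - F k x\<bar> \<le> \<bar>3 * f x\<bar>" by (simp add: abs_mult)
    qed
  qed fact
  then obtain k where "L2_norm S (\<lambda>x. f x - F k x) \<le> e"
    using tendsto_0_imp_ex_le[OF _ e] by meson
  then show "\<exists>g. test_approximable S g \<and> L2_norm S (\<lambda>x. f x - g x) \<le> e" using ap by blast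
qed

text \<open>Self-duality of L2: testing with \<open>f\<close> itself would give |f|^2 \<le> c |f|. A
  test function within e of \<open>f\<close> gives the same up to an error linear in e, which then
  tends to 0.\<close>

lemma L2_norm_le_of_test_functions:
  assumes S: "open S" "bounded S" and f: "f \<in> L2 S" and c: "0 \<le> c"
    and le: "\<And>\<phi>. \<phi> \<in> test_functions S \<Longrightarrow> \<bar>LINT x|lebesgue_on S. f x * \<phi> x\<bar> \<le> c * L2_norm S \<phi>"
  shows "L2_norm S f \<le> c"
proof -
  let ?N = "L2_norm S f"
  have bound: "?N\<^sup>2 \<le> c * ?N + (c + ?N) * e" if e: "e > 0" for e
  proof -
    obtain \<phi> where \<phi>: "\<phi> \<in> test_functions S" "L2_norm S (\<lambda>x. f x - \<phi> x) \<le> e"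
      using test_approximable_L2[OF S f] e unfolding test_approximable_def by blast
    have \<phi>L: "\<phi> \<in> L2 S" by (rule test_functions_L2[OF S(1) \<phi>(1)])
    have d: "(\<lambda>x. f x - \<phi> x) \<in> L2 S" by (rule L2_diff[OF f \<phi>L])
    have 1: "\<bar>L2_inner S f \<phi>\<bar> \<le> c * L2_norm S \<phi>" using le[OF \<phi>(1)] by (simp add: L2_inner_def)
    have "L2_norm S \<phi> = L2_norm S (\<lambda>x. f x - (f x - \<phi> x))" by simp
    also have "\<dots> \<le> ?N + L2_norm S (\<lambda>x. f x - \<phi> x)" by (rule L2_norm_diff[OF f d])
    finally have 2: "c * L2_norm S \<phi> \<le> c * (?N + e)" using \<phi>(2) c by (intro mult_left_mono) auto
    have "\<bar>L2_inner S (\<lambda>x. f x - \<phi> x) f\<bar> \<le> L2_norm S (\<lambda>x. f x - \<phi> x) * ?N"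
      by (rule L2_Cauchy_Schwarz[OF d f])
    also have "\<dots> \<le> e * ?N" using \<phi>(2) by (intro mult_right_mono) auto
    finally have 3: "\<bar>L2_inner S (\<lambda>x. f x - \<phi> x) f\<bar> \<le> e * ?N" .
    have "?N\<^sup>2 = L2_inner S f \<phi> + L2_inner S (\<lambda>x. f x - \<phi> x) f"
      using L2_inner_diff_left[OF f \<phi>L f] by (simp add: L2_inner_self L2_inner_commute[of S \<phi>])
    also have "\<dots> \<le> c * (?N + e) + e * ?N" using 1 2 3 by linarith
    finally show ?thesis by (simp add: algebra_simps)
  qed
  have "?N\<^sup>2 \<le> c * ?N + e" if "e > 0" for e
  proof (cases "c + ?N = 0")
    case False
    then have p: "c + ?N > 0" using c by (simp add: less_le)
    have "?N\<^sup>2 \<le> c * ?N + (c + ?N) * (e / (c + ?N))"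
      using p that by (intro bound) simp
    then show ?thesis using False by simp
  qed (use that bound[OF that] in simp)
  then have "?N\<^sup>2 \<le> c * ?N" by (rule field_le_epsilon)
  then show ?thesis
  proof (cases "?N = 0")
    case False
    then have "?N > 0" by (simp add: less_le)
    with \<open>?N\<^sup>2 \<le> c * ?N\<close> show ?thesis by (simp add: power2_eq_square)
  qed (use c in simp)
qed

section \<open>Rescaling test functions\<close>

lemma lebesgue_affine_map:
  fixes b :: "'a::euclidean_space"
  assumes s: "s > 0"
  shows "(\<lambda>x. s *\<^sub>R x + b) \<in> lebesgue \<rightarrow>\<^sub>M lebesgue"
    and "lebesgue = density (distr lebesgue lebesgue (\<lambda>x. s *\<^sub>R x + b)) (\<lambda>_. ennreal (s ^ DIM('a)))"
proof -
  have eq: "(\<lambda>x. b + (\<Sum>j\<in>Basis. (s * (x \<bullet> j)) *\<^sub>R j)) = (\<lambda>x. s *\<^sub>R x + b)"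
  proof
    fix x :: 'a
    have "(\<Sum>j\<in>Basis. (s * (x \<bullet> j)) *\<^sub>R j) = s *\<^sub>R (\<Sum>j\<in>Basis. (x \<bullet> j) *\<^sub>R j)"
      by (simp add: scaleR_sum_right)
    then show "b + (\<Sum>j\<in>Basis. (s * (x \<bullet> j)) *\<^sub>R j) = s *\<^sub>R x + b"
      by (simp add: euclidean_representation)
  qed
  show "(\<lambda>x. s *\<^sub>R x + b) \<in> lebesgue \<rightarrow>\<^sub>M lebesgue"
    using lebesgue_affine_measurable[of "\<lambda>_. s" b] s unfolding eq by simp
  show "lebesgue = density (distr lebesgue lebesgue (\<lambda>x. s *\<^sub>R x + b)) (\<lambda>_. ennreal (s ^ DIM('a)))"
    using lebesgue_affine_euclidean[of "\<lambda>_. s" b] s unfolding eq by simp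
qed

lemma integral_lebesgue_affine:
  fixes f :: "'a::euclidean_space \<Rightarrow> real"
  assumes s: "s > 0" and f: "f \<in> borel_measurable lebesgue"
  shows "(\<integral>x. f x \<partial>lebesgue) = s ^ DIM('a) * (\<integral>x. f (s *\<^sub>R x + b) \<partial>lebesgue)"
    and "integrable lebesgue f \<longleftrightarrow> integrable lebesgue (\<lambda>x. f (s *\<^sub>R x + b))"
proof -
  let ?T = "\<lambda>x::'a. s *\<^sub>R x + b"
  have T: "?T \<in> lebesgue \<rightarrow>\<^sub>M lebesgue" using s by (rule lebesgue_affine_map)
  have f': "f \<in> borel_measurable (distr lebesgue lebesgue ?T)" using f by simp
  have "(\<integral>x. f x \<partial>lebesgue) = (\<integral>x. f x \<partial>density (distr lebesgue lebesgue ?T) (\<lambda>_. ennreal (s ^ DIM('a))))"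
    using lebesgue_affine_map(2)[OF s, of b] by simp
  also have "\<dots> = (\<integral>x. s ^ DIM('a) *\<^sub>R f x \<partial>distr lebesgue lebesgue ?T)"
    using s by (intro integral_density f') auto
  also have "\<dots> = (\<integral>x. s ^ DIM('a) *\<^sub>R f (?T x) \<partial>lebesgue)"
    using f by (intro integral_distr T) auto
  finally show "(\<integral>x. f x \<partial>lebesgue) = s ^ DIM('a) * (\<integral>x. f (s *\<^sub>R x + b) \<partial>lebesgue)" by simp
  have "integrable lebesgue f \<longleftrightarrow> integrable (density (distr lebesgue lebesgue ?T) (\<lambda>_. ennreal (s ^ DIM('a)))) f"
    using lebesgue_affine_map(2)[OF s, of b] by simp
  also have "\<dots> \<longleftrightarrow> integrable (distr lebesgue lebesgue ?T) (\<lambda>x. s ^ DIM('a) *\<^sub>R f x)"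
    using s by (intro integrable_density f') auto
  also have "\<dots> \<longleftrightarrow> integrable (distr lebesgue lebesgue ?T) f"
    using s by simp
  also have "\<dots> \<longleftrightarrow> integrable lebesgue (\<lambda>x. f (?T x))"
    by (rule integrable_distr_eq[OF T f])
  finally show "integrable lebesgue f \<longleftrightarrow> integrable lebesgue (\<lambda>x. f (s *\<^sub>R x + b))" .
qed

lemma AE_lebesgue_affine:
  fixes b :: "'a::euclidean_space"
  assumes s: "s > 0" and ae: "AE x in lebesgue. P x"
  shows "AE x in lebesgue. P (s *\<^sub>R x + b)"
proof -
  let ?T = "\<lambda>x::'a. s *\<^sub>R x + b"
  have T: "?T \<in> lebesgue \<rightarrow>\<^sub>M lebesgue" using s by (rule lebesgue_affine_map)
  have "AE x in density (distr lebesgue lebesgue ?T) (\<lambda>_. ennreal (s ^ DIM('a))). P x"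
    using ae by (simp only: lebesgue_affine_map(2)[OF s, of b, symmetric])
  then have "AE x in distr lebesgue lebesgue ?T. P x"
    using s by (subst (asm) AE_density) auto
  then show ?thesis by (rule AE_distrD[OF T])
qed

text \<open>The mean value theorem bounds the difference quotients of \<open>F\<close> by c', so c'
  |g| dominates and differentiation passes under the integral.\<close>

lemma has_field_derivative_integral:
  fixes g :: "'a \<Rightarrow> real"
  assumes g: "integrable M g" and ab: "a < r" "r < b"
    and F: "\<And>r. F r \<in> borel_measurable M" "\<And>r x. a < r \<Longrightarrow> r < b \<Longrightarrow> \<bar>F r x\<bar> \<le> c"
    and D: "\<And>r x. a < r \<Longrightarrow> r < b \<Longrightarrow> ((\<lambda>r. F r x) has_field_derivative F' r x) (at r)"
    and F': "F' r \<in> borel_measurable M" "\<And>r x. a < r \<Longrightarrow> r < b \<Longrightarrow> \<bar>F' r x\<bar> \<le> c'"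
  shows "((\<lambda>r. \<integral>x. g x * F r x \<partial>M) has_field_derivative (\<integral>x. g x * F' r x \<partial>M)) (at r)"
proof -
  let ?S = "{a<..<b}"
  have int: "integrable M (\<lambda>x. g x * F y x)" if "y \<in> ?S" for y
    by (rule integrable_mult_bounded[OF g F(1)]) (use F(2) that in auto)
  have c'0: "0 \<le> c'" using F'(2)[OF ab] abs_ge_zero order_trans by blast
  have lip: "\<bar>F y x - F r x\<bar> \<le> c' * \<bar>y - r\<bar>" if yS: "y \<in> ?S" for y x
  proof -
    consider "y < r" | "y = r" | "r < y" by linarith
    then show ?thesis
    proof cases
      case 1
      obtain z where z: "y < z" "z < r" "F r x - F y x = (r - y) * F' z x"
        using MVT2[OF 1, of "\<lambda>r. F r x" "\<lambda>r. F' r x", OF D] ab yS by auto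
      have "\<bar>F' z x\<bar> \<le> c'" using F'(2) z ab yS by auto
      moreover have "\<bar>F y x - F r x\<bar> = \<bar>y - r\<bar> * \<bar>F' z x\<bar>"
        using z(3) by (simp add: abs_mult[symmetric] abs_minus_commute)
      ultimately show ?thesis by (simp add: mult.commute mult_right_mono)
    next
      case 3
      obtain z where z: "r < z" "z < y" "F y x - F r x = (y - r) * F' z x"
        using MVT2[OF 3, of "\<lambda>r. F r x" "\<lambda>r. F' r x", OF D] ab yS by auto
      have "\<bar>F' z x\<bar> \<le> c'" using F'(2) z ab yS by auto
      moreover have "\<bar>F y x - F r x\<bar> = \<bar>y - r\<bar> * \<bar>F' z x\<bar>"
        using z(3) by (simp add: abs_mult)
      ultimately show ?thesis by (simp add: mult.commute mult_right_mono)
    qed simp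
  qed
  have "((\<lambda>y. ((\<integral>x. g x * F y x \<partial>M) - (\<integral>x. g x * F r x \<partial>M)) / (y - r)) \<longlongrightarrow> (\<integral>x. g x * F' r x \<partial>M)) (at r within ?S)"
    unfolding tendsto_at_iff_sequentially
  proof (intro allI impI)
    fix X :: "nat \<Rightarrow> real" assume X: "\<forall>i. X i \<in> ?S - {r}" "X \<longlonglongrightarrow> r"
    have lim: "(\<lambda>n. \<integral>x. g x * ((F (X n) x - F r x) / (X n - r)) \<partial>M) \<longlonglongrightarrow> (\<integral>x. g x * F' r x \<partial>M)"
    proof (rule integral_dominated_convergence[where w = "\<lambda>x. c' * \<bar>g x\<bar>"])
      show "(\<lambda>x. g x * F' r x) \<in> borel_measurable M" using g F' by simp
      show "(\<lambda>x. g x * ((F (X n) x - F r x) / (X n - r))) \<in> borel_measurable M" for n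
        using g F(1) by simp
      show "integrable M (\<lambda>x. c' * \<bar>g x\<bar>)" using g by simp
      show "AE x in M. (\<lambda>n. g x * ((F (X n) x - F r x) / (X n - r))) \<longlonglongrightarrow> g x * F' r x"
      proof (intro AE_I2 tendsto_intros)
        fix x
        have "((\<lambda>y. (F y x - F r x) / (y - r)) \<longlongrightarrow> F' r x) (at r)"
          using D[OF ab, of x] by (simp add: has_field_derivative_iff)
        then show "(\<lambda>n. (F (X n) x - F r x) / (X n - r)) \<longlonglongrightarrow> F' r x"
          using X unfolding tendsto_at_iff_sequentially by (auto simp: o_def)
      qed
      show "AE x in M. norm (g x * ((F (X n) x - F r x) / (X n - r))) \<le> c' * \<bar>g x\<bar>" for n
      proof (rule AE_I2)
        fix x
        have "X n \<noteq> r" "X n \<in> ?S" using X by auto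
        then have "\<bar>(F (X n) x - F r x) / (X n - r)\<bar> \<le> c'"
          using lip[of "X n" x] by (simp add: pos_divide_le_eq)
        from mult_left_mono[OF this abs_ge_zero[of "g x"]]
        show "norm (g x * ((F (X n) x - F r x) / (X n - r))) \<le> c' * \<bar>g x\<bar>"
          by (simp only: real_norm_def abs_mult mult.commute[of c'])
      qed
    qed
    have eq: "(\<integral>x. g x * ((F (X n) x - F r x) / (X n - r)) \<partial>M)
        = ((\<integral>x. g x * F (X n) x \<partial>M) - (\<integral>x. g x * F r x \<partial>M)) / (X n - r)" for n
    proof -
      have "X n \<in> ?S" "r \<in> ?S" using X ab by auto
      from Bochner_Integration.integral_diff[OF int[OF this(1)] int[OF this(2)]]
      have "(\<integral>x. g x * F (X n) x \<partial>M) - (\<integral>x. g x * F r x \<partial>M) = (\<integral>x. g x * (F (X n) x - F r x) \<partial>M)"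
        by (simp add: right_diff_distrib)
      then show ?thesis by simp
    qed
    show "((\<lambda>y. ((\<integral>x. g x * F y x \<partial>M) - (\<integral>x. g x * F r x \<partial>M)) / (y - r)) \<circ> X)
        \<longlonglongrightarrow> (\<integral>x. g x * F' r x \<partial>M)"
      using lim unfolding eq o_def .
  qed
  moreover have "at r within ?S = at r" by (rule at_within_open) (use ab in auto)
  ultimately show ?thesis by (simp only: has_field_derivative_iff)
qed

lemma frechet_derivative_eq_sum_partial:
  assumes "f differentiable (at x)"
  shows "frechet_derivative f (at x) h = (\<Sum>i\<in>UNIV. h $ i * partial i f x)"
proof -
  have l: "linear (frechet_derivative f (at x))" using assms by (rule linear_frechet_derivative)
  have "frechet_derivative f (at x) h = frechet_derivative f (at x) (\<Sum>i\<in>UNIV. (h $ i) *\<^sub>R axis i 1)"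
    using basis_expansion[of h] by (simp add: scalar_mult_eq_scaleR)
  also have "\<dots> = (\<Sum>i\<in>UNIV. h $ i * partial i f x)"
    by (simp add: linear_sum[OF l] linear_cmul[OF l] partial_def)
  finally show ?thesis .
qed

text \<open>The pullback of a test function under the dilation by r about \<open>w\<close>. The
  power of r preserves the integral, so this is the adjoint of composition with the homothety of
  ratio 1 / r; for r \<ge> 1 supports move towards \<open>w\<close> and stay in a star-shaped
  set.\<close>

definition rescale :: "real^'d::finite \<Rightarrow> real \<Rightarrow> (real^'d \<Rightarrow> real) \<Rightarrow> real^'d \<Rightarrow> real" where
  "rescale w r \<phi> z = r ^ CARD('d) * \<phi> (r *\<^sub>R z + (w - r *\<^sub>R w))"

lemma rescale_test_function:
  fixes K :: "(real^'d::finite) set"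
  assumes star: "\<And>x. x \<in> K \<Longrightarrow> closed_segment w x \<subseteq> K" and \<phi>: "\<phi> \<in> test_functions K" and r: "r \<ge> 1"
  shows "rescale w r \<phi> \<in> test_functions K"
proof -
  from test_functionsE[OF \<phi>] obtain L where L: "smooth_fun \<phi>" "compact L" "L \<subseteq> K"
    "\<And>x js. x \<notin> L \<Longrightarrow> partials js \<phi> x = 0" by blast
  let ?L = "(\<lambda>y. w + (1 / r) *\<^sub>R (y - w)) ` L"
  show ?thesis
  proof (rule test_functionsI[of _ ?L])
    show "smooth_fun (rescale w r \<phi>)"
      unfolding rescale_def[abs_def] by (intro smooth_fun_mult smooth_fun_const smooth_fun_affine(1) L)
    show "compact ?L" using L(2) by (intro compact_continuous_image continuous_intros)
    show "?L \<subseteq> K"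
    proof
      fix z assume "z \<in> ?L"
      then obtain y where y: "y \<in> L" "z = w + (1 / r) *\<^sub>R (y - w)" by auto
      have "z = (1 - 1 / r) *\<^sub>R w + (1 / r) *\<^sub>R y" using y(2) by (simp add: algebra_simps)
      then have "z \<in> closed_segment w y" unfolding closed_segment_def using r by auto
      then show "z \<in> K" using star y(1) L(3) by blast
    qed
    show "rescale w r \<phi> z = 0" if z: "z \<notin> ?L" for z
    proof -
      have "r *\<^sub>R z + (w - r *\<^sub>R w) \<notin> L"
      proof
        assume a: "r *\<^sub>R z + (w - r *\<^sub>R w) \<in> L"
        have "z = w + (1 / r) *\<^sub>R ((r *\<^sub>R z + (w - r *\<^sub>R w)) - w)"
          using r by (simp add: algebra_simps)
        then show False using z a by blast
      qed
      then show ?thesis using L(4)[of _ "[]"] by (simp add: rescale_def)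
    qed
  qed
qed

text \<open>The rescaled functions satisfy the continuity equation
  \<open>r \<partial>\<^sub>r \<phi>\<^sub>r = div ((z - w) \<phi>\<^sub>r)\<close>, which turns the derivative of \<open>\<integral> g \<phi>\<^sub>r\<close> into an integral
  against the weak gradient of \<open>g\<close>.\<close>

lemma rescale_estimate:
  fixes K :: "(real^'d::finite) set"
  assumes K: "open K" and star: "\<And>x. x \<in> K \<Longrightarrow> closed_segment w x \<subseteq> K"
    and g: "integrable (lebesgue_on K) g"
    and wd: "\<And>i. is_weak_deriv K [i] g (G i)"
    and \<phi>: "\<phi> \<in> test_functions K" and R: "R > 1"
    and B: "\<And>r. 1 \<le> r \<Longrightarrow> r \<le> R \<Longrightarrow>
      \<bar>\<Sum>i\<in>UNIV. LINT z|lebesgue_on K. G i z * ((z $ i - w $ i) * rescale w r \<phi> z)\<bar> \<le> B"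
  shows "\<bar>(LINT z|lebesgue_on K. g z * rescale w R \<phi> z) - (LINT z|lebesgue_on K. g z * \<phi> z)\<bar> \<le> (R - 1) * B"
proof -
  let ?d = "CARD('d)"
  let ?y = "\<lambda>r z. r *\<^sub>R z + (w - r *\<^sub>R w)"
  have s\<phi>: "smooth_fun \<phi>" by (rule test_functions_smooth[OF \<phi>])
  \<comment> \<open>\<open>\<rho>\<close> is the divergence of (y - w) \<phi>(y). Since y - w = r (z
    - w) at the dilated point y, the r-derivative of r^d \<phi>(y) is r^(d-1) \<rho>(y), which is
    \<open>F'\<close>.\<close>
  define \<rho> where "\<rho> = (\<lambda>y. real ?d * \<phi> y + (\<Sum>i\<in>UNIV. (y $ i - w $ i) * partial i \<phi> y))"
  have \<rho>: "\<rho> \<in> test_functions K"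
    unfolding \<rho>_def
    by (intro test_functions_add test_functions_sum test_functions_mult \<phi> smooth_fun_const
        smooth_fun_diff smooth_fun_component) (use test_functions_partials[OF \<phi>, of "[i]" for i] in simp)
  obtain c where c: "0 \<le> c" "\<And>x. \<bar>\<phi> x\<bar> \<le> c" using test_functions_bounded[OF \<phi>] by blast
  obtain c' where c': "0 \<le> c'" "\<And>x. \<bar>\<rho> x\<bar> \<le> c'" using test_functions_bounded[OF \<rho>] by blast
  define F' where "F' = (\<lambda>r z. r ^ (?d - 1) * \<rho> (?y r z))"
  have d: "?d > 0" by simp
  have D: "((\<lambda>r. rescale w r \<phi> z) has_field_derivative F' r z) (at r)" for r z
  proof -
    have dy: "((\<lambda>r. ?y r z) has_derivative (\<lambda>h. h *\<^sub>R (z - w))) (at r)"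
      by (auto intro!: derivative_eq_intros simp: algebra_simps)
    have "((\<lambda>r. \<phi> (?y r z)) has_derivative (\<lambda>h. frechet_derivative \<phi> (at (?y r z)) (h *\<^sub>R (z - w)))) (at r)"
      using has_derivative_compose[OF dy] smooth_fun_differentiable[OF s\<phi>, of "?y r z"]
      by (simp add: frechet_derivative_works)
    moreover have "(\<lambda>h. frechet_derivative \<phi> (at (?y r z)) (h *\<^sub>R (z - w)))
        = (*) (\<Sum>i\<in>UNIV. (z $ i - w $ i) * partial i \<phi> (?y r z))"
      by (rule ext) (simp add: frechet_derivative_eq_sum_partial[OF smooth_fun_differentiable[OF s\<phi>]]
          sum_distrib_left mult_ac)
    ultimately have D1: "((\<lambda>r. \<phi> (?y r z)) has_field_derivative (\<Sum>i\<in>UNIV. (z $ i - w $ i) * partial i \<phi> (?y r z))) (at r)"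
      by (simp add: has_field_derivative_def)
    have "((\<lambda>r. r ^ ?d * \<phi> (?y r z)) has_field_derivative
        (real ?d * r ^ (?d - 1)) * \<phi> (?y r z) + (\<Sum>i\<in>UNIV. (z $ i - w $ i) * partial i \<phi> (?y r z)) * r ^ ?d) (at r)"
      by (rule DERIV_mult[OF _ D1]) (auto intro!: derivative_eq_intros)
    moreover have "r ^ ?d = r ^ (?d - 1) * r" using d by (metis Suc_diff_1 power_Suc2)
    moreover have "(?y r z) $ i - w $ i = r * (z $ i - w $ i)" for i by (simp add: algebra_simps)
    ultimately show ?thesis
      unfolding rescale_def F'_def \<rho>_def
      by (simp add: algebra_simps sum_distrib_left sum_distrib_right)
  qed
  define I where "I = (\<lambda>r. \<integral>z. g z * rescale w r \<phi> z \<partial>lebesgue_on K)"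
  have sm: "smooth_fun (rescale w r \<phi>)" for r
    unfolding rescale_def[abs_def] by (intro smooth_fun_mult smooth_fun_const smooth_fun_affine(1) s\<phi>)
  \<comment> \<open>On the open interval from 0 to R + 1 both endpoints 1 and R are interior, so the
    derivative is two-sided as the mean value theorem requires.\<close>
  have I: "(I has_field_derivative (\<integral>z. g z * F' r z \<partial>lebesgue_on K)) (at r)" if r: "0 < r" "r < R + 1" for r
    unfolding I_def
  proof (rule has_field_derivative_integral[OF g r])
    show "rescale w r \<phi> \<in> borel_measurable (lebesgue_on K)" for r
      by (rule smooth_fun_measurable_lebesgue_on[OF sm])
    show "\<bar>rescale w r \<phi> x\<bar> \<le> (R + 1) ^ ?d * c" if "0 < r" "r < R + 1" for r x
      unfolding rescale_def abs_mult using that c by (intro mult_mono) (auto intro: power_mono)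
    show "F' r \<in> borel_measurable (lebesgue_on K)" for r
      unfolding F'_def
      by (intro smooth_fun_measurable_lebesgue_on smooth_fun_mult smooth_fun_const smooth_fun_affine(1)
          test_functions_smooth[OF \<rho>])
    show "\<bar>F' r x\<bar> \<le> (R + 1) ^ (?d - 1) * c'" if "0 < r" "r < R + 1" for r x
      unfolding F'_def abs_mult using that c' by (intro mult_mono) (auto intro: power_mono)
    show "((\<lambda>r. rescale w r \<phi> x) has_field_derivative F' r x) (at r)" for r x by (rule D)
  qed
  have bound: "\<bar>\<integral>z. g z * F' r z \<partial>lebesgue_on K\<bar> \<le> B" if r: "1 \<le> r" "r \<le> R" for r
  proof -
    let ?\<chi> = "\<lambda>i z. (z $ i - w $ i) * rescale w r \<phi> z"
    have tr: "rescale w r \<phi> \<in> test_functions K" by (rule rescale_test_function[OF star \<phi> r(1)])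
    have t\<chi>: "?\<chi> i \<in> test_functions K" for i
      by (intro test_functions_mult tr smooth_fun_diff smooth_fun_const smooth_fun_component)
    have p\<chi>: "partial i (?\<chi> i) \<in> test_functions K" for i
      using test_functions_partials[OF t\<chi>, of "[i]"] by simp
    have sc: "smooth_fun (\<lambda>z. z $ i - w $ i)" for i :: 'd
      by (intro smooth_fun_diff smooth_fun_const smooth_fun_component)
    have pc: "partial i (\<lambda>z. z $ i - w $ i) z = 1" for i :: 'd and z
    proof -
      have "((\<lambda>z. z $ i - w $ i) has_derivative (\<lambda>h. h $ i)) (at z)"
        by (auto intro!: derivative_eq_intros bounded_linear.has_derivative[OF bounded_linear_vec_nth])
      from partial_eqI[OF this] show ?thesis by simp
    qed
    have pr: "partial i (rescale w r \<phi>) z = r ^ ?d * (r * partial i \<phi> (?y r z))" for i z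
      unfolding rescale_def[abs_def]
      by (subst partial_mult) (auto intro!: smooth_fun_differentiable smooth_fun_affine(1) s\<phi>
          simp: partial_const smooth_fun_affine(2)[OF s\<phi>])
    have p\<chi>_eq: "partial i (?\<chi> i) z = (z $ i - w $ i) * (r ^ ?d * (r * partial i \<phi> (?y r z))) + rescale w r \<phi> z" for i z
      using partial_mult[of "\<lambda>z. z $ i - w $ i" "rescale w r \<phi>" i]
      by (simp add: pc pr smooth_fun_differentiable[OF sc] smooth_fun_differentiable[OF sm])
    have "(\<Sum>i\<in>UNIV. partial i (?\<chi> i) z) = r * F' r z" for z
    proof -
      have "r * r ^ (?d - 1) = r ^ ?d" using d by (metis Suc_diff_1 power_Suc)
      then have "r * F' r z = r ^ ?d * \<rho> (?y r z)" by (simp add: F'_def mult.assoc[symmetric])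
      moreover have "(?y r z) $ i - w $ i = r * (z $ i - w $ i)" for i by (simp add: algebra_simps)
      moreover have "(\<Sum>i\<in>UNIV. partial i (?\<chi> i) z)
          = (\<Sum>i\<in>UNIV. (z $ i - w $ i) * (r ^ ?d * (r * partial i \<phi> (?y r z)))) + real ?d * rescale w r \<phi> z"
        by (simp only: p\<chi>_eq sum.distrib sum_constant)
      ultimately show ?thesis
        by (simp add: \<rho>_def rescale_def algebra_simps sum_distrib_left)
    qed
    then have "(\<integral>z. g z * (r * F' r z) \<partial>lebesgue_on K) = (\<integral>z. (\<Sum>i\<in>UNIV. g z * partial i (?\<chi> i) z) \<partial>lebesgue_on K)"
      by (simp add: sum_distrib_left[symmetric])
    also have "\<dots> = (\<Sum>i\<in>UNIV. \<integral>z. g z * partial i (?\<chi> i) z \<partial>lebesgue_on K)"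
      by (intro Bochner_Integration.integral_sum integrable_test_function_mult K p\<chi>
          is_weak_deriv_locally_integrable(1)[OF wd])
    also have "\<dots> = (\<Sum>i\<in>UNIV. - (\<integral>z. G i z * ?\<chi> i z \<partial>lebesgue_on K))"
      using wd t\<chi> by (intro sum.cong refl) (auto simp: is_weak_deriv_def)
    also have "\<bar>\<dots>\<bar> \<le> B" using B[OF r] by (simp add: sum_negf)
    finally have "\<bar>r * (\<integral>z. g z * F' r z \<partial>lebesgue_on K)\<bar> \<le> B"
      by (simp add: mult.left_commute[of _ r])
    then have "r * \<bar>\<integral>z. g z * F' r z \<partial>lebesgue_on K\<bar> \<le> B" using r by (simp add: abs_mult)
    \<comment> \<open>The divergence identity bounds r times the integral; r \<ge> 1 allows the
      factor to be dropped.\<close>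
    moreover have "\<bar>\<integral>z. g z * F' r z \<partial>lebesgue_on K\<bar> \<le> r * \<bar>\<integral>z. g z * F' r z \<partial>lebesgue_on K\<bar>"
      using r mult_right_mono[of 1 r "\<bar>\<integral>z. g z * F' r z \<partial>lebesgue_on K\<bar>"] by simp
    ultimately show ?thesis by linarith
  qed
  obtain z where z: "1 < z" "z < R" "I R - I 1 = (R - 1) * (\<integral>x. g x * F' z x \<partial>lebesgue_on K)"
    using MVT2[OF R, of I "\<lambda>r. \<integral>z. g z * F' r z \<partial>lebesgue_on K"] I by force
  have "\<bar>I R - I 1\<bar> = (R - 1) * \<bar>\<integral>x. g x * F' z x \<partial>lebesgue_on K\<bar>"
    using z R by (simp add: abs_mult)
  also have "\<dots> \<le> (R - 1) * B" using bound z R by (intro mult_left_mono) auto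
  finally show ?thesis by (simp add: I_def rescale_def[of w 1])
qed

section \<open>Contracting a weakly differentiable function towards a point\<close>

text \<open>The homothety with centre \<open>w\<close> and ratio 1 / \<open>R\<close>, split into
  linear part and translation as the change of variables formulas expect.\<close>

definition contract :: "'a::euclidean_space \<Rightarrow> real \<Rightarrow> 'a \<Rightarrow> 'a" where
  "contract w R y = (1 / R) *\<^sub>R y + (w - (1 / R) *\<^sub>R w)"

lemma contract_closed_segment: "R \<ge> 1 \<Longrightarrow> contract w R y \<in> closed_segment w y"
  unfolding closed_segment_def contract_def
  by (auto simp: algebra_simps intro!: exI[of _ "1 / R"])

lemma contract_measurable:
  fixes g :: "'a::euclidean_space \<Rightarrow> real"
  assumes K: "K \<in> sets lebesgue" "B \<in> sets lebesgue" and R: "R > 0" and sub: "\<And>x. x \<in> K \<Longrightarrow> contract w R x \<in> B"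
    and g: "g \<in> borel_measurable (lebesgue_on B)"
  shows "(\<lambda>x. g (contract w R x)) \<in> borel_measurable (lebesgue_on K)"
proof -
  have T: "contract w R \<in> lebesgue \<rightarrow>\<^sub>M lebesgue"
    unfolding contract_def[abs_def] using R by (intro lebesgue_affine_map(1)) simp
  have "(\<lambda>x. indicator B x *\<^sub>R g x) \<in> borel_measurable lebesgue"
    using g K by (simp add: borel_measurable_lebesgue_on_iff)
  from borel_measurable_scaleR[OF borel_measurable_indicator[OF K(1)] measurable_compose[OF T this]]
  have "(\<lambda>x. indicat_real K x *\<^sub>R (indicator B (contract w R x) *\<^sub>R g (contract w R x))) \<in> borel_measurable lebesgue" .
  moreover have "(\<lambda>x. indicat_real K x *\<^sub>R (indicator B (contract w R x) *\<^sub>R g (contract w R x)))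
      = (\<lambda>x. indicator K x *\<^sub>R g (contract w R x))"
    using sub by (auto simp: indicator_def fun_eq_iff)
  ultimately show ?thesis using K by (simp add: borel_measurable_lebesgue_on_iff)
qed

text \<open>\<open>B\<close> only has to contain the image of \<open>K\<close>, hence an inequality
  for nonnegative \<open>F\<close>; \<open>R ^ DIM('a)\<close> is the Jacobian of the inverse
  map.\<close>

lemma contract_integrable:
  fixes F :: "'a::euclidean_space \<Rightarrow> real"
  assumes K: "K \<in> sets lebesgue" "B \<in> sets lebesgue" and R: "R > 0" and sub: "\<And>x. x \<in> K \<Longrightarrow> contract w R x \<in> B"
    and F: "integrable (lebesgue_on B) F"
  shows "integrable (lebesgue_on K) (\<lambda>x. F (contract w R x))"
    and "(\<And>x. 0 \<le> F x) \<Longrightarrow>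
      (LINT x|lebesgue_on K. F (contract w R x)) \<le> R ^ DIM('a) * (LINT x|lebesgue_on B. F x)"
proof -
  let ?f = "\<lambda>x. indicat_real B x *\<^sub>R F x"
  have f: "integrable lebesgue ?f" using F K by (simp add: integrable_restrict_space)
  have aff: "integrable lebesgue (\<lambda>x. ?f (contract w R x))"
    "(\<integral>x. ?f x \<partial>lebesgue) = (1 / R) ^ DIM('a) * (\<integral>x. ?f (contract w R x) \<partial>lebesgue)"
    using integral_lebesgue_affine[of "1 / R" ?f "w - (1 / R) *\<^sub>R w"] R f
    unfolding contract_def by (auto dest: borel_measurable_integrable)
  have eq: "(\<lambda>x. indicat_real K x *\<^sub>R F (contract w R x)) = (\<lambda>x. indicator K x *\<^sub>R ?f (contract w R x))"
    using sub by (auto simp: indicator_def fun_eq_iff)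
  have "integrable lebesgue (\<lambda>x. indicator K x *\<^sub>R ?f (contract w R x))"
    by (rule integrable_mult_indicator[OF K(1) aff(1)])
  then show "integrable (lebesgue_on K) (\<lambda>x. F (contract w R x))"
    unfolding eq[symmetric] using K by (simp add: integrable_restrict_space)
  assume pos: "\<And>x. 0 \<le> F x"
  have "(LINT x|lebesgue_on K. F (contract w R x)) = (\<integral>x. indicator K x *\<^sub>R ?f (contract w R x) \<partial>lebesgue)"
    unfolding eq[symmetric] using K by (simp add: integral_restrict_space)
  also have "\<dots> \<le> (\<integral>x. ?f (contract w R x) \<partial>lebesgue)"
    using pos by (intro integral_mono' aff) (auto simp: indicator_def)
  also have "\<dots> = R ^ DIM('a) * (\<integral>x. ?f x \<partial>lebesgue)"
    using aff(2) R by (simp add: field_simps)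
  also have "(\<integral>x. ?f x \<partial>lebesgue) = (LINT x|lebesgue_on B. F x)"
    using K by (simp add: integral_restrict_space)
  finally show "(LINT x|lebesgue_on K. F (contract w R x)) \<le> R ^ DIM('a) * (LINT x|lebesgue_on B. F x)" .
qed

lemma contract_L2:
  fixes g :: "'a::euclidean_space \<Rightarrow> real"
  assumes K: "K \<in> sets lebesgue" "B \<in> sets lebesgue" and R: "R > 0" and sub: "\<And>x. x \<in> K \<Longrightarrow> contract w R x \<in> B"
    and g: "g \<in> L2 B"
  shows "(\<lambda>x. g (contract w R x)) \<in> L2 K"
    and "(L2_norm K (\<lambda>x. g (contract w R x)))\<^sup>2 \<le> R ^ DIM('a) * (L2_norm B g)\<^sup>2"
  using contract_measurable[OF K R sub L2_D(1)[OF g]] contract_integrable[OF K R sub L2_D(2)[OF g]]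
  by (auto simp: L2_def L2_norm_square)

lemma AE_contract:
  fixes K :: "'a::euclidean_space set"
  assumes K: "K \<in> sets lebesgue" "B \<in> sets lebesgue" and R: "R > 0" and sub: "\<And>x. x \<in> K \<Longrightarrow> contract w R x \<in> B"
    and ae: "AE x in lebesgue_on B. P x"
  shows "AE x in lebesgue_on K. P (contract w R x)"
proof -
  have "AE x in lebesgue. contract w R x \<in> B \<longrightarrow> P (contract w R x)"
    using AE_lebesgue_affine[of "1 / R" "\<lambda>x. x \<in> B \<longrightarrow> P x" "w - (1 / R) *\<^sub>R w"] ae K R
    unfolding contract_def by (simp add: AE_lebesgue_on_iff)
  then show ?thesis
    unfolding AE_lebesgue_on_iff[OF K(1)] by eventually_elim (use sub in auto)
qed

text \<open>The substitution z = contract w R y: the Jacobian cancels the power of \<open>R\<close>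
  in \<open>rescale\<close>. Star-shapedness keeps the contracted points in \<open>K\<close>, where
  \<open>g\<close> is given.\<close>

lemma integral_mult_rescale:
  fixes K :: "(real^'d::finite) set"
  assumes K: "open K" and star: "\<And>x. x \<in> K \<Longrightarrow> closed_segment w x \<subseteq> K" and R: "R \<ge> 1"
    and g: "integrable (lebesgue_on K) g" and \<phi>: "\<phi> \<in> test_functions K"
  shows "(LINT z|lebesgue_on K. g z * rescale w R \<phi> z) = (LINT y|lebesgue_on K. g (contract w R y) * \<phi> y)"
proof -
  let ?f = "\<lambda>z. indicat_real K z *\<^sub>R (g z * rescale w R \<phi> z)"
  have \<phi>0: "\<phi> y = 0" if "y \<notin> K" for y
    using \<phi> that closure_subset[of "{x. \<phi> x \<noteq> 0}"] by (auto simp: test_functions_def)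
  have "integrable (lebesgue_on K) (\<lambda>z. g z * rescale w R \<phi> z)"
  proof -
    have t: "rescale w R \<phi> \<in> test_functions K" by (rule rescale_test_function[OF star \<phi> R])
    from test_functions_bounded[OF t] obtain c where "\<And>x. \<bar>rescale w R \<phi> x\<bar> \<le> c" by blast
    then show ?thesis
      by (rule integrable_mult_bounded[OF g smooth_fun_measurable_lebesgue_on[OF test_functions_smooth[OF t]]])
  qed
  then have f: "?f \<in> borel_measurable lebesgue"
    using K by (simp add: integrable_restrict_space borel_measurable_integrable)
  have "(LINT z|lebesgue_on K. g z * rescale w R \<phi> z) = (\<integral>z. ?f z \<partial>lebesgue)"
    using K by (simp add: integral_restrict_space)
  also have "\<dots> = (1 / R) ^ CARD('d) * (\<integral>y. ?f (contract w R y) \<partial>lebesgue)"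
    using integral_lebesgue_affine(1)[OF _ f, of "1 / R" "w - (1 / R) *\<^sub>R w"] R
    unfolding contract_def by simp
  also have "(\<lambda>y. ?f (contract w R y)) = (\<lambda>y. R ^ CARD('d) * (indicat_real K y *\<^sub>R (g (contract w R y) * \<phi> y)))"
  proof
    fix y
    have "R *\<^sub>R contract w R y + (w - R *\<^sub>R w) = y"
      using R by (simp add: contract_def algebra_simps)
    then have r: "rescale w R \<phi> (contract w R y) = R ^ CARD('d) * \<phi> y" by (simp add: rescale_def)
    show "?f (contract w R y) = R ^ CARD('d) * (indicat_real K y *\<^sub>R (g (contract w R y) * \<phi> y))"
    proof (cases "y \<in> K")
      case True
      then have "contract w R y \<in> K" using contract_closed_segment[OF R] star by blast
      then show ?thesis using True by (simp add: r)
    qed (simp add: r \<phi>0)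
  qed
  also have "(1 / R) ^ CARD('d) * (\<integral>y. R ^ CARD('d) * (indicat_real K y *\<^sub>R (g (contract w R y) * \<phi> y)) \<partial>lebesgue)
      = (\<integral>y. indicat_real K y *\<^sub>R (g (contract w R y) * \<phi> y) \<partial>lebesgue)"
    using R by (simp only: integral_mult_right_zero) (simp add: power_divide)
  also have "\<dots> = (LINT y|lebesgue_on K. g (contract w R y) * \<phi> y)"
    using K by (simp add: integral_restrict_space)
  finally show ?thesis .
qed

lemma integral_rescale:
  fixes K :: "(real^'d::finite) set"
  assumes K: "open K" and star: "\<And>x. x \<in> K \<Longrightarrow> closed_segment w x \<subseteq> K" and R: "R \<ge> 1"
    and \<phi>: "\<phi> \<in> test_functions K"
  shows "(LINT z|lebesgue_on K. rescale w R \<phi> z) = (LINT z|lebesgue_on K. \<phi> z)"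
    and "(L2_norm K (rescale w R \<phi>))\<^sup>2 = R ^ CARD('d) * (L2_norm K \<phi>)\<^sup>2"
proof -
  have R0: "R > 0" using R by simp
  have m: "\<psi> \<in> borel_measurable lebesgue" if "\<psi> \<in> test_functions K" for \<psi>
    using test_functions_integrable(2)[OF that] by simp
  have t: "rescale w R \<phi> \<in> test_functions K" by (rule rescale_test_function[OF star \<phi> R])
  show "(LINT z|lebesgue_on K. rescale w R \<phi> z) = (LINT z|lebesgue_on K. \<phi> z)"
    unfolding integral_lebesgue_on_test_function[OF K t] integral_lebesgue_on_test_function[OF K \<phi>]
    using integral_lebesgue_affine(1)[OF R0 m[OF \<phi>], of "w - R *\<^sub>R w"] by (simp add: rescale_def[abs_def])
  have sq: "(\<lambda>x. \<psi> x * \<psi> x) \<in> test_functions K" if "\<psi> \<in> test_functions K" for \<psi>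
    by (rule test_functions_mult[OF that test_functions_smooth[OF that]])
  have n: "(L2_norm K \<psi>)\<^sup>2 = (LINT x|lebesgue_on K. \<psi> x * \<psi> x)" for \<psi> :: "real^'d \<Rightarrow> real"
    unfolding L2_norm_square by (simp add: power2_eq_square)
  have "(\<integral>z. rescale w R \<phi> z * rescale w R \<phi> z \<partial>lebesgue)
      = (\<integral>z. (R ^ CARD('d) * R ^ CARD('d)) * (\<phi> (R *\<^sub>R z + (w - R *\<^sub>R w)) * \<phi> (R *\<^sub>R z + (w - R *\<^sub>R w))) \<partial>lebesgue)"
    by (simp add: rescale_def mult_ac)
  also have "\<dots> = R ^ CARD('d) * (\<integral>z. \<phi> z * \<phi> z \<partial>lebesgue)"
    using integral_lebesgue_affine(1)[OF R0 m[OF sq[OF \<phi>]], of "w - R *\<^sub>R w"] by simp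
  finally show "(L2_norm K (rescale w R \<phi>))\<^sup>2 = R ^ CARD('d) * (L2_norm K \<phi>)\<^sup>2"
    using integral_lebesgue_on_test_function[OF K sq[OF t]] integral_lebesgue_on_test_function[OF K sq[OF \<phi>]]
    unfolding n by simp
qed

text \<open>By duality the difference is tested with \<open>\<phi>\<close>, and
  \<open>rescale_estimate\<close> applies with a bound from Cauchy-Schwarz in each direction, |z_i -
  w_i| being at most \<open>D\<close>.\<close>

lemma L2_norm_contract_diff:
  fixes K :: "(real^'d::finite) set"
  assumes K: "open K" "bounded K" and star: "\<And>x. x \<in> K \<Longrightarrow> closed_segment w x \<subseteq> K"
    and R: "R > 1" and g: "g \<in> L2 K" and G: "\<And>i. is_weak_deriv K [i] g (G i)" "\<And>i. G i \<in> L2 K"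
    and D: "0 \<le> D" "\<And>x i. x \<in> K \<Longrightarrow> \<bar>x $ i - w $ i\<bar> \<le> D"
  shows "L2_norm K (\<lambda>x. g (contract w R x) - g x) \<le> (R - 1) * (D * R ^ CARD('d) * (\<Sum>i\<in>UNIV. L2_norm K (G i)))"
proof -
  have Ks: "K \<in> sets lebesgue" using K by simp
  have Km: "K \<in> lmeasurable" using K by (simp add: lmeasurable_open)
  have sub: "contract w R x \<in> K" if "x \<in> K" for x
    using contract_closed_segment[of R w x] star[OF that] R by auto
  have gT: "(\<lambda>x. g (contract w R x)) \<in> L2 K" using R by (intro contract_L2[OF Ks Ks _ sub g]) auto
  show ?thesis
  proof (rule L2_norm_le_of_test_functions[OF K])
    show "(\<lambda>x. g (contract w R x) - g x) \<in> L2 K" by (rule L2_diff[OF gT g])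
    show "0 \<le> (R - 1) * (D * R ^ CARD('d) * (\<Sum>i\<in>UNIV. L2_norm K (G i)))"
      using R D by (intro mult_nonneg_nonneg sum_nonneg) auto
    fix \<phi> assume \<phi>: "\<phi> \<in> test_functions K"
    have \<phi>L: "\<phi> \<in> L2 K" by (rule test_functions_L2[OF K(1) \<phi>])
    have gi: "integrable (lebesgue_on K) g" by (rule L2_integrable[OF Km g])
    have "(LINT x|lebesgue_on K. (g (contract w R x) - g x) * \<phi> x)
        = (LINT x|lebesgue_on K. g (contract w R x) * \<phi> x) - (LINT x|lebesgue_on K. g x * \<phi> x)"
      unfolding left_diff_distrib
      by (intro Bochner_Integration.integral_diff L2_integrable_mult gT g \<phi>L)
    also have "\<dots> = (LINT x|lebesgue_on K. g x * rescale w R \<phi> x) - (LINT x|lebesgue_on K. g x * \<phi> x)"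
      using integral_mult_rescale[OF K(1) star _ gi \<phi>, of R] R by simp
    also have "\<bar>\<dots>\<bar> \<le> (R - 1) * ((D * R ^ CARD('d) * (\<Sum>i\<in>UNIV. L2_norm K (G i))) * L2_norm K \<phi>)"
    proof (rule rescale_estimate[OF K(1) star gi G(1) \<phi> R])
      fix r assume r: "1 \<le> r" "r \<le> R"
      have t: "rescale w r \<phi> \<in> test_functions K" by (rule rescale_test_function[OF star \<phi> r(1)])
      have tL: "rescale w r \<phi> \<in> L2 K" by (rule test_functions_L2[OF K(1) t])
      \<comment> \<open>The exact factor is the square root of r^d; it is replaced by the larger R^d
        to avoid roots in the constants.\<close>
      have "(L2_norm K (rescale w r \<phi>))\<^sup>2 \<le> (R ^ CARD('d) * L2_norm K \<phi>)\<^sup>2"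
      proof -
        have "r ^ CARD('d) \<le> R ^ CARD('d)" using r by (intro power_mono) auto
        also have "\<dots> \<le> R ^ CARD('d) * R ^ CARD('d)" using R by simp
        finally show ?thesis
          using integral_rescale(2)[OF K(1) star r(1) \<phi>]
          by (simp add: power_mult_distrib power2_eq_square[of "R ^ _"] mult_right_mono)
      qed
      then have N: "L2_norm K (rescale w r \<phi>) \<le> R ^ CARD('d) * L2_norm K \<phi>"
        by (rule power2_le_imp_le) (use R in simp)
      have "\<bar>LINT z|lebesgue_on K. G i z * ((z $ i - w $ i) * rescale w r \<phi> z)\<bar>
          \<le> L2_norm K (G i) * (D * (R ^ CARD('d) * L2_norm K \<phi>))" for i
      proof -
        have t\<chi>: "(\<lambda>z. (z $ i - w $ i) * rescale w r \<phi> z) \<in> test_functions K"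
          by (intro test_functions_mult t smooth_fun_diff smooth_fun_const smooth_fun_component)
        have "\<bar>LINT z|lebesgue_on K. G i z * ((z $ i - w $ i) * rescale w r \<phi> z)\<bar>
            \<le> L2_norm K (G i) * L2_norm K (\<lambda>z. (z $ i - w $ i) * rescale w r \<phi> z)"
          using L2_Cauchy_Schwarz[OF G(2) test_functions_L2[OF K(1) t\<chi>], of i] by (simp add: L2_inner_def)
        also have "L2_norm K (\<lambda>z. (z $ i - w $ i) * rescale w r \<phi> z) \<le> L2_norm K (\<lambda>z. D * rescale w r \<phi> z)"
        proof (rule L2_norm_mono_AE[OF L2_mult[OF tL]])
          show "AE x in lebesgue_on K. norm ((x $ i - w $ i) * rescale w r \<phi> x) \<le> norm (D * rescale w r \<phi> x)"
            using AE_in_lebesgue_on[of K]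
            by eventually_elim (use D in \<open>auto simp: abs_mult intro!: mult_right_mono\<close>)
        qed
        also have "\<dots> \<le> D * (R ^ CARD('d) * L2_norm K \<phi>)"
          using N D by (simp add: L2_norm_mult mult_left_mono)
        finally show ?thesis by (simp add: mult_left_mono)
      qed
      then have "(\<Sum>i\<in>UNIV. \<bar>LINT z|lebesgue_on K. G i z * ((z $ i - w $ i) * rescale w r \<phi> z)\<bar>)
          \<le> (\<Sum>i\<in>UNIV. L2_norm K (G i) * (D * (R ^ CARD('d) * L2_norm K \<phi>)))"
        by (intro sum_mono)
      also have "\<dots> = (D * R ^ CARD('d) * (\<Sum>i\<in>UNIV. L2_norm K (G i))) * L2_norm K \<phi>"
        by (simp add: sum_distrib_right[symmetric])
      finally show "\<bar>\<Sum>i\<in>UNIV. LINT z|lebesgue_on K. G i z * ((z $ i - w $ i) * rescale w r \<phi> z)\<bar>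
          \<le> (D * R ^ CARD('d) * (\<Sum>i\<in>UNIV. L2_norm K (G i))) * L2_norm K \<phi>"
        using sum_abs[of "\<lambda>i. LINT z|lebesgue_on K. G i z * ((z $ i - w $ i) * rescale w r \<phi> z)" UNIV]
        by linarith
    qed
    finally show "\<bar>LINT x|lebesgue_on K. (g (contract w R x) - g x) * \<phi> x\<bar>
        \<le> (R - 1) * (D * R ^ CARD('d) * (\<Sum>i\<in>UNIV. L2_norm K (G i))) * L2_norm K \<phi>"
      by (simp add: mult.assoc)
  qed
qed

text \<open>The Linf counterpart by L1 duality. \<open>rescale\<close> preserves the integral of a
  nonnegative test function, so no power of \<open>R\<close> appears.\<close>

lemma AE_contract_diff_le:
  fixes K :: "(real^'d::finite) set" and R M D :: real
  assumes K: "open K" and star: "\<And>x. x \<in> K \<Longrightarrow> closed_segment w x \<subseteq> K"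
    and R: "R > 1" and g: "integrable (lebesgue_on K) g" and G: "\<And>i. is_weak_deriv K [i] g (G i)"
    and M: "0 \<le> M" "\<And>i. AE x in lebesgue_on K. \<bar>G i x\<bar> \<le> M"
    and D: "0 \<le> D" "\<And>x i. x \<in> K \<Longrightarrow> \<bar>x $ i - w $ i\<bar> \<le> D"
  shows "AE x in lebesgue_on K. \<bar>g (contract w R x) - g x\<bar> \<le> (R - 1) * (real CARD('d) * (M * D))"
proof -
  have Ks: "K \<in> sets lebesgue" using K by simp
  have sub: "contract w R x \<in> K" if "x \<in> K" for x
    using contract_closed_segment[of R w x] star[OF that] R by auto
  have gT: "integrable (lebesgue_on K) (\<lambda>x. g (contract w R x))"
    using R by (intro contract_integrable(1)[OF Ks Ks _ sub g]) auto
  have li: "locally_integrable K f" if "integrable (lebesgue_on K) f" for f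
    unfolding locally_integrable_def
    using integrable_lebesgue_on_subset[OF Ks compact_in_sets_lebesgue _ that] by auto
  show ?thesis
  proof (rule AE_le_of_test_functions[OF K])
    show "locally_integrable K (\<lambda>x. g (contract w R x) - g x)"
      using gT g by (intro li) auto
    fix \<phi> assume \<phi>: "\<phi> \<in> test_functions K" and pos: "\<And>x. 0 \<le> \<phi> x"
    have "(LINT x|lebesgue_on K. (g (contract w R x) - g x) * \<phi> x)
        = (LINT x|lebesgue_on K. g (contract w R x) * \<phi> x) - (LINT x|lebesgue_on K. g x * \<phi> x)"
      unfolding left_diff_distrib
      by (intro Bochner_Integration.integral_diff integrable_test_function_mult li gT g \<phi> K)
    also have "\<dots> = (LINT x|lebesgue_on K. g x * rescale w R \<phi> x) - (LINT x|lebesgue_on K. g x * \<phi> x)"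
      using integral_mult_rescale[OF K star _ g \<phi>, of R] R by simp
    also have "\<bar>\<dots>\<bar> \<le> (R - 1) * (real CARD('d) * (M * D * (LINT x|lebesgue_on K. \<phi> x)))"
    proof (rule rescale_estimate[OF K star g G \<phi> R])
      fix r assume r: "1 \<le> r" "r \<le> R"
      have t: "rescale w r \<phi> \<in> test_functions K" by (rule rescale_test_function[OF star \<phi> r(1)])
      have ti: "integrable (lebesgue_on K) (rescale w r \<phi>)"
        using test_functions_integrable(2)[OF t] Ks by (intro integrable_lebesgue_onI)
      have rpos: "0 \<le> rescale w r \<phi> x" for x using pos r by (simp add: rescale_def)
      have "\<bar>LINT z|lebesgue_on K. G i z * ((z $ i - w $ i) * rescale w r \<phi> z)\<bar>
          \<le> M * D * (LINT x|lebesgue_on K. \<phi> x)" for i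
      proof -
        have "\<bar>LINT z|lebesgue_on K. G i z * ((z $ i - w $ i) * rescale w r \<phi> z)\<bar>
            \<le> (LINT z|lebesgue_on K. \<bar>G i z * ((z $ i - w $ i) * rescale w r \<phi> z)\<bar>)"
          by (rule integral_abs_bound)
        also have "\<dots> \<le> (LINT z|lebesgue_on K. (M * D) * rescale w r \<phi> z)"
        proof (rule integral_mono_AE')
          show "integrable (lebesgue_on K) (\<lambda>z. (M * D) * rescale w r \<phi> z)" using ti by simp
          show "AE z in lebesgue_on K. \<bar>G i z * ((z $ i - w $ i) * rescale w r \<phi> z)\<bar> \<le> (M * D) * rescale w r \<phi> z"
            using AE_in_lebesgue_on[of K] M(2)[of i]
          proof eventually_elim
            case (elim z)
            have "\<bar>G i z\<bar> * (\<bar>z $ i - w $ i\<bar> * rescale w r \<phi> z) \<le> M * (D * rescale w r \<phi> z)"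
              using elim D rpos[of z] M(1) by (intro mult_mono) auto
            then show ?case using rpos[of z] by (simp add: abs_mult mult.assoc)
          qed
          show "AE z in lebesgue_on K. 0 \<le> M * D * rescale w r \<phi> z"
            using M(1) D(1) rpos by (intro AE_I2) simp
        qed
        also have "\<dots> = M * D * (LINT x|lebesgue_on K. \<phi> x)"
          using integral_rescale(1)[OF K star r(1) \<phi>] by simp
        finally show ?thesis .
      qed
      then have "(\<Sum>i\<in>UNIV. \<bar>LINT z|lebesgue_on K. G i z * ((z $ i - w $ i) * rescale w r \<phi> z)\<bar>)
          \<le> (\<Sum>i\<in>(UNIV::'d set). M * D * (LINT x|lebesgue_on K. \<phi> x))"
        by (intro sum_mono)
      then show "\<bar>\<Sum>i\<in>UNIV. LINT z|lebesgue_on K. G i z * ((z $ i - w $ i) * rescale w r \<phi> z)\<bar>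
          \<le> real CARD('d) * (M * D * (LINT x|lebesgue_on K. \<phi> x))"
        by (intro order_trans[OF sum_abs]) simp
    qed
    finally show "\<bar>LINT x|lebesgue_on K. (g (contract w R x) - g x) * \<phi> x\<bar>
        \<le> (R - 1) * (real CARD('d) * (M * D)) * (LINT x|lebesgue_on K. \<phi> x)"
      by (simp add: mult.assoc)
  qed
qed

section \<open>Oscillation bounds on star-shaped cells\<close>

text \<open>The contraction of \<open>x\<close> towards \<open>w\<close> and that of \<open>w\<close> towards \<open>x\<close> have the same image, the
  midpoint, so Fubini's theorem bounds the mean over \<open>w\<close> of the deviation of \<open>g\<close> from \<open>g w\<close>.\<close>

lemma nn_integral_midpoint:
  fixes B :: "'a::euclidean_space set" and g :: "'a \<Rightarrow> real" and \<Theta> \<Theta>' :: "real \<Rightarrow> ennreal"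
  assumes B: "open B" "B \<noteq> {}" "emeasure lborel B \<noteq> \<infinity>"
    and mid: "\<And>x w. x \<in> B \<Longrightarrow> w \<in> B \<Longrightarrow> contract w 2 x \<in> B"
    and g: "g \<in> borel_measurable (lebesgue_on B)"
    and \<Theta>[measurable]: "\<Theta> \<in> borel_measurable borel" "\<Theta>' \<in> borel_measurable borel"
    and le: "\<And>u v m. \<Theta> (u - v) \<le> \<Theta>' (m - u) + \<Theta>' (m - v)"
    and E: "E \<noteq> \<infinity>" "\<And>w. w \<in> B \<Longrightarrow> (\<integral>\<^sup>+x. \<Theta>' (g (contract w 2 x) - g x) \<partial>lebesgue_on B) \<le> E"
  shows "\<exists>\<kappa>. (\<integral>\<^sup>+x. \<Theta> (g x - \<kappa>) \<partial>lebesgue_on B) \<le> 2 * E"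
proof (rule ccontr)
  \<comment> \<open>The candidates for \<kappa> are the values of \<open>g\<close> at points w of
    \<open>B\<close>. If every one failed, integrating the failure over w would contradict the
    Fubini bound.\<close>
  assume neg: "\<not> ?thesis"
  have Bs: "B \<in> sets lebesgue" and [measurable]: "B \<in> sets borel" using B(1) by auto
  have "(\<lambda>x. indicator B x *\<^sub>R g x) \<in> borel_measurable lebesgue"
    using g Bs by (simp add: borel_measurable_lebesgue_on_iff)
  \<comment> \<open>Fubini is applied to the product of Borel-Lebesgue measures, so \<open>g\<close>
    is replaced by a Borel function equal to it a.e. on \<open>B\<close>.\<close>
  then obtain g' where [measurable]: "g' \<in> borel_measurable lborel"
    and g': "AE x in lborel. indicator B x *\<^sub>R g x = g' x"
    using completion_ex_borel_measurable_real by blast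
  then have [measurable]: "g' \<in> borel_measurable borel" by simp
  have ae: "AE x in lebesgue_on B. g x = g' x"
    using AE_completion[OF g'] unfolding AE_lebesgue_on_iff[OF Bs] by eventually_elim auto
  have nn: "(\<integral>\<^sup>+x. f x \<partial>lebesgue_on B) = (\<integral>\<^sup>+x. f x * indicator B x \<partial>lborel)" for f
    using Bs by (simp add: nn_integral_restrict_space nn_integral_completion)
  define m where "m = (\<lambda>w x::'a. (1 / 2) *\<^sub>R x + (w - (1 / 2) *\<^sub>R w))"
  have [measurable]: "(\<lambda>p. m (fst p) (snd p)) \<in> borel_measurable (borel \<Otimes>\<^sub>M borel)"
    unfolding m_def by measurable
  have m_commute: "m w x = m x w" for w x
  proof -
    have "m w x - m x w = 0" by (simp add: m_def scaleR_left_diff_distrib[symmetric] algebra_simps)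
        (simp add: scaleR_add_left[symmetric])
    then show ?thesis by simp
  qed
  \<comment> \<open>Since m w x = m x w, the sum H w x + H x w compares g' x and g' w with one and
    the same midpoint value, and \<open>le\<close> applies.\<close>
  define H where "H = (\<lambda>w x. indicator B x * indicator B w * \<Theta>' (g' (m w x) - g' x))"
  have Hm[measurable]: "(\<lambda>(w, x). H w x) \<in> borel_measurable (lborel \<Otimes>\<^sub>M lborel)"
    unfolding H_def by measurable
  have H: "(\<integral>\<^sup>+x. H w x \<partial>lborel) \<le> E * indicator B w" for w
  proof (cases "w \<in> B")
    case True
    have "AE x in lebesgue_on B. g (contract w 2 x) = g' (contract w 2 x)"
      by (rule AE_contract[OF Bs Bs _ _ ae]) (use mid True in auto)
    with ae have "AE x in lebesgue_on B. \<Theta>' (g (contract w 2 x) - g x) = \<Theta>' (g' (m w x) - g' x)"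
      by eventually_elim (simp add: contract_def m_def)
    then have "(\<integral>\<^sup>+x. \<Theta>' (g' (m w x) - g' x) \<partial>lebesgue_on B) \<le> E"
      using E(2)[OF True] nn_integral_cong_AE by fastforce
    moreover have "(\<integral>\<^sup>+x. \<Theta>' (g' (m w x) - g' x) \<partial>lebesgue_on B) = (\<integral>\<^sup>+x. H w x \<partial>lborel)"
      unfolding nn H_def using True by (simp add: mult.commute)
    ultimately show ?thesis using True by simp
  qed (simp add: H_def)
  define J where "J = (\<lambda>w. \<integral>\<^sup>+x. indicator B x * \<Theta> (g' x - g' w) \<partial>lborel)"
  have Jm[measurable]: "J \<in> borel_measurable lborel"
    unfolding J_def by measurable
  have "(\<integral>\<^sup>+w. indicator B w * J w \<partial>lborel) \<le> (\<integral>\<^sup>+w. (\<integral>\<^sup>+x. H w x \<partial>lborel) + (\<integral>\<^sup>+x. H x w \<partial>lborel) \<partial>lborel)"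
  proof (rule nn_integral_mono)
    fix w
    have [measurable]: "(\<lambda>x. H w x) \<in> borel_measurable lborel" "(\<lambda>x. H x w) \<in> borel_measurable lborel"
      using measurable_compose[OF measurable_Pair1' Hm, of w] measurable_compose[OF measurable_Pair2' Hm, of w]
      by auto
    have "indicator B w * J w = (\<integral>\<^sup>+x. indicator B w * (indicator B x * \<Theta> (g' x - g' w)) \<partial>lborel)"
      unfolding J_def by (rule nn_integral_cmult[symmetric]) measurable
    also have "\<dots> \<le> (\<integral>\<^sup>+x. H w x + H x w \<partial>lborel)"
    proof (rule nn_integral_mono)
      fix x
      show "indicator B w * (indicator B x * \<Theta> (g' x - g' w)) \<le> H w x + H x w"
        using le[of "g' x" "g' w" "g' (m w x)"] m_commute[of w x]
        by (auto simp: H_def indicator_def)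
    qed
    also have "\<dots> = (\<integral>\<^sup>+x. H w x \<partial>lborel) + (\<integral>\<^sup>+x. H x w \<partial>lborel)"
      by (rule nn_integral_add) measurable
    finally show "indicator B w * J w \<le> (\<integral>\<^sup>+x. H w x \<partial>lborel) + (\<integral>\<^sup>+x. H x w \<partial>lborel)" .
  qed
  also have "\<dots> = (\<integral>\<^sup>+w. (\<integral>\<^sup>+x. H w x \<partial>lborel) \<partial>lborel) + (\<integral>\<^sup>+w. (\<integral>\<^sup>+x. H x w \<partial>lborel) \<partial>lborel)"
    by (rule nn_integral_add) measurable
  also have "(\<integral>\<^sup>+w. (\<integral>\<^sup>+x. H x w \<partial>lborel) \<partial>lborel) = (\<integral>\<^sup>+w. (\<integral>\<^sup>+x. H w x \<partial>lborel) \<partial>lborel)"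
    using lborel_pair.Fubini'[OF Hm] by simp
  also have "(\<integral>\<^sup>+w. (\<integral>\<^sup>+x. H w x \<partial>lborel) \<partial>lborel) + (\<integral>\<^sup>+w. (\<integral>\<^sup>+x. H w x \<partial>lborel) \<partial>lborel)
      \<le> (\<integral>\<^sup>+w. E * indicator B w \<partial>lborel) + (\<integral>\<^sup>+w. E * indicator B w \<partial>lborel)"
    by (intro add_mono nn_integral_mono H)
  also have "\<dots> = (\<integral>\<^sup>+w. 2 * E * indicator B w \<partial>lborel)"
    by (simp add: nn_integral_cmult_indicator) (simp add: mult_2 distrib_right)
  finally have upper: "(\<integral>\<^sup>+w. indicator B w * J w \<partial>lborel) \<le> (\<integral>\<^sup>+w. 2 * E * indicator B w \<partial>lborel)" .
  have J: "2 * E < J w" if "w \<in> B" for w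
  proof -
    have "(\<integral>\<^sup>+x. \<Theta> (g x - g' w) \<partial>lebesgue_on B) = (\<integral>\<^sup>+x. \<Theta> (g' x - g' w) \<partial>lebesgue_on B)"
      by (rule nn_integral_cong_AE) (use ae in eventually_elim, simp)
    also have "\<dots> = J w" by (simp add: nn J_def mult.commute)
    finally show ?thesis using neg by (metis not_le_imp_less)
  qed
  \<comment> \<open>Strictness survives integration because \<open>B\<close> is open and non-empty,
    hence not null, and the smaller integral is finite.\<close>
  have "(\<integral>\<^sup>+w. 2 * E * indicator B w \<partial>lborel) < (\<integral>\<^sup>+w. indicator B w * J w \<partial>lborel)"
  proof (rule nn_integral_less)
    show "(\<integral>\<^sup>+w. 2 * E * indicator B w \<partial>lborel) \<noteq> \<infinity>"
      using E(1) B(3) by (simp add: nn_integral_cmult ennreal_mult_eq_top_iff)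
    show "AE w in lborel. 2 * E * indicator B w \<le> indicator B w * J w"
      using J by (intro AE_I2) (auto simp: indicator_def intro: less_imp_le)
    show "\<not> (AE w in lborel. indicator B w * J w \<le> 2 * E * indicator B w)"
    proof
      assume "AE w in lborel. indicator B w * J w \<le> 2 * E * indicator B w"
      then have "AE w in lborel. w \<notin> B"
      proof eventually_elim
        case (elim w)
        then show ?case using J[of w] by (auto simp: indicator_def not_le[symmetric])
      qed
      then have "B \<in> null_sets lborel" by (simp add: AE_iff_null_sets)
      then have "negligible B" using null_sets_completionI negligible_iff_null_sets by blast
      then show False using open_not_negligible[OF B(1,2)] by simp
    qed
  qed measurable
  with upper show False by simp
qed

text \<open>In a ball every point w may serve as centre of the contraction by 1/2. With displacement
  at most 2 \<rho> the contraction estimate gives \<open>M\<close>. Taking \<Theta> v = v^2 and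
  \<Theta>' v = 2 v^2 in the midpoint lemma bounds the squared norm by 4 M^2, whence 2 M and the
  factor 4 * 2^d.\<close>

lemma poincare_ball:
  fixes c :: "real^'d::finite"
  assumes \<rho>: "\<rho> > 0" and g: "g \<in> L2 (ball c \<rho>)"
    and G: "\<And>i. is_weak_deriv (ball c \<rho>) [i] g (G i)" "\<And>i. G i \<in> L2 (ball c \<rho>)"
  shows "\<exists>\<kappa>. L2_norm (ball c \<rho>) (\<lambda>x. g x - \<kappa>) \<le> 4 * 2 ^ CARD('d) * \<rho> * (\<Sum>i\<in>UNIV. L2_norm (ball c \<rho>) (G i))"
proof -
  let ?B = "ball c \<rho>"
  define M where "M = 2 * \<rho> * 2 ^ CARD('d) * (\<Sum>i\<in>UNIV. L2_norm ?B (G i))"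
  have M0: "0 \<le> M" unfolding M_def using \<rho> by (intro mult_nonneg_nonneg sum_nonneg) auto
  have Bs: "?B \<in> sets lebesgue" and Bm: "?B \<in> lmeasurable" by auto
  have seg: "closed_segment w x \<subseteq> ?B" if "w \<in> ?B" "x \<in> ?B" for w x
    using that by (intro closed_segment_subset convex_ball)
  have mid: "contract w 2 x \<in> ?B" if "x \<in> ?B" "w \<in> ?B" for x w
    using contract_closed_segment[of 2 w x] seg[OF that(2,1)] by auto
  have "\<exists>\<kappa>. (\<integral>\<^sup>+x. ennreal ((g x - \<kappa>)\<^sup>2) \<partial>lebesgue_on ?B) \<le> 2 * ennreal (2 * M\<^sup>2)"
  proof (rule nn_integral_midpoint[of ?B g "\<lambda>v. ennreal (v\<^sup>2)" "\<lambda>v. ennreal (2 * v\<^sup>2)"])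
    show "emeasure lborel ?B \<noteq> \<infinity>" using emeasure_bounded_finite[of ?B] by auto
    show "g \<in> borel_measurable (lebesgue_on ?B)" using g by (rule L2_D)
    show "ennreal ((u - v)\<^sup>2) \<le> ennreal (2 * (m - u)\<^sup>2) + ennreal (2 * (m - v)\<^sup>2)" for u v m
    proof -
      have "(u - v)\<^sup>2 = 2 * (m - u)\<^sup>2 + 2 * (m - v)\<^sup>2 - ((m - u) + (m - v))\<^sup>2"
        by (simp add: power2_eq_square algebra_simps)
      then have "(u - v)\<^sup>2 \<le> 2 * (m - u)\<^sup>2 + 2 * (m - v)\<^sup>2" by simp
      then show ?thesis by (simp add: ennreal_plus[symmetric] del: ennreal_plus)
    qed
    show "(\<integral>\<^sup>+x. ennreal (2 * (g (contract w 2 x) - g x)\<^sup>2) \<partial>lebesgue_on ?B) \<le> ennreal (2 * M\<^sup>2)"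
      if w: "w \<in> ?B" for w
    proof -
      have gT: "(\<lambda>x. g (contract w 2 x)) \<in> L2 ?B"
        by (rule contract_L2(1)[OF Bs Bs _ _ g]) (use mid w in auto)
      have d: "(\<lambda>x. g (contract w 2 x) - g x) \<in> L2 ?B" by (rule L2_diff[OF gT g])
      have "L2_norm ?B (\<lambda>x. g (contract w 2 x) - g x) \<le> (2 - 1) * (2 * \<rho> * 2 ^ CARD('d) * (\<Sum>i\<in>UNIV. L2_norm ?B (G i)))"
      proof (rule L2_norm_contract_diff[OF _ _ _ _ g G])
        show "closed_segment w x \<subseteq> ?B" if "x \<in> ?B" for x using seg w that by blast
        show "\<bar>x $ i - w $ i\<bar> \<le> 2 * \<rho>" if "x \<in> ?B" for x i
        proof -
          have "\<bar>x $ i - w $ i\<bar> \<le> dist x w"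
            using component_le_norm_cart[of "x - w" i] by (simp add: dist_norm)
          also have "\<dots> \<le> dist x c + dist c w" by (rule dist_triangle)
          also have "\<dots> \<le> 2 * \<rho>" using that w by (simp add: dist_commute)
          finally show ?thesis .
        qed
      qed (use \<rho> in auto)
      then have "(L2_norm ?B (\<lambda>x. g (contract w 2 x) - g x))\<^sup>2 \<le> M\<^sup>2"
        by (intro power_mono) (simp_all add: M_def)
      moreover have "(\<integral>\<^sup>+x. ennreal (2 * (g (contract w 2 x) - g x)\<^sup>2) \<partial>lebesgue_on ?B)
          = ennreal (LINT x|lebesgue_on ?B. 2 * (g (contract w 2 x) - g x)\<^sup>2)"
        using L2_D(2)[OF d] by (intro nn_integral_eq_integral) auto
      ultimately show ?thesis by (simp add: L2_norm_square)
    qed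
  qed (use mid \<rho> in auto)
  then obtain \<kappa> where \<kappa>: "(\<integral>\<^sup>+x. ennreal ((g x - \<kappa>)\<^sup>2) \<partial>lebesgue_on ?B) \<le> 2 * ennreal (2 * M\<^sup>2)" by blast
  have d: "(\<lambda>x. g x - \<kappa>) \<in> L2 ?B" by (rule L2_diff[OF g L2_const[OF Bm]])
  have "(\<integral>\<^sup>+x. ennreal ((g x - \<kappa>)\<^sup>2) \<partial>lebesgue_on ?B) = ennreal (LINT x|lebesgue_on ?B. (g x - \<kappa>)\<^sup>2)"
    using L2_D(2)[OF d] by (intro nn_integral_eq_integral) auto
  moreover have "2 * ennreal (2 * M\<^sup>2) = ennreal ((2 * M)\<^sup>2)"
  proof -
    have "2 * ennreal (2 * M\<^sup>2) = ennreal 2 * ennreal (2 * M\<^sup>2)" by simp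
    also have "\<dots> = ennreal (2 * (2 * M\<^sup>2))" by (rule ennreal_mult'[symmetric]) simp
    finally show ?thesis by (simp add: power2_eq_square)
  qed
  ultimately have "(L2_norm ?B (\<lambda>x. g x - \<kappa>))\<^sup>2 \<le> (2 * M)\<^sup>2"
    using \<kappa> by (simp add: L2_norm_square)
  then have "L2_norm ?B (\<lambda>x. g x - \<kappa>) \<le> 2 * M" by (rule power2_le_imp_le) (use M0 in simp)
  then show ?thesis by (auto simp: M_def mult_ac)
qed

text \<open>Indicators of large values turn the midpoint lemma into an essential bound: if |u - v| >
  2 N, one of the distances to the midpoint value exceeds N, which happens only on a null set. So
  the lemma is used with E = 0, and 2 N is the stated bound.\<close>

lemma oscillation_ball:
  fixes c :: "real^'d::finite" and M :: real
  assumes \<rho>: "\<rho> > 0" and g: "integrable (lebesgue_on (ball c \<rho>)) g"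
    and G: "\<And>i. is_weak_deriv (ball c \<rho>) [i] g (G i)"
    and M: "0 \<le> M" "\<And>i. AE x in lebesgue_on (ball c \<rho>). \<bar>G i x\<bar> \<le> M"
  shows "\<exists>\<kappa>. AE x in lebesgue_on (ball c \<rho>). \<bar>g x - \<kappa>\<bar> \<le> 4 * real CARD('d) * M * \<rho>"
proof -
  let ?B = "ball c \<rho>"
  define N where "N = real CARD('d) * (M * (2 * \<rho>))"
  have Bs: "?B \<in> sets lebesgue" by auto
  have seg: "closed_segment w x \<subseteq> ?B" if "w \<in> ?B" "x \<in> ?B" for w x
    using that by (intro closed_segment_subset convex_ball)
  have mid: "contract w 2 x \<in> ?B" if "x \<in> ?B" "w \<in> ?B" for x w
    using contract_closed_segment[of 2 w x] seg[OF that(2,1)] by auto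
  have gm: "g \<in> borel_measurable (lebesgue_on ?B)" using g by simp
  have "\<exists>\<kappa>. (\<integral>\<^sup>+x. indicator {v. 2 * N < \<bar>v\<bar>} (g x - \<kappa>) \<partial>lebesgue_on ?B) \<le> 2 * 0"
  proof (rule nn_integral_midpoint[of ?B g "indicator {v. 2 * N < \<bar>v\<bar>}" "indicator {v. N < \<bar>v\<bar>}"])
    show "emeasure lborel ?B \<noteq> \<infinity>" using emeasure_bounded_finite[of ?B] by auto
    show "g \<in> borel_measurable (lebesgue_on ?B)" by (rule gm)
    show "indicator {v. 2 * N < \<bar>v\<bar>} (u - v) \<le> (indicator {v. N < \<bar>v\<bar>} (m - u) + indicator {v. N < \<bar>v\<bar>} (m - v) :: ennreal)" for u v m
      by (auto simp: indicator_def)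
    show "(\<integral>\<^sup>+x. indicator {v. N < \<bar>v\<bar>} (g (contract w 2 x) - g x) \<partial>lebesgue_on ?B) \<le> 0" if w: "w \<in> ?B" for w
    proof -
      have "AE x in lebesgue_on ?B. \<bar>g (contract w 2 x) - g x\<bar> \<le> (2 - 1) * (real CARD('d) * (M * (2 * \<rho>)))"
      proof (rule AE_contract_diff_le[OF _ _ _ g G M])
        show "closed_segment w x \<subseteq> ?B" if "x \<in> ?B" for x using seg w that by blast
        show "\<bar>x $ i - w $ i\<bar> \<le> 2 * \<rho>" if "x \<in> ?B" for x i
        proof -
          have "\<bar>x $ i - w $ i\<bar> \<le> dist x w"
            using component_le_norm_cart[of "x - w" i] by (simp add: dist_norm)
          also have "\<dots> \<le> dist x c + dist c w" by (rule dist_triangle)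
          also have "\<dots> \<le> 2 * \<rho>" using that w by (simp add: dist_commute)
          finally show ?thesis .
        qed
      qed (use \<rho> in auto)
      then have "AE x in lebesgue_on ?B. indicator {v. N < \<bar>v\<bar>} (g (contract w 2 x) - g x) = (0::ennreal)"
        by eventually_elim (simp add: N_def indicator_def)
      from nn_integral_cong_AE[OF this] show ?thesis by simp
    qed
  qed (use mid \<rho> in auto)
  then obtain \<kappa> where "(\<integral>\<^sup>+x. indicator {v. 2 * N < \<bar>v\<bar>} (g x - \<kappa>) \<partial>lebesgue_on ?B) = 0" by auto
  then have "AE x in lebesgue_on ?B. indicator {v. 2 * N < \<bar>v\<bar>} (g x - \<kappa>) = (0::ennreal)"
    using gm by (subst (asm) nn_integral_0_iff_AE) auto
  then have "AE x in lebesgue_on ?B. \<bar>g x - \<kappa>\<bar> \<le> 4 * real CARD('d) * M * \<rho>"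
    by eventually_elim (auto simp: N_def indicator_def mult_ac split: if_splits)
  then show ?thesis ..
qed

text \<open>The geometry used by the oscillation bounds: a centre, an inscribed ball about it and an
  aspect ratio. The resulting constants involve only \<eta> and the dimension.\<close>

locale star_cell =
  fixes K :: "(real^'d::finite) set" and c :: "real^'d" and \<rho> D \<eta> :: real
  assumes open_K: "open K" and star: "\<And>x. x \<in> K \<Longrightarrow> closed_segment c x \<subseteq> K"
    and \<rho>: "0 < \<rho>" "ball c \<rho> \<subseteq> K" "\<rho> \<le> D" and D: "\<And>x. x \<in> K \<Longrightarrow> dist c x \<le> D"
    and \<eta>: "0 < \<eta>" "D \<le> \<eta> * \<rho>"
begin

lemma bounded_K: "bounded K"
  using D unfolding bounded_def by blast

lemma K_lmeasurable: "K \<in> lmeasurable"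
  using open_K bounded_K by (simp add: lmeasurable_open)

lemma K_sets: "K \<in> sets lebesgue"
  using open_K by simp

lemma component_le: "x \<in> K \<Longrightarrow> \<bar>x $ i - c $ i\<bar> \<le> D"
  using component_le_norm_cart[of "x - c" i] D[of x] by (simp add: dist_norm norm_minus_commute)

text \<open>The ratio is taken as \<eta> + 1 instead of \<eta>, so that the image lies in the open
  ball and the ratio exceeds 1.\<close>

lemma contract_in_ball:
  assumes x: "x \<in> K"
  shows "contract c (\<eta> + 1) x \<in> ball c \<rho>"
proof -
  have "c - contract c (\<eta> + 1) x = (1 / (\<eta> + 1)) *\<^sub>R (c - x)"
    by (simp add: contract_def algebra_simps)
  then have "dist c (contract c (\<eta> + 1) x) = dist c x / (\<eta> + 1)"
    using \<eta> by (simp add: dist_norm)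
  also have "\<dots> \<le> \<eta> * \<rho> / (\<eta> + 1)"
    using D[OF x] \<eta> by (intro divide_right_mono) auto
  also have "\<dots> < \<rho>" using \<eta> \<rho> by (simp add: field_simps)
  finally show ?thesis by simp
qed

text \<open>With T the contraction into the inscribed ball, g - \<kappa> is g \<circ> T - \<kappa>,
  controlled by the Poincare inequality of the ball after a change of variables, minus g \<circ> T -
  g, controlled by the gradient. The two contributions are the summands 4 * 2^d and \<eta> of the
  constant.\<close>

lemma poincare:
  assumes g: "g \<in> L2 K" and G: "\<And>i. is_weak_deriv K [i] g (G i)" "\<And>i. G i \<in> L2 K"
  shows "\<exists>\<kappa>. L2_norm K (\<lambda>x. g x - \<kappa>)
    \<le> (\<eta> + 4 * 2 ^ CARD('d)) * (\<eta> + 1) ^ CARD('d) * D * (\<Sum>i\<in>UNIV. L2_norm K (G i))"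
proof -
  let ?B = "ball c \<rho>" and ?R = "\<eta> + 1" and ?S = "\<Sum>i\<in>UNIV. L2_norm K (G i)"
  have Bs: "?B \<in> sets lebesgue" by auto
  have gB: "g \<in> L2 ?B" by (rule L2_subset[OF K_sets Bs \<rho>(2) g])
  have D0: "0 \<le> D" using \<rho> by simp
  have S0: "0 \<le> ?S" by (intro sum_nonneg) simp
  obtain \<kappa> where "L2_norm ?B (\<lambda>x. g x - \<kappa>) \<le> 4 * 2 ^ CARD('d) * \<rho> * (\<Sum>i\<in>UNIV. L2_norm ?B (G i))"
    using poincare_ball[OF \<rho>(1) gB is_weak_deriv_subset[OF open_K open_ball \<rho>(2) G(1)]
        L2_subset[OF K_sets Bs \<rho>(2) G(2)]] by blast
  also have "\<dots> \<le> 4 * 2 ^ CARD('d) * D * ?S"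
    using \<rho> by (intro mult_mono sum_mono L2_norm_subset[OF K_sets Bs \<rho>(2) G(2)] sum_nonneg) auto
  finally have \<kappa>: "L2_norm ?B (\<lambda>x. g x - \<kappa>) \<le> 4 * 2 ^ CARD('d) * D * ?S" .
  have gk: "(\<lambda>x. g x - \<kappa>) \<in> L2 ?B" by (rule L2_diff[OF gB L2_const]) simp
  have R: "?R > 1" "?R > 0" using \<eta> by auto
  note cT = contract_L2(2)[OF K_sets Bs R(2) contract_in_ball gk]
  have gT: "(\<lambda>x. g (contract c ?R x)) \<in> L2 K"
    by (rule contract_L2(1)[OF K_sets Bs R(2) contract_in_ball gB])
  have 1: "L2_norm K (\<lambda>x. g (contract c ?R x) - \<kappa>) \<le> ?R ^ CARD('d) * (4 * 2 ^ CARD('d) * D * ?S)"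
  proof (rule power2_le_imp_le)
    have "(L2_norm K (\<lambda>x. g (contract c ?R x) - \<kappa>))\<^sup>2 \<le> ?R ^ CARD('d) * (L2_norm ?B (\<lambda>x. g x - \<kappa>))\<^sup>2"
      using cT by simp
    \<comment> \<open>One factor R^d would do for the square; a second one makes it a perfect
      square.\<close>
    also have "\<dots> \<le> (?R ^ CARD('d) * ?R ^ CARD('d)) * (4 * 2 ^ CARD('d) * D * ?S)\<^sup>2"
      using R \<kappa> by (intro mult_mono power_mono) (auto intro: one_le_power mult_right_mono[of 1, simplified])
    finally show "(L2_norm K (\<lambda>x. g (contract c ?R x) - \<kappa>))\<^sup>2 \<le> (?R ^ CARD('d) * (4 * 2 ^ CARD('d) * D * ?S))\<^sup>2"
      by (simp add: power_mult_distrib power2_eq_square[of "?R ^ _"])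
    show "0 \<le> ?R ^ CARD('d) * (4 * 2 ^ CARD('d) * D * ?S)" using R D0 S0 by simp
  qed
  have 2: "L2_norm K (\<lambda>x. g (contract c ?R x) - g x) \<le> (?R - 1) * (D * ?R ^ CARD('d) * ?S)"
    by (rule L2_norm_contract_diff[OF open_K bounded_K star R(1) g G D0 component_le])
  have "L2_norm K (\<lambda>x. g x - \<kappa>) = L2_norm K (\<lambda>x. (g (contract c ?R x) - \<kappa>) - (g (contract c ?R x) - g x))"
    by simp
  also have "\<dots> \<le> L2_norm K (\<lambda>x. g (contract c ?R x) - \<kappa>) + L2_norm K (\<lambda>x. g (contract c ?R x) - g x)"
    by (intro L2_norm_diff L2_diff gT g L2_const K_lmeasurable)
  also have "\<dots> \<le> ?R ^ CARD('d) * (4 * 2 ^ CARD('d) * D * ?S) + (?R - 1) * (D * ?R ^ CARD('d) * ?S)"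
    using 1 2 by linarith
  also have "\<dots> = (\<eta> + 4 * 2 ^ CARD('d)) * ?R ^ CARD('d) * D * ?S"
    by (simp add: algebra_simps)
  finally show ?thesis by blast
qed

text \<open>The splitting of \<open>poincare\<close> in the sup norm, where changing variables costs
  nothing: 4 comes from the ball and \<eta> = R - 1 from the contraction.\<close>

lemma oscillation:
  fixes M :: real
  assumes g: "integrable (lebesgue_on K) g" and G: "\<And>i. is_weak_deriv K [i] g (G i)"
    and M: "0 \<le> M" "\<And>i. AE x in lebesgue_on K. \<bar>G i x\<bar> \<le> M"
  shows "\<exists>\<kappa>. AE x in lebesgue_on K. \<bar>g x - \<kappa>\<bar> \<le> (\<eta> + 4) * real CARD('d) * M * D"
proof -
  let ?B = "ball c \<rho>" and ?R = "\<eta> + 1"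
  have Bs: "?B \<in> sets lebesgue" by auto
  have D0: "0 \<le> D" using \<rho> by simp
  have R: "?R > 1" "?R > 0" using \<eta> by auto
  have "AE x in lebesgue_on ?B. \<bar>G i x\<bar> \<le> M" for i
    by (rule AE_lebesgue_on_subset[OF K_sets Bs \<rho>(2) M(2)])
  then obtain \<kappa> where \<kappa>: "AE x in lebesgue_on ?B. \<bar>g x - \<kappa>\<bar> \<le> 4 * real CARD('d) * M * \<rho>"
    using oscillation_ball[OF \<rho>(1) integrable_lebesgue_on_subset[OF K_sets Bs \<rho>(2) g]
        is_weak_deriv_subset[OF open_K open_ball \<rho>(2) G] M(1)] by blast
  have 1: "AE x in lebesgue_on K. \<bar>g (contract c ?R x) - \<kappa>\<bar> \<le> 4 * real CARD('d) * M * \<rho>"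
    by (rule AE_contract[OF K_sets Bs R(2) contract_in_ball \<kappa>])
  have 2: "AE x in lebesgue_on K. \<bar>g (contract c ?R x) - g x\<bar> \<le> (?R - 1) * (real CARD('d) * (M * D))"
    by (rule AE_contract_diff_le[OF open_K star R(1) g G M D0 component_le])
  have "4 * real CARD('d) * M * \<rho> \<le> 4 * real CARD('d) * M * D"
    using \<rho> M by (intro mult_left_mono) auto
  then have le: "4 * real CARD('d) * M * \<rho> + (?R - 1) * (real CARD('d) * (M * D)) \<le> (\<eta> + 4) * real CARD('d) * M * D"
    by (simp add: algebra_simps)
  from 1 2 have "AE x in lebesgue_on K. \<bar>g x - \<kappa>\<bar> \<le> (\<eta> + 4) * real CARD('d) * M * D"
    by eventually_elim (use le in linarith)
  then show ?thesis ..
qed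

end

section \<open>Meshes and cell averages\<close>

lemma polytopal_domain_D:
  fixes K :: "'a::euclidean_space set"
  assumes "polytopal_domain K"
  shows "open K" "bounded K" "K \<noteq> {}" "K \<in> lmeasurable" "0 < measure lebesgue K" "negligible (frontier K)"
proof -
  show K: "open K" "bounded K" "K \<noteq> {}" using assms by (auto simp: polytopal_domain_def)
  show Km: "K \<in> lmeasurable" using K by (simp add: lmeasurable_open)
  have "\<not> negligible K" using open_not_negligible[OF K(1,3)] .
  then show "0 < measure lebesgue K"
    using Km by (simp add: negligible_iff_measure0[OF Km] zero_less_measure_iff)
  obtain \<F> where F: "finite \<F>" "\<And>\<sigma>. \<sigma> \<in> \<F> \<Longrightarrow> aff_dim \<sigma> = int DIM('a) - 1" "frontier K = \<Union>\<F>"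
    using assms by (auto simp: polytopal_domain_def)
  have "negligible \<sigma>" if "\<sigma> \<in> \<F>" for \<sigma>
  proof -
    have "aff_dim \<sigma> < int DIM('a)" using F(2)[OF that] by simp
    then obtain a b where "a \<noteq> 0" "\<sigma> \<subseteq> {x. a \<bullet> x = b}" by (rule aff_lowdim_subset_hyperplane)
    then show ?thesis using negligible_hyperplane[of a b] negligible_subset by blast
  qed
  then show "negligible (frontier K)" unfolding F(3) using F(1) by (intro negligible_Union)
qed

lemma polytopal_mesh_D:
  assumes "polytopal_mesh S \<M>"
  shows "finite \<M>" "\<And>K. K \<in> \<M> \<Longrightarrow> polytopal_domain K" "\<And>K. K \<in> \<M> \<Longrightarrow> K \<subseteq> S" "pairwise disjnt \<M>"
    "\<And>K x. K \<in> \<M> \<Longrightarrow> x \<in> K \<Longrightarrow> closed_segment (centroid K) x \<subseteq> K"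
    "negligible (S - \<Union>\<M>)"
proof -
  show fin: "finite \<M>" and dom: "\<And>K. K \<in> \<M> \<Longrightarrow> polytopal_domain K" and "\<And>K. K \<in> \<M> \<Longrightarrow> K \<subseteq> S" "pairwise disjnt \<M>"
    "\<And>K x. K \<in> \<M> \<Longrightarrow> x \<in> K \<Longrightarrow> closed_segment (centroid K) x \<subseteq> K"
    using assms by (auto simp: polytopal_mesh_def)
  have cl: "closure S = (\<Union>K\<in>\<M>. closure K)" using assms by (auto simp: polytopal_mesh_def)
  \<comment> \<open>The closed cells cover \<open>S\<close>, so a point outside every open cell lies
    on the boundary of one of them, and boundaries lie in finitely many hyperplanes.\<close>
  have "S - \<Union>\<M> \<subseteq> (\<Union>K\<in>\<M>. frontier K)"
  proof
    fix x assume x: "x \<in> S - \<Union>\<M>"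
    then have "x \<in> closure S" using closure_subset by auto
    then obtain K where K: "K \<in> \<M>" "x \<in> closure K" using cl by auto
    then have "x \<in> frontier K"
      using x interior_open[OF polytopal_domain_D(1)[OF dom[OF K(1)]]] by (auto simp: frontier_def)
    then show "x \<in> (\<Union>K\<in>\<M>. frontier K)" using K by auto
  qed
  moreover have "negligible (\<Union>K\<in>\<M>. frontier K)"
    using fin polytopal_domain_D(6)[OF dom] by (intro negligible_Union) auto
  ultimately show "negligible (S - \<Union>\<M>)" using negligible_subset by blast
qed

lemma star_cell_mesh:
  fixes \<M> :: "(real^'d::finite) set set"
  assumes M: "polytopal_mesh S \<M>" and reg: "mesh_regular \<M> \<eta>" and \<eta>: "\<eta> > 0" and K: "K \<in> \<M>"
  shows "star_cell K (centroid K) (inradius K) (diameter K) \<eta>" "diameter K \<le> mesh_size \<M>"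
proof -
  note pd = polytopal_domain_D[OF polytopal_mesh_D(2)[OF M K]]
  note star = polytopal_mesh_D(5)[OF M K]
  let ?c = "centroid K" and ?A = "{r. 0 \<le> r \<and> ball (centroid K) r \<subseteq> K}"
  obtain x0 where "x0 \<in> K" using pd(3) by blast
  \<comment> \<open>The segment from the centroid to any point of the cell contains the
    centroid.\<close>
  then have cK: "?c \<in> K" using star ends_in_segment(1) by blast
  then obtain e where e: "e > 0" "ball ?c e \<subseteq> K" using pd(1) openE by blast
  have rA: "r \<le> diameter K" if "r \<in> ?A" for r
  proof -
    have "diameter (ball ?c r) \<le> diameter K" using that by (intro diameter_subset pd) auto
    then show ?thesis using that by (auto split: if_splits)
  qed
  have bdd: "bdd_above ?A" using rA by (rule bdd_aboveI)
  have pos: "0 < inradius K"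
    unfolding inradius_def using e by (intro less_le_trans[OF e(1)] cSup_upper bdd) auto
  show "star_cell K ?c (inradius K) (diameter K) \<eta>"
  proof
    show "open K" by (rule pd)
    show "closed_segment ?c x \<subseteq> K" if "x \<in> K" for x by (rule star[OF that])
    show "0 < inradius K" by (rule pos)
    \<comment> \<open>The supremum is attained, because an open ball is the union of the smaller
      concentric ones.\<close>
    show "ball ?c (inradius K) \<subseteq> K"
    proof
      fix y assume "y \<in> ball ?c (inradius K)"
      then have "dist ?c y < Sup ?A" by (simp add: inradius_def)
      then obtain r where "r \<in> ?A" "dist ?c y < r"
        using less_cSup_iff[of ?A "dist ?c y"] bdd e by (metis (mono_tags, lifting) empty_iff less_imp_le mem_Collect_eq)
      then show "y \<in> K" by auto
    qed
    show "inradius K \<le> diameter K"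
      unfolding inradius_def using e by (intro cSup_least rA) (auto intro: less_imp_le)
    show "dist ?c x \<le> diameter K" if "x \<in> K" for x
      by (rule diameter_bounded_bound[OF pd(2) cK that])
    show "0 < \<eta>" by (rule \<eta>)
    have "diameter K / inradius K \<le> \<eta>" using reg K by (simp add: mesh_regular_def)
    then show "diameter K \<le> \<eta> * inradius K" using pos by (simp add: field_simps)
  qed
  show "diameter K \<le> mesh_size \<M>"
    unfolding mesh_size_def using polytopal_mesh_D(1)[OF M] K by (intro Max_ge) auto
qed

definition cell_avg :: "'a::euclidean_space set \<Rightarrow> ('a \<Rightarrow> real) \<Rightarrow> real" where
  "cell_avg K v = (1 / measure lebesgue K) * (LINT y|lebesgue_on K. v y)"

lemma mesh_proj_eq_cell_avg:
  assumes "finite \<M>" "pairwise disjnt \<M>" "K \<in> \<M>" "x \<in> K"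
  shows "mesh_proj \<M> v x = cell_avg K v"
proof -
  have "mesh_proj \<M> v x = (\<Sum>L\<in>\<M>. if L = K then cell_avg K v else 0)"
    unfolding mesh_proj_def using assms
    by (intro sum.cong) (auto simp: pairwise_def disjnt_iff indicator_def cell_avg_def)
  then show ?thesis using assms by simp
qed

lemma mesh_proj_L2:
  assumes S: "S \<in> lmeasurable" and M: "finite \<M>" "\<And>K. K \<in> \<M> \<Longrightarrow> K \<in> sets lebesgue"
  shows "mesh_proj \<M> v \<in> L2 S"
proof -
  have "(\<lambda>x. indicator K x * c) \<in> L2 S" if "K \<in> \<M>" for K and c :: real
  proof (rule L2_bounded[OF S, of _ "\<bar>c\<bar>"])
    show "(\<lambda>x. indicat_real K x * c) \<in> borel_measurable (lebesgue_on S)"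
      using M(2)[OF that] by (intro borel_measurable_times measurable_restrict_space1 borel_measurable_indicator) auto
  qed (auto simp: indicator_def)
  then show ?thesis unfolding mesh_proj_def[abs_def] by (intro L2_sum)
qed

lemma integral_cell_avg:
  assumes "K \<in> lmeasurable" "0 < measure lebesgue K"
  shows "(LINT y|lebesgue_on K. c) = c * measure lebesgue K"
    and "cell_avg K v * measure lebesgue K = (LINT y|lebesgue_on K. v y)"
proof -
  have "(LINT y|lebesgue_on K. c) = c * measure (lebesgue_on K) (space (lebesgue_on K))" by simp
  also have "measure (lebesgue_on K) (space (lebesgue_on K)) = measure lebesgue K"
    using assms(1) by (simp add: space_restrict_space measure_restrict_space fmeasurableD)
  finally show "(LINT y|lebesgue_on K. c) = c * measure lebesgue K" .
  show "cell_avg K v * measure lebesgue K = (LINT y|lebesgue_on K. v y)"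
    using assms(2) by (simp add: cell_avg_def)
qed

text \<open>Pythagoras: the cross term contains the integral of g minus its mean, which vanishes. It
  turns the unspecified constant of the Poincare inequality into the cell mean.\<close>

lemma L2_norm_cell_avg_le:
  fixes g :: "'a::euclidean_space \<Rightarrow> real"
  assumes K: "K \<in> lmeasurable" "0 < measure lebesgue K" and g: "g \<in> L2 K"
  shows "L2_norm K (\<lambda>x. g x - cell_avg K g) \<le> L2_norm K (\<lambda>x. g x - \<kappa>)"
proof (rule power2_le_imp_le)
  let ?m = "cell_avg K g"
  have gi: "integrable (lebesgue_on K) g" by (rule L2_integrable[OF K(1) g])
  have c: "(\<lambda>x. t) \<in> L2 K" for t :: real by (rule L2_const[OF K(1)])
  have ci: "integrable (lebesgue_on K) (\<lambda>x. t)" for t :: real by (rule L2_integrable[OF K(1) c])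
  have d: "integrable (lebesgue_on K) (\<lambda>x. (g x - ?m)\<^sup>2)"
    using L2_D(2)[OF L2_diff[OF g c[of ?m]]] by simp
  have "(LINT x|lebesgue_on K. (norm (g x - \<kappa>))\<^sup>2)
      = (LINT x|lebesgue_on K. (g x - ?m)\<^sup>2 + 2 * (?m - \<kappa>) * (g x - ?m) + (?m - \<kappa>)\<^sup>2)"
    by (intro Bochner_Integration.integral_cong) (auto simp: power2_eq_square algebra_simps)
  also have "\<dots> = (LINT x|lebesgue_on K. (g x - ?m)\<^sup>2) + 2 * (?m - \<kappa>) * (LINT x|lebesgue_on K. g x - ?m) + (LINT x|lebesgue_on K. (?m - \<kappa>)\<^sup>2)"
    using gi ci d by (simp del: integral_const lebesgue_integral_const)
  also have "(LINT x|lebesgue_on K. g x - ?m) = 0"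
    unfolding Bochner_Integration.integral_diff[OF gi ci] integral_cell_avg(1)[OF K]
      integral_cell_avg(2)[OF K, symmetric] by simp
  also have "(LINT x|lebesgue_on K. (?m - \<kappa>)\<^sup>2) = (?m - \<kappa>)\<^sup>2 * measure lebesgue K"
    by (rule integral_cell_avg(1)[OF K])
  finally have "(LINT x|lebesgue_on K. (g x - ?m)\<^sup>2) \<le> (LINT x|lebesgue_on K. (norm (g x - \<kappa>))\<^sup>2)"
    by simp
  then show "(L2_norm K (\<lambda>x. g x - ?m))\<^sup>2 \<le> (L2_norm K (\<lambda>x. g x - \<kappa>))\<^sup>2"
    by (simp add: L2_norm_square)
qed simp

section \<open>Clipping and its interplay with cell averages\<close>

lemma clip_le: "a \<le> b \<Longrightarrow> a \<le> clip a b s" "clip a b s \<le> b"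
  by (auto simp: clip_def)

lemma clip_lipschitz: "\<bar>clip a b s - clip a b t\<bar> \<le> \<bar>s - t\<bar>"
  by (auto simp: clip_def)

text \<open>For a \<le> b, \<open>minmod a b\<close> is the distance from 0 to [a, b], that is |clip
  a b 0|, and clipping is 1-Lipschitz.\<close>

lemma clip_abs_le: "a \<le> b \<Longrightarrow> \<bar>clip a b s\<bar> \<le> minmod a b + \<bar>s\<bar>"
  by (auto simp: clip_def minmod_def mult_le_0_iff min_def max_def abs_if)

lemma clip_projection: "a \<le> b \<Longrightarrow> a \<le> v \<Longrightarrow> v \<le> b \<Longrightarrow> (clip a b s - s) * (v - clip a b s) \<ge> 0"
  by (auto simp: clip_def min_def max_def mult_nonneg_nonneg mult_nonpos_nonpos)

lemma minmod_nonneg: "0 \<le> minmod a b"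
  by (simp add: minmod_def)

lemma measurable_clip: "f \<in> borel_measurable M \<Longrightarrow> (\<lambda>x. clip a b (f x)) \<in> borel_measurable M"
  unfolding clip_def by (intro borel_measurable_min borel_measurable_max) auto

lemma AE_const_positive:
  assumes "K \<in> lmeasurable" "0 < measure lebesgue K" "AE x in lebesgue_on K. P"
  shows P
proof (rule ccontr)
  assume "\<not> P"
  then have "AE x in lebesgue. x \<notin> K" using assms by (simp add: AE_lebesgue_on_iff fmeasurableD)
  then have "K \<in> null_sets lebesgue" using assms AE_iff_null_sets fmeasurableD by blast
  then show False using assms(2) by (simp add: measure_eq_0_null_sets)
qed

text \<open>A bound \<open>m < b\<close> of \<open>clip \<circ> g\<close> from above already bounds \<open>g\<close>, hence its mean; likewise from below.\<close>

lemma clip_cell_avg_near: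
  fixes g :: "'a::euclidean_space \<Rightarrow> real"
  assumes K: "K \<in> lmeasurable" "0 < measure lebesgue K" and g: "integrable (lebesgue_on K) g"
    and ab: "a \<le> b" and osc: "AE x in lebesgue_on K. \<bar>clip a b (g x) - \<kappa>\<bar> \<le> \<delta>"
  shows "\<bar>clip a b (cell_avg K g) - \<kappa>\<bar> \<le> \<delta>"
proof -
  have ci: "integrable (lebesgue_on K) (\<lambda>x. t)" for t :: real
    by (rule L2_integrable[OF K(1) L2_const[OF K(1)]])
  have up: "clip a b (cell_avg K g) \<le> \<kappa> + \<delta>"
  proof (cases "b \<le> \<kappa> + \<delta>")
    case True
    then show ?thesis using clip_le(2)[of a b "cell_avg K g"] by linarith
  next
    case False
    have "AE x in lebesgue_on K. a \<le> \<kappa> + \<delta>"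
      using osc by eventually_elim (use clip_le(1)[OF ab] in \<open>smt (verit)\<close>)
    then have a: "a \<le> \<kappa> + \<delta>" by (rule AE_const_positive[OF K])
    have "AE x in lebesgue_on K. g x \<le> \<kappa> + \<delta>"
      using osc by eventually_elim (use False in \<open>auto simp: clip_def min_def max_def split: if_splits\<close>)
    then have "(LINT x|lebesgue_on K. g x) \<le> (LINT x|lebesgue_on K. \<kappa> + \<delta>)"
      by (intro integral_mono_AE g ci)
    then have "cell_avg K g * measure lebesgue K \<le> (\<kappa> + \<delta>) * measure lebesgue K"
      unfolding integral_cell_avg(1)[OF K] integral_cell_avg(2)[OF K, symmetric] .
    then have "cell_avg K g \<le> \<kappa> + \<delta>" using K(2) by simp
    then show ?thesis using a by (auto simp: clip_def)
  qed
  have lo: "\<kappa> - \<delta> \<le> clip a b (cell_avg K g)"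
  proof (cases "\<kappa> - \<delta> \<le> a")
    case True
    then show ?thesis using clip_le(1)[OF ab, of "cell_avg K g"] by linarith
  next
    case False
    have "AE x in lebesgue_on K. \<kappa> - \<delta> \<le> b"
      using osc by eventually_elim (use clip_le(2) in \<open>smt (verit)\<close>)
    then have b: "\<kappa> - \<delta> \<le> b" by (rule AE_const_positive[OF K])
    have "AE x in lebesgue_on K. \<kappa> - \<delta> \<le> g x"
      using osc by eventually_elim (use False in \<open>auto simp: clip_def min_def max_def split: if_splits\<close>)
    then have "(LINT x|lebesgue_on K. \<kappa> - \<delta>) \<le> (LINT x|lebesgue_on K. g x)"
      by (intro integral_mono_AE g ci)
    then have "(\<kappa> - \<delta>) * measure lebesgue K \<le> cell_avg K g * measure lebesgue K"
      unfolding integral_cell_avg(1)[OF K] integral_cell_avg(2)[OF K, symmetric] .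
    then have "\<kappa> - \<delta> \<le> cell_avg K g" using K(2) by simp
    then show ?thesis using b by (auto simp: clip_def)
  qed
  show ?thesis using up lo by linarith
qed

lemma W1inf_weak_deriv:
  assumes K: "open K" and u: "u \<in> W1inf K"
  shows "is_weak_deriv K [i] u (weak_deriv K [i] u)"
    "AE x in lebesgue_on K. \<bar>weak_deriv K [i] u x\<bar> \<le> W1inf_norm K u" "0 \<le> W1inf_norm K u"
proof -
  obtain v where v: "v \<in> Linf K" "is_weak_deriv K [i] u v" using u by (force simp: W1inf_def)
  note ae = weak_deriv_AE[OF K v(2)]
  have ae': "AE x in lebesgue_on K. v x = weak_deriv K [i] u x" using ae(1) by eventually_elim simp
  obtain M where M: "AE x in lebesgue_on K. \<bar>v x\<bar> \<le> M" using v by (auto simp: Linf_def)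
  have "AE x in lebesgue_on K. \<bar>weak_deriv K [i] u x\<bar> \<le> M"
    using M ae(1) by eventually_elim simp
  moreover have "weak_deriv K [i] u \<in> borel_measurable (lebesgue_on K)"
    using borel_measurable_lebesgue_on_cong_AE[OF _ _ ae'] K v(1) by (simp add: Linf_def)
  ultimately have L: "weak_deriv K [i] u \<in> Linf K" by (auto simp: Linf_def)
  have le: "Linf_norm K (weak_deriv K [i] u) \<le> W1inf_norm K u"
    unfolding W1inf_norm_def using finite_lists_le[of 1] by (intro Max_ge) auto
  show "is_weak_deriv K [i] u (weak_deriv K [i] u)" by (rule ae(2))
  show "AE x in lebesgue_on K. \<bar>weak_deriv K [i] u x\<bar> \<le> W1inf_norm K u"
    using Linf_norm_AE(1)[OF L] by eventually_elim (use le in linarith)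
  show "0 \<le> W1inf_norm K u" using Linf_norm_AE(2)[OF L] le by linarith
qed

lemma broken_W1inf_norm_ge:
  assumes "finite \<K>"
  shows "K \<in> \<K> \<Longrightarrow> W1inf_norm K u \<le> broken_W1inf_norm \<K> u" and "0 \<le> broken_W1inf_norm \<K> u"
  using assms by (auto simp: broken_W1inf_norm_def)

section \<open>The Hessian scheme and the discrete adjoint error\<close>

text \<open>Induction over a spanning set in the manner of Gram-Schmidt: \<open>r\<close> is the
  part of the new vector orthogonal to the old span, and the representer is corrected along
  \<open>r\<close>. The functional stays arbitrary, since the induction hypothesis is also needed
  for \<open>b s\<close>.\<close>

lemma riesz_span:
  fixes b :: "'x::real_vector \<Rightarrow> 'x \<Rightarrow> real"
  assumes X: "subspace X"
    and add: "\<And>u v w. u \<in> X \<Longrightarrow> v \<in> X \<Longrightarrow> w \<in> X \<Longrightarrow> b (u + v) w = b u w + b v w"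
    and scale: "\<And>c u w. u \<in> X \<Longrightarrow> w \<in> X \<Longrightarrow> b (c *\<^sub>R u) w = c * b u w"
    and sym: "\<And>u w. u \<in> X \<Longrightarrow> w \<in> X \<Longrightarrow> b u w = b w u"
    and pos: "\<And>u. u \<in> X \<Longrightarrow> b u u = 0 \<Longrightarrow> u = 0"
    and S: "finite S" "S \<subseteq> X"
    and lf: "\<And>u v. u \<in> X \<Longrightarrow> v \<in> X \<Longrightarrow> lf (u + v) = lf u + lf v" "\<And>c u. u \<in> X \<Longrightarrow> lf (c *\<^sub>R u) = c * lf u"
  shows "\<exists>w\<in>span S. \<forall>v\<in>span S. b w v = lf v"
  using S lf
proof (induction S arbitrary: lf rule: finite_induct)
  case empty
  have "0 \<in> X" using X by (rule subspace_0)
  then show ?case using scale[of 0 0 0] empty(3)[of 0 0] by simp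
next
  case (insert s S)
  have sX: "s \<in> X" and SX: "S \<subseteq> X" using insert.prems by auto
  have span: "v \<in> X" if "v \<in> span S" for v using span_minimal[OF SX X] that by blast
  \<comment> \<open>The induction hypothesis for the functional \<open>b s\<close> yields the
    orthogonal projection of s onto the old span.\<close>
  obtain s' where s': "s' \<in> span S" "\<And>v. v \<in> span S \<Longrightarrow> b s' v = b s v"
    using insert.IH[OF SX, of "b s"] add sym scale sX X
    by (metis subspace_add subspace_scale)
  define r where "r = s - s'"
  have rX: "r \<in> X" unfolding r_def using sX span[OF s'(1)] X by (rule subspace_diff[rotated])
  have rv: "b r v = 0" if "v \<in> span S" for v
  proof -
    have "b s v = b (r + s') v" by (simp add: r_def)
    also have "\<dots> = b r v + b s' v" by (rule add[OF rX span[OF s'(1)] span[OF that]])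
    finally show ?thesis using s'(2)[OF that] by simp
  qed
  show ?case
  proof (cases "r = 0")
    case True
    then have "s \<in> span S" using s'(1) by (simp add: r_def)
    then show ?thesis using insert.IH[OF SX insert.prems(2,3)] by (simp add: span_redundant)
  next
    case False
    obtain w0 where w0: "w0 \<in> span S" "\<And>v. v \<in> span S \<Longrightarrow> b w0 v = lf v"
      using insert.IH[OF SX insert.prems(2,3)] by blast
    have w0X: "w0 \<in> X" by (rule span[OF w0(1)])
    \<comment> \<open>Chosen so that b w r = lf r; on the old span the correction has no effect
      because r is orthogonal to it.\<close>
    define k where "k = (lf r - b w0 r) / b r r"
    define w where "w = w0 + k *\<^sub>R r"
    have krX: "k *\<^sub>R r \<in> X" using rX X by (rule subspace_scale[rotated])
    have bw: "b w v = b w0 v + k * b r v" if "v \<in> X" for v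
      unfolding w_def using add[OF w0X krX that] scale[OF rX that] by simp
    have wX: "w \<in> X" unfolding w_def using w0X krX X by (rule subspace_add[rotated])
    have sub: "span S \<subseteq> span (insert s S)" by (rule span_mono) auto
    have "r \<in> span (insert s S)"
      unfolding r_def using span_diff[OF span_base[of s "insert s S"]] s'(1) sub by blast
    then have "w \<in> span (insert s S)"
      unfolding w_def using w0(1) sub by (intro span_add span_scale) auto
    moreover have "b w v = lf v" if vs: "v \<in> span (insert s S)" for v
    proof -
      obtain t where t: "v - t *\<^sub>R s \<in> span S" using vs span_breakdown_eq by blast
      define z where "z = (v - t *\<^sub>R s) + t *\<^sub>R s'"
      have z: "z \<in> span S" unfolding z_def using t s'(1) by (intro span_add span_scale)
      have v: "v = t *\<^sub>R r + z" by (simp add: z_def r_def algebra_simps)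
      have trX: "t *\<^sub>R r \<in> X" using rX X by (rule subspace_scale[rotated])
      have "b w r = lf r" using bw[OF rX] pos[OF rX] False by (auto simp: k_def)
      moreover have "b w z = lf z" using bw[OF span[OF z]] w0(2)[OF z] rv[OF z] by simp
      moreover have "b w v = t * b w r + b w z"
        using sym add[OF trX span[OF z] wX] scale[OF rX wX] wX rX trX span[OF z] v X subspace_add by metis
      moreover have "lf v = t * lf r + lf z"
        using v insert.prems(2)[OF trX span[OF z]] insert.prems(3)[OF rX] by simp
      ultimately show ?thesis by simp
    qed
    ultimately show ?thesis by blast
  qed
qed

text \<open>\<open>P\<close> is the stability constant of the reconstruction; the locale is entered
  later with the value that (A3) supplies.\<close>

locale hessian_scheme_setting =
  fixes \<Omega> :: "(real^'d::finite) set" and X :: "'x::real_vector set"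
    and PiD :: "'x \<Rightarrow> real^'d \<Rightarrow> real" and GradD :: "'x \<Rightarrow> real^'d \<Rightarrow> real^'d"
    and HD :: "'x \<Rightarrow> real^'d \<Rightarrow> real^'d^'d" and P :: real
  assumes \<Omega>: "\<Omega> \<in> lmeasurable" and hd: "hessian_discretisation \<Omega> X PiD GradD HD"
    and P: "0 \<le> P" "\<And>v. v \<in> X \<Longrightarrow> L2_norm \<Omega> (PiD v) \<le> P * L2_norm \<Omega> (HD v)"
begin

lemma \<Omega>_sets: "\<Omega> \<in> sets lebesgue"
  using \<Omega> by (rule fmeasurableD)

lemma X: "subspace X" and X_span: "\<exists>S. finite S \<and> X = span S"
  using hd by (auto simp: hessian_discretisation_def)

lemma PiD_L2: "v \<in> X \<Longrightarrow> PiD v \<in> L2 \<Omega>" and HD_L2: "v \<in> X \<Longrightarrow> HD v \<in> L2 \<Omega>"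
  using hd by (auto simp: hessian_discretisation_def)

lemma ae_linear:
  assumes "v \<in> X" "w \<in> X"
  shows "AE x in lebesgue_on \<Omega>. PiD (v + w) x = PiD v x + PiD w x"
    "AE x in lebesgue_on \<Omega>. HD (v + w) x = HD v x + HD w x"
    "AE x in lebesgue_on \<Omega>. PiD (c *\<^sub>R v) x = c *\<^sub>R PiD v x"
    "AE x in lebesgue_on \<Omega>. HD (c *\<^sub>R v) x = c *\<^sub>R HD v x"
  using hd assms by (auto simp: hessian_discretisation_def ae_linear_on_def)

lemma PiD_diff:
  assumes "v \<in> X" "w \<in> X"
  shows "AE x in lebesgue_on \<Omega>. PiD (v - w) x = PiD v x - PiD w x"
proof -
  have m: "(-1) *\<^sub>R w \<in> X" using X assms(2) by (rule subspace_scale)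
  have "AE x in lebesgue_on \<Omega>. PiD (v + (-1) *\<^sub>R w) x = PiD v x - PiD w x"
    using ae_linear(1)[OF assms(1) m] ae_linear(3)[OF assms(2,1), of "-1"] by eventually_elim simp
  then show ?thesis by simp
qed

lemma aD_add: "u \<in> X \<Longrightarrow> v \<in> X \<Longrightarrow> w \<in> X \<Longrightarrow> aD \<Omega> HD (u + v) w = aD \<Omega> HD u w + aD \<Omega> HD v w"
  unfolding aD_def
  by (subst L2_inner_cong_AE[OF \<Omega>_sets ae_linear(2) AE_I2[OF refl]])
     (auto simp: L2_inner_add_left HD_L2)

lemma aD_scale: "u \<in> X \<Longrightarrow> w \<in> X \<Longrightarrow> aD \<Omega> HD (c *\<^sub>R u) w = c * aD \<Omega> HD u w"
  unfolding aD_def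
  by (subst L2_inner_cong_AE[OF \<Omega>_sets ae_linear(4) AE_I2[OF refl]])
     (auto simp: L2_inner_scaleR_left)

lemma aD_commute: "aD \<Omega> HD u w = aD \<Omega> HD w u"
  unfolding aD_def by (rule L2_inner_commute)

lemma aD_self: "aD \<Omega> HD u u = (L2_norm \<Omega> (HD u))\<^sup>2"
  unfolding aD_def by (rule L2_inner_self)

lemma aD_diff:
  assumes "u \<in> X" "v \<in> X" "w \<in> X"
  shows "aD \<Omega> HD (u - v) w = aD \<Omega> HD u w - aD \<Omega> HD v w"
  using aD_add[of u "(-1) *\<^sub>R v" w] aD_scale[of v w "-1"] assms subspace_scale[OF X, of v "-1"] by simp

abbreviation scheme :: "(real^'d \<Rightarrow> real) \<Rightarrow> 'x \<Rightarrow> bool" where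
  "scheme g w \<equiv> hessian_scheme \<Omega> X PiD HD g w"

text \<open>The error analysis runs through auxiliary discrete solutions with intermediate sources,
  whose existence is obtained here from the Riesz representation.\<close>

lemma scheme_ex:
  assumes g: "g \<in> L2 \<Omega>"
  shows "\<exists>w. scheme g w"
proof -
  obtain S where S: "finite S" "X = span S" using X_span by blast
  have "\<exists>w\<in>span S. \<forall>v\<in>span S. aD \<Omega> HD w v = L2_inner \<Omega> g (PiD v)"
  proof (rule riesz_span[OF X aD_add aD_scale aD_commute _ S(1)])
    show "u = 0" if "u \<in> X" "aD \<Omega> HD u u = 0" for u
      using that hd by (auto simp: aD_self hessian_discretisation_def is_norm_on_def)
    show "S \<subseteq> X" using S(2) span_superset by blast
    show "L2_inner \<Omega> g (PiD (u + v)) = L2_inner \<Omega> g (PiD u) + L2_inner \<Omega> g (PiD v)" if "u \<in> X" "v \<in> X" for u v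
      using L2_inner_cong_AE[OF \<Omega>_sets ae_linear(1)[OF that] AE_I2[OF refl], of g]
        L2_inner_add_left[OF PiD_L2[OF that(1)] PiD_L2[OF that(2)] g]
      by (simp add: L2_inner_commute[of \<Omega> g])
    show "L2_inner \<Omega> g (PiD (c *\<^sub>R u)) = c * L2_inner \<Omega> g (PiD u)" if "u \<in> X" for c u
      using L2_inner_cong_AE[OF \<Omega>_sets ae_linear(3)[OF that that] AE_I2[OF refl], of c g]
      by (simp add: L2_inner_commute[of \<Omega> g] L2_inner_mult_left)
  qed
  then show ?thesis using S(2) by (auto simp: hessian_scheme_def)
qed

lemma scheme_D: "scheme g w \<Longrightarrow> w \<in> X" "scheme g w \<Longrightarrow> v \<in> X \<Longrightarrow> aD \<Omega> HD w v = L2_inner \<Omega> g (PiD v)"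
  by (auto simp: hessian_scheme_def)

lemma scheme_cong:
  assumes "AE x in lebesgue_on \<Omega>. g x = g' x" "scheme g w"
  shows "scheme g' w"
  unfolding hessian_scheme_def
  using scheme_D[OF assms(2)] L2_inner_cong_AE[OF \<Omega>_sets assms(1) AE_I2[OF refl]] by simp

lemma scheme_diff:
  assumes "scheme g w" "scheme g' w'" "g \<in> L2 \<Omega>" "g' \<in> L2 \<Omega>"
  shows "scheme (\<lambda>x. g x - g' x) (w - w')"
  unfolding hessian_scheme_def
  using scheme_D[OF assms(1)] scheme_D[OF assms(2)] subspace_diff[OF X]
  by (simp add: aD_diff L2_inner_diff_left assms(3,4) PiD_L2)

text \<open>Reciprocity: both sides are the discrete energy product of \<open>w\<close> and
  \<open>w'\<close>. It serves as the discrete duality argument and as the source of the sign of the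
  adjoint term.\<close>

lemma scheme_sym:
  assumes "scheme g w" "scheme g' w'"
  shows "L2_inner \<Omega> g (PiD w') = L2_inner \<Omega> g' (PiD w)"
  using scheme_D(2)[OF assms(1) scheme_D(1)[OF assms(2)]] scheme_D(2)[OF assms(2) scheme_D(1)[OF assms(1)]]
  by (simp add: aD_commute[of w])

text \<open>\<open>F\<close> bounds the source only as a functional, and only at the reconstruction
  of \<open>w\<close> itself. So sources that are small merely against reconstructed functions, as
  in (A1)(ii), can be used.\<close>

lemma scheme_stable:
  assumes w: "scheme g w" and F: "0 \<le> F" "\<bar>L2_inner \<Omega> g (PiD w)\<bar> \<le> F * L2_norm \<Omega> (PiD w)"
  shows "L2_norm \<Omega> (HD w) \<le> F * P" and "L2_norm \<Omega> (PiD w) \<le> F * P\<^sup>2"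
proof -
  have wX: "w \<in> X" using w by (rule scheme_D)
  let ?n = "L2_norm \<Omega> (HD w)"
  have "?n * ?n = L2_inner \<Omega> g (PiD w)"
    using scheme_D(2)[OF w wX] by (simp add: aD_self power2_eq_square)
  also have "\<dots> \<le> F * L2_norm \<Omega> (PiD w)" using F(2) by linarith
  also have "\<dots> \<le> F * (P * ?n)" using P(2)[OF wX] F(1) by (intro mult_left_mono)
  finally have le: "?n * ?n \<le> (F * P) * ?n" by (simp add: mult.assoc)
  show 1: "?n \<le> F * P"
  proof (cases "?n = 0")
    case False
    then have "?n > 0" by (simp add: less_le)
    then show ?thesis using le by simp
  qed (use F P in simp)
  have "L2_norm \<Omega> (PiD w) \<le> P * (F * P)"
    using P(2)[OF wX] mult_left_mono[OF 1 P(1)] by linarith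
  then show "L2_norm \<Omega> (PiD w) \<le> F * P\<^sup>2" by (simp add: power2_eq_square mult_ac)
qed

lemma scheme_stable_L2:
  assumes w: "scheme g w" and g: "g \<in> L2 \<Omega>"
  shows "L2_norm \<Omega> (HD w) \<le> L2_norm \<Omega> g * P" and "L2_norm \<Omega> (PiD w) \<le> L2_norm \<Omega> g * P\<^sup>2"
  using scheme_stable[OF w L2_norm_nonneg L2_Cauchy_Schwarz[OF g PiD_L2[OF scheme_D(1)[OF w]]]] by auto

end

lemma ext_zero_L2:
  fixes v :: "'a::euclidean_space \<Rightarrow> real"
  assumes S: "S \<in> sets lebesgue" "T \<in> sets lebesgue" "T \<subseteq> S"
  shows "ext_zero T v \<in> L2 S \<longleftrightarrow> v \<in> L2 T"
    and "L2_inner S (ext_zero T v) g = L2_inner T v g"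
    and "L2_norm S (ext_zero T v) = L2_norm T v"
proof -
  have i: "indicator S x *\<^sub>R ext_zero T v x = indicator T x *\<^sub>R v x" for x
    using S(3) by (auto simp: ext_zero_def indicator_def)
  have i2: "indicator S x *\<^sub>R (norm (ext_zero T v x))\<^sup>2 = indicator T x *\<^sub>R (norm (v x))\<^sup>2" for x
    using S(3) by (auto simp: ext_zero_def indicator_def)
  have i3: "indicat_real S x * (ext_zero T v x * g x) = indicat_real T x * (v x * g x)" for x
    using S(3) by (auto simp: ext_zero_def indicator_def)
  show "ext_zero T v \<in> L2 S \<longleftrightarrow> v \<in> L2 T"
    using S(1,2) i i2 by (simp add: L2_def borel_measurable_lebesgue_on_iff integrable_restrict_space)
  show "L2_inner S (ext_zero T v) g = L2_inner T v g"
    using S(1,2) by (simp add: L2_inner_def integral_restrict_space i3)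
  show "L2_norm S (ext_zero T v) = L2_norm T v"
    using S(1,2) i2 by (simp add: L2_norm_def integral_restrict_space)
qed

text \<open>The chain pM, P0, P1, P2, pD of discrete adjoints changes one ingredient at a time: P0
  sees the exact state, P1 the discrete state for \<open>u\<close>, P2 the one for
  \<open>uc\<close>, pD the one for \<open>uh\<close>. The links cost e1, (e2 + e3) P^2, e4 P^3 and
  P^4 times the control error S. The first three sum to \<open>T\<close>, which in turn bounds S
  through the variational inequality.\<close>

lemma (in hessian_scheme_setting) adjoint_error:
  assumes \<omega>: "\<omega> \<in> sets lebesgue" "\<omega> \<subseteq> \<Omega>" and \<alpha>: "\<alpha> > 0"
    and L: "f \<in> L2 \<Omega>" "yd \<in> L2 \<Omega>" "y \<in> L2 \<Omega>" "yM \<in> L2 \<Omega>" "p \<in> L2 \<Omega>" "pM \<in> L2 \<Omega>"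
    and U: "u \<in> L2 \<omega>" "uc \<in> L2 \<omega>" "uh \<in> L2 \<omega>"
    and yD: "scheme (\<lambda>x. f x + ext_zero \<omega> uh x) yD" and pD: "scheme (\<lambda>x. PiD yD x - yd x) pD"
    and e0: "0 \<le> e2" "0 \<le> e3" "0 \<le> e4" "0 \<le> e5"
    and b1: "\<And>w. scheme (\<lambda>x. y x - yd x) w \<Longrightarrow> L2_norm \<Omega> (\<lambda>x. PiD w x - pM x) \<le> e1"
    and b2: "\<And>w. scheme (\<lambda>x. f x + ext_zero \<omega> u x) w \<Longrightarrow> L2_norm \<Omega> (\<lambda>x. PiD w x - yM x) \<le> e2"
    and b3: "\<And>v. v \<in> X \<Longrightarrow> \<bar>L2_inner \<Omega> (\<lambda>x. y x - yM x) (PiD v)\<bar> \<le> e3 * L2_norm \<Omega> (PiD v)"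
    and b4: "\<And>v. v \<in> X \<Longrightarrow> \<bar>L2_inner \<omega> (\<lambda>x. u x - uc x) (PiD v)\<bar> \<le> e4 * L2_norm \<Omega> (HD v)"
    and b5: "\<bar>L2_inner \<omega> (\<lambda>x. p x - pM x) (\<lambda>x. uh x - uc x)\<bar> \<le> e5 * L2_norm \<omega> (\<lambda>x. uh x - uc x)"
    and vi: "\<alpha> * (L2_norm \<omega> (\<lambda>x. uh x - uc x))\<^sup>2 \<le> L2_inner \<omega> (\<lambda>x. p x - PiD pD x) (\<lambda>x. uh x - uc x)"
  defines "T \<equiv> e1 + (e2 + e3) * P\<^sup>2 + e4 * P ^ 3"
  shows "L2_norm \<Omega> (\<lambda>x. pM x - PiD pD x) \<le> T + P ^ 4 * ((e5 + T) / \<alpha>)"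
proof -
  note ez = ext_zero_L2[OF \<Omega>_sets \<omega>]
  have E: "ext_zero \<omega> u \<in> L2 \<Omega>" "ext_zero \<omega> uc \<in> L2 \<Omega>" "ext_zero \<omega> uh \<in> L2 \<Omega>" using U ez by auto
  have F: "(\<lambda>x. f x + ext_zero \<omega> u x) \<in> L2 \<Omega>" "(\<lambda>x. f x + ext_zero \<omega> uc x) \<in> L2 \<Omega>" "(\<lambda>x. f x + ext_zero \<omega> uh x) \<in> L2 \<Omega>"
    using E L(1) by (auto intro: L2_add)
  obtain Y1 Y2 where Y1: "scheme (\<lambda>x. f x + ext_zero \<omega> u x) Y1" and Y2: "scheme (\<lambda>x. f x + ext_zero \<omega> uc x) Y2"
    using scheme_ex[OF F(1)] scheme_ex[OF F(2)] by blast
  note XX = scheme_D(1)[OF Y1] scheme_D(1)[OF Y2] scheme_D(1)[OF yD]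
  note PY = PiD_L2[OF XX(1)] PiD_L2[OF XX(2)] PiD_L2[OF XX(3)]
  have G: "(\<lambda>x. y x - yd x) \<in> L2 \<Omega>" "(\<lambda>x. PiD Y1 x - yd x) \<in> L2 \<Omega>" "(\<lambda>x. PiD Y2 x - yd x) \<in> L2 \<Omega>" "(\<lambda>x. PiD yD x - yd x) \<in> L2 \<Omega>"
    by (intro L2_diff L PY)+
  obtain P0 P1 P2 where P0: "scheme (\<lambda>x. y x - yd x) P0" and P1: "scheme (\<lambda>x. PiD Y1 x - yd x) P1"
    and P2: "scheme (\<lambda>x. PiD Y2 x - yd x) P2"
    using scheme_ex[OF G(1)] scheme_ex[OF G(2)] scheme_ex[OF G(3)] by blast
  note PX = scheme_D(1)[OF P0] scheme_D(1)[OF P1] scheme_D(1)[OF P2] scheme_D(1)[OF pD]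
  note PP = PiD_L2[OF PX(1)] PiD_L2[OF PX(2)] PiD_L2[OF PX(3)] PiD_L2[OF PX(4)]
  have N: "L2_norm \<Omega> (\<lambda>x. PiD v x - PiD w x) = L2_norm \<Omega> (PiD (v - w))" if "v \<in> X" "w \<in> X" for v w
    using PiD_diff[OF that] by (intro L2_norm_cong_AE[OF \<Omega>_sets, symmetric])
  have n1: "L2_norm \<Omega> (\<lambda>x. PiD P0 x - pM x) \<le> e1" by (rule b1[OF P0])
  \<comment> \<open>Inserting yM splits the source: y - yM is small only when tested with
    reconstructions, PiD Y1 - yM is small in norm.\<close>
  have n2: "L2_norm \<Omega> (PiD (P0 - P1)) \<le> (e2 + e3) * P\<^sup>2"
  proof (rule scheme_stable(2)[OF scheme_diff[OF P0 P1 G(1,2)]])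
    have dX: "P0 - P1 \<in> X" using subspace_diff[OF X] PX by blast
    let ?q = "PiD (P0 - P1)"
    have q: "?q \<in> L2 \<Omega>" by (rule PiD_L2[OF dX])
    have a: "(\<lambda>x. y x - yM x) \<in> L2 \<Omega>" and b: "(\<lambda>x. PiD Y1 x - yM x) \<in> L2 \<Omega>" by (intro L2_diff L PY)+
    have "L2_inner \<Omega> (\<lambda>x. (y x - yd x) - (PiD Y1 x - yd x)) ?q = L2_inner \<Omega> (\<lambda>x. (y x - yM x) - (PiD Y1 x - yM x)) ?q"
      by simp
    also have "\<dots> = L2_inner \<Omega> (\<lambda>x. y x - yM x) ?q - L2_inner \<Omega> (\<lambda>x. PiD Y1 x - yM x) ?q"
      by (rule L2_inner_diff_left[OF a b q])
    finally have eq: "L2_inner \<Omega> (\<lambda>x. (y x - yd x) - (PiD Y1 x - yd x)) ?q = \<dots>" .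
    have "\<bar>L2_inner \<Omega> (\<lambda>x. PiD Y1 x - yM x) ?q\<bar> \<le> L2_norm \<Omega> (\<lambda>x. PiD Y1 x - yM x) * L2_norm \<Omega> ?q"
      by (rule L2_Cauchy_Schwarz[OF b q])
    also have "\<dots> \<le> e2 * L2_norm \<Omega> ?q" using b2[OF Y1] by (intro mult_right_mono) auto
    finally show "\<bar>L2_inner \<Omega> (\<lambda>x. (y x - yd x) - (PiD Y1 x - yd x)) ?q\<bar> \<le> (e2 + e3) * L2_norm \<Omega> ?q"
      using b3[OF dX] unfolding eq by (simp add: algebra_simps)
  qed (use e0 in simp)
  \<comment> \<open>Discrete duality: P1 - P2 is the adjoint with source PiD (Y1 - Y2), so by
    reciprocity |PiD (Y1 - Y2)|^2 is the product of u - uc with PiD (P1 - P2). This gives e4 P for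
    the states, and stability adds P^2.\<close>
  have n3: "L2_norm \<Omega> (PiD (P1 - P2)) \<le> e4 * P ^ 3"
  proof -
    have q: "scheme (PiD (Y1 - Y2)) (P1 - P2)"
      by (rule scheme_cong[OF _ scheme_diff[OF P1 P2 G(2,3)]])
         (use PiD_diff[OF XX(1,2)] in eventually_elim, simp)
    have e: "scheme (ext_zero \<omega> (\<lambda>x. u x - uc x)) (Y1 - Y2)"
      by (rule scheme_cong[OF _ scheme_diff[OF Y1 Y2 F(1,2)]]) (simp add: ext_zero_def left_diff_distrib)
    have qX: "P1 - P2 \<in> X" and eX: "Y1 - Y2 \<in> X" using subspace_diff[OF X] PX XX by auto
    let ?n = "L2_norm \<Omega> (PiD (Y1 - Y2))"
    note st = scheme_stable_L2[OF q PiD_L2[OF eX]]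
    have "?n * ?n = L2_inner \<omega> (\<lambda>x. u x - uc x) (PiD (P1 - P2))"
      using scheme_sym[OF e q] by (simp add: ez L2_inner_self power2_eq_square)
    also have "\<dots> \<le> e4 * L2_norm \<Omega> (HD (P1 - P2))" using b4[OF qX] by linarith
    also have "\<dots> \<le> e4 * (?n * P)" using st(1) e0 by (intro mult_left_mono)
    finally have le: "?n * ?n \<le> (e4 * P) * ?n" by (simp add: mult_ac)
    have "?n \<le> e4 * P"
    proof (cases "?n = 0")
      case False
      then have "?n > 0" by (simp add: less_le)
      then show ?thesis using le by simp
    qed (use e0 P in simp)
    from mult_right_mono[OF this, of "P\<^sup>2"] st(2) show ?thesis
      by (simp add: power2_eq_square power3_eq_cube mult_ac)
  qed
  have n: "L2_norm \<Omega> (\<lambda>x. pM x - PiD P2 x) \<le> T"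
  proof -
    have "L2_norm \<Omega> (\<lambda>x. pM x - PiD P2 x)
        = L2_norm \<Omega> (\<lambda>x. ((PiD P0 x - PiD P1 x) + (PiD P1 x - PiD P2 x)) - (PiD P0 x - pM x))"
      by simp
    also have "\<dots> \<le> L2_norm \<Omega> (\<lambda>x. (PiD P0 x - PiD P1 x) + (PiD P1 x - PiD P2 x)) + L2_norm \<Omega> (\<lambda>x. PiD P0 x - pM x)"
      by (intro L2_norm_diff L2_add L2_diff PP L)
    also have "\<dots> \<le> (L2_norm \<Omega> (\<lambda>x. PiD P0 x - PiD P1 x) + L2_norm \<Omega> (\<lambda>x. PiD P1 x - PiD P2 x)) + L2_norm \<Omega> (\<lambda>x. PiD P0 x - pM x)"
      by (intro add_right_mono L2_norm_triangle L2_diff PP)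
    also have "\<dots> \<le> T"
      using n1 n2 n3 unfolding T_def N[OF PX(1,2)] N[OF PX(2,3)] by linarith
    finally show ?thesis .
  qed
  define S where "S = L2_norm \<omega> (\<lambda>x. uh x - uc x)"
  have duL: "(\<lambda>x. uh x - uc x) \<in> L2 \<omega>" by (rule L2_diff[OF U(3,2)])
  have e': "scheme (ext_zero \<omega> (\<lambda>x. uh x - uc x)) (yD - Y2)"
    by (rule scheme_cong[OF _ scheme_diff[OF yD Y2 F(3,2)]]) (simp add: ext_zero_def left_diff_distrib)
  have q': "scheme (PiD (yD - Y2)) (pD - P2)"
    by (rule scheme_cong[OF _ scheme_diff[OF pD P2 G(4,3)]])
       (use PiD_diff[OF XX(3,2)] in eventually_elim, simp)
  have q'X: "pD - P2 \<in> X" and e'X: "yD - Y2 \<in> X" using subspace_diff[OF X] PX XX by auto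
  have n4: "L2_norm \<Omega> (PiD (pD - P2)) \<le> P ^ 4 * S"
  proof -
    have "L2_norm \<Omega> (PiD (yD - Y2)) \<le> S * P\<^sup>2"
      using scheme_stable_L2(2)[OF e'] duL by (simp add: ez S_def)
    then have "L2_norm \<Omega> (PiD (yD - Y2)) * P\<^sup>2 \<le> (S * P\<^sup>2) * P\<^sup>2" by (rule mult_right_mono) simp
    with scheme_stable_L2(2)[OF q' PiD_L2[OF e'X]] show ?thesis
      by (simp add: power2_eq_square power4_eq_xxxx mult_ac)
  qed
  \<comment> \<open>Reciprocity turns the product into the squared norm of PiD (yD - Y2).\<close>
  have sign: "0 \<le> L2_inner \<omega> (\<lambda>x. PiD pD x - PiD P2 x) (\<lambda>x. uh x - uc x)"
  proof -
    have "L2_inner \<omega> (\<lambda>x. PiD pD x - PiD P2 x) (\<lambda>x. uh x - uc x)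
        = L2_inner \<omega> (\<lambda>x. uh x - uc x) (PiD (pD - P2))"
      by (subst L2_inner_commute, rule L2_inner_cong_AE[OF \<omega>(1)])
         (use AE_lebesgue_on_subset[OF \<Omega>_sets \<omega> PiD_diff[OF PX(4,3)]] in \<open>auto elim: eventually_mono\<close>)
    also have "\<dots> = L2_inner \<Omega> (PiD (yD - Y2)) (PiD (yD - Y2))"
      using scheme_sym[OF e' q'] by (simp add: ez)
    finally show ?thesis by (simp add: L2_inner_self)
  qed
  note sub = L2_subset[OF \<Omega>_sets \<omega>]
  \<comment> \<open>p - PiD pD is split at pM and P2. The last piece enters with a minus sign and is
    dropped by \<open>sign\<close>; the others are linear in S against \<alpha> S^2.\<close>
  have S: "S \<le> (e5 + T) / \<alpha>"
  proof -
    let ?d = "\<lambda>x. uh x - uc x"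
    have a1: "(\<lambda>x. p x - pM x) \<in> L2 \<omega>" "(\<lambda>x. pM x - PiD P2 x) \<in> L2 \<omega>" "(\<lambda>x. PiD pD x - PiD P2 x) \<in> L2 \<omega>"
      by (intro sub L2_diff L PP)+
    have "L2_inner \<omega> (\<lambda>x. p x - PiD pD x) ?d
        = L2_inner \<omega> (\<lambda>x. ((p x - pM x) + (pM x - PiD P2 x)) - (PiD pD x - PiD P2 x)) ?d" by simp
    also have "\<dots> = (L2_inner \<omega> (\<lambda>x. p x - pM x) ?d + L2_inner \<omega> (\<lambda>x. pM x - PiD P2 x) ?d)
        - L2_inner \<omega> (\<lambda>x. PiD pD x - PiD P2 x) ?d"
      by (simp only: L2_inner_diff_left[OF L2_add[OF a1(1,2)] a1(3) duL] L2_inner_add_left[OF a1(1,2) duL])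
    also have "\<dots> \<le> e5 * S + L2_inner \<omega> (\<lambda>x. pM x - PiD P2 x) ?d"
      using b5 sign unfolding S_def by linarith
    also have "L2_inner \<omega> (\<lambda>x. pM x - PiD P2 x) ?d \<le> L2_norm \<omega> (\<lambda>x. pM x - PiD P2 x) * S"
      using L2_Cauchy_Schwarz[OF a1(2) duL] unfolding S_def by linarith
    also have "\<dots> \<le> T * S"
      using L2_norm_subset[OF \<Omega>_sets \<omega> L2_diff[OF L(6) PP(3)]] n
      by (intro mult_right_mono) (auto simp: S_def)
    finally have "\<alpha> * S\<^sup>2 \<le> e5 * S + T * S" using vi by (simp add: S_def)
    then have le: "(\<alpha> * S) * S \<le> (e5 + T) * S" by (simp add: power2_eq_square algebra_simps)
    have S0: "0 \<le> S" by (simp add: S_def)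
    show ?thesis
    proof (cases "S = 0")
      case True
      have "0 \<le> T" using n L2_norm_nonneg order_trans by blast
      then show ?thesis using True \<alpha> e0(4) by simp
    next
      case False
      then have "\<alpha> * S \<le> e5 + T" using le S0 by (simp add: less_le)
      then show ?thesis using \<alpha> by (simp add: field_simps)
    qed
  qed
  have "L2_norm \<Omega> (\<lambda>x. pM x - PiD pD x) = L2_norm \<Omega> (\<lambda>x. (pM x - PiD P2 x) - (PiD pD x - PiD P2 x))" by simp
  also have "\<dots> \<le> L2_norm \<Omega> (\<lambda>x. pM x - PiD P2 x) + L2_norm \<Omega> (\<lambda>x. PiD pD x - PiD P2 x)"
    by (intro L2_norm_diff L2_diff PP L)
  also have "\<dots> \<le> T + P ^ 4 * S" using n n4 N[OF PX(4,3)] by simp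
  also have "\<dots> \<le> T + P ^ 4 * ((e5 + T) / \<alpha>)" using S P by (intro add_left_mono mult_left_mono) auto
  finally show ?thesis .
qed

section \<open>The control problem\<close>

lemma sum4_swap:
  fixes F :: "'a::finite \<Rightarrow> 'a \<Rightarrow> 'a \<Rightarrow> 'a \<Rightarrow> real"
  shows "(\<Sum>i\<in>UNIV. \<Sum>j\<in>UNIV. \<Sum>k\<in>UNIV. \<Sum>l\<in>UNIV. F i j k l)
    = (\<Sum>i\<in>UNIV. \<Sum>j\<in>UNIV. \<Sum>k\<in>UNIV. \<Sum>l\<in>UNIV. F k l i j)"
proof -
  have pair: "(\<Sum>i\<in>UNIV. \<Sum>j\<in>UNIV. G i j) = (\<Sum>p\<in>UNIV. G (fst p) (snd p))" for G :: "'a \<Rightarrow> 'a \<Rightarrow> real"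
    by (simp add: sum.cartesian_product case_prod_beta)
  show ?thesis unfolding pair by (rule sum.swap)
qed

text \<open>Relabelling by a_ijkl = a_klij. The adjoint equation has \<open>p\<close> in the second
  slot, whereas the distributional equation in (A1) needs it in the first.\<close>

lemma aform_commute:
  assumes A: "\<And>i j k l x. x \<in> \<Omega> \<Longrightarrow> A i j k l x = A k l i j x"
  shows "aform \<Omega> A z w = aform \<Omega> A w z"
proof -
  have "(LINT x|lebesgue_on \<Omega>. A i j k l x * weak_deriv \<Omega> [i, j] z x * weak_deriv \<Omega> [k, l] w x)
      = (LINT x|lebesgue_on \<Omega>. A k l i j x * weak_deriv \<Omega> [k, l] w x * weak_deriv \<Omega> [i, j] z x)" for i j k l
    using A by (intro Bochner_Integration.integral_cong) (auto simp: space_restrict_space mult_ac)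
  then show ?thesis unfolding aform_def by (simp only: sum4_swap[of "\<lambda>i j k l. LINT x|lebesgue_on \<Omega>. A k l i j x * weak_deriv \<Omega> [k, l] w x * weak_deriv \<Omega> [i, j] z x"])
qed

text \<open>The weak derivative in the directions \<open>[k, l]\<close> of a test function is its classical
  derivative in the directions \<open>[l, k]\<close>, which suffices because the coefficients are symmetric
  in \<open>k\<close> and \<open>l\<close>.\<close>

lemma solves_pdeI:
  assumes \<Omega>: "open \<Omega>"
    and A: "\<And>i j k l x. x \<in> \<Omega> \<Longrightarrow> A i j k l x = A i j l k x"
    and w: "\<And>\<phi>. \<phi> \<in> H20 \<Omega> \<Longrightarrow> aform \<Omega> A w \<phi> = L2_inner \<Omega> g \<phi>"
  shows "solves_pde \<Omega> A w g"
  unfolding solves_pde_def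
proof
  fix \<phi> assume \<phi>: "\<phi> \<in> test_functions \<Omega>"
  have \<Omega>s: "\<Omega> \<in> sets lebesgue" using \<Omega> by simp
  have "(LINT x|lebesgue_on \<Omega>. A i j k l x * weak_deriv \<Omega> [i, j] w x * weak_deriv \<Omega> [k, l] \<phi> x)
      = (LINT x|lebesgue_on \<Omega>. A i j l k x * weak_deriv \<Omega> [i, j] w x * partials [l, k] \<phi> x)" for i j k l
  proof (rule lebesgue_on_cong_AE(3)[OF \<Omega>s])
    show "AE x in lebesgue_on \<Omega>. A i j k l x * weak_deriv \<Omega> [i, j] w x * weak_deriv \<Omega> [k, l] \<phi> x
        = A i j l k x * weak_deriv \<Omega> [i, j] w x * partials [l, k] \<phi> x"
      using weak_deriv_AE(1)[OF \<Omega> is_weak_deriv_smooth[OF \<Omega> test_functions_smooth[OF \<phi>], of "[k, l]"]]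
        AE_in_lebesgue_on[of \<Omega>]
    proof eventually_elim
      case (elim x)
      then show ?case using A[OF elim(2), of i j k l] by simp
    qed
  qed
  then have "aform \<Omega> A w \<phi> = (\<Sum>i\<in>UNIV. \<Sum>j\<in>UNIV. \<Sum>k\<in>UNIV. \<Sum>l\<in>UNIV.
      LINT x|lebesgue_on \<Omega>. A i j l k x * weak_deriv \<Omega> [i, j] w x * partials [l, k] \<phi> x)"
    by (simp only: aform_def)
  also have "\<dots> = (\<Sum>i\<in>UNIV. \<Sum>j\<in>UNIV. \<Sum>k\<in>UNIV. \<Sum>l\<in>UNIV.
      LINT x|lebesgue_on \<Omega>. A i j k l x * weak_deriv \<Omega> [i, j] w x * partials [k, l] \<phi> x)"
    by (rule sum.cong[OF refl], rule sum.cong[OF refl], rule sum.swap)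
  finally show "(\<Sum>i\<in>UNIV. \<Sum>j\<in>UNIV. \<Sum>k\<in>UNIV. \<Sum>l\<in>UNIV.
        LINT x|lebesgue_on \<Omega>. A i j k l x * weak_deriv \<Omega> [i, j] w x * partials [k, l] \<phi> x)
      = (LINT x|lebesgue_on \<Omega>. g x * \<phi> x)"
    using w[OF test_functions_in_H20[OF \<Omega> \<phi>]] by (simp add: L2_inner_def)
qed

section \<open>The setting: projection formula and cellwise constant comparison control\<close>

locale optimal_control =
  fixes \<Omega> \<omega> :: "(real^'d::finite) set" and B :: "real^'d^'d \<Rightarrow> real^'d^'d" and A :: "'d coeffs"
    and \<M> :: "(real^'d) set set" and \<eta> c0 :: real
    and X :: "'x::real_vector set" and PiD :: "'x \<Rightarrow> real^'d \<Rightarrow> real"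
    and GradD :: "'x \<Rightarrow> real^'d \<Rightarrow> real^'d" and HD :: "'x \<Rightarrow> real^'d \<Rightarrow> real^'d^'d"
    and wM :: "(real^'d \<Rightarrow> real) \<Rightarrow> real^'d \<Rightarrow> real" and \<alpha> a b :: real
    and f yd ud y p u :: "real^'d \<Rightarrow> real" and yD pD :: 'x and uh :: "real^'d \<Rightarrow> real"
  assumes dom: "polytopal_domain \<Omega>" "polytopal_domain \<omega>" "\<omega> \<subseteq> \<Omega>"
    and A: "admissible_coeffs \<Omega> B A"
    and mesh: "polytopal_mesh \<Omega> \<M>" "mesh_regular \<M> \<eta>" "polytopal_mesh \<omega> (cells_in \<M> \<omega>)"
    and pos: "\<eta> > 0" "c0 > 0" "\<alpha> > 0" and ab: "a \<le> b"
    and hd: "hessian_discretisation \<Omega> X PiD GradD HD"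
    and data: "f \<in> L2 \<Omega>" "yd \<in> L2 \<Omega>"
    and cKKT: "continuous_KKT \<Omega> \<omega> A \<alpha> (U_ad \<omega> a b) f yd ud y p u"
    and dKKT: "discrete_KKT \<Omega> \<omega> X PiD HD \<alpha> (U_ad_h \<omega> (U_ad \<omega> a b) (U_h \<M>)) f yd ud yD pD uh"
    and A1: "assumption_A1 \<Omega> A \<M> X PiD HD c0 wM" and A2: "assumption_A2 \<Omega> \<M> X PiD HD c0"
    and A3: "assumption_A3 \<Omega> X PiD HD c0" and A4: "assumption_A4 \<M> \<omega> a b u c0"
    and reg: "y \<in> Hk 4 \<Omega>" "p \<in> Hk 4 \<Omega>" "ud \<in> Hk 2 \<Omega>"
begin

definition h where "h = mesh_size \<M>"
text \<open>(A3) bounds the supremum of a reconstruction by c0 times its discrete Hessian norm; the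
  square root of the measure converts this to L2.\<close>

definition P where "P = c0 * sqrt (measure lebesgue \<Omega>)"
definition g where "g = (\<lambda>x. ud x - (1 / \<alpha>) * p x)"
definition uc where "uc = (\<lambda>x. clip a b (mesh_proj \<M> g x))"
text \<open>Dominates both 1 and 1 / \<alpha>, so that all dependence on \<alpha> is collected in
  powers of \<open>k\<close>.\<close>

definition k where "k = 1 + 1 / \<alpha>"
definition W where "W = broken_W1inf_norm (M1_cells \<M> \<omega> a b u) u"
definition N where "N = W + data_size \<Omega> a b yd ud f y p"

lemma \<Omega>: "open \<Omega>" "bounded \<Omega>" "\<Omega> \<in> lmeasurable" "\<Omega> \<in> sets lebesgue"
  using polytopal_domain_D[OF dom(1)] by auto

lemma \<omega>: "open \<omega>" "bounded \<omega>" "\<omega> \<in> lmeasurable" "\<omega> \<in> sets lebesgue"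
  using polytopal_domain_D[OF dom(2)] by auto

lemmas L2_sub = L2_subset[OF \<Omega>(4) \<omega>(4) dom(3)]
lemmas L2_norm_sub = L2_norm_subset[OF \<Omega>(4) \<omega>(4) dom(3)]

sublocale hessian_scheme_setting \<Omega> X PiD GradD HD P
proof
  show "0 \<le> P" using pos by (simp add: P_def)
  show "L2_norm \<Omega> (PiD v) \<le> P * L2_norm \<Omega> (HD v)" if "v \<in> X" for v
  proof -
    have L: "PiD v \<in> Linf \<Omega>" "Linf_norm \<Omega> (PiD v) \<le> c0 * L2_norm \<Omega> (HD v)"
      using A3 that by (auto simp: assumption_A3_def)
    have "L2_norm \<Omega> (PiD v) \<le> Linf_norm \<Omega> (PiD v) * sqrt (measure lebesgue \<Omega>)"
      using Linf_norm_AE[OF L(1)] by (intro L2_norm_bounded \<Omega>) auto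
    also have "\<dots> \<le> (c0 * L2_norm \<Omega> (HD v)) * sqrt (measure lebesgue \<Omega>)"
      using L(2) by (intro mult_right_mono) auto
    finally show ?thesis by (simp add: P_def mult_ac)
  qed
qed (fact \<Omega> hd)+

lemma Hk2: "y \<in> Hk 2 \<Omega>" "p \<in> Hk 2 \<Omega>" "ud \<in> Hk 2 \<Omega>"
  using reg Hk_mono[of 2 4 \<Omega>] by auto

lemma L2s: "y \<in> L2 \<Omega>" "p \<in> L2 \<Omega>" "ud \<in> L2 \<Omega>" "wM y \<in> L2 \<Omega>" "wM p \<in> L2 \<Omega>"
  using Hk2 A1 by (auto simp: Hk_def assumption_A1_def)

lemma g_L2: "g \<in> L2 \<Omega>"
  unfolding g_def by (intro L2_diff L2_mult L2s)

lemma u_ad: "u \<in> L2 \<omega>" "AE x in lebesgue_on \<omega>. a \<le> u x \<and> u x \<le> b"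
  using cKKT by (auto simp: continuous_KKT_def U_ad_def)

lemma uh_ad: "uh \<in> L2 \<omega>" "AE x in lebesgue_on \<omega>. a \<le> uh x \<and> uh x \<le> b" "uh \<in> U_ad_h \<omega> (U_ad \<omega> a b) (U_h \<M>)"
  using dKKT by (auto simp: discrete_KKT_def U_ad_def U_ad_h_def)

lemma k_ge: "1 \<le> k" "1 / \<alpha> \<le> k"
  using pos by (auto simp: k_def)

lemma clip_L2:
  assumes "v \<in> borel_measurable (lebesgue_on \<omega>)"
  shows "(\<lambda>x. clip a b (v x)) \<in> U_ad \<omega> a b"
proof -
  have "(\<lambda>x. clip a b (v x)) \<in> L2 \<omega>"
  proof (rule L2_bounded[OF \<omega>(3), of _ "\<bar>a\<bar> + \<bar>b\<bar>"])
    show "AE x in lebesgue_on \<omega>. norm (clip a b (v x)) \<le> \<bar>a\<bar> + \<bar>b\<bar>"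
      by (intro AE_I2) (auto simp: clip_def)
  qed (rule measurable_clip[OF assms])
  then show ?thesis using clip_le(1)[OF ab] clip_le(2)[of a b] by (auto simp: U_ad_def)
qed

text \<open>The optimality condition reads (u - g, v - u) \<ge> 0. For v = clip g the projection
  inequality gives the pointwise bound (u - g)(v - u) \<le> -(v - u)^2, so v - u has norm
  zero.\<close>

lemma u_eq: "AE x in lebesgue_on \<omega>. u x = clip a b (g x)"
proof -
  let ?v = "\<lambda>x. clip a b (g x)"
  have gL: "g \<in> L2 \<omega>" by (rule L2_sub[OF g_L2])
  have v: "?v \<in> U_ad \<omega> a b" by (rule clip_L2[OF L2_D(1)[OF gL]])
  then have vL: "?v \<in> L2 \<omega>" by (simp add: U_ad_def)
  have d: "(\<lambda>x. ?v x - u x) \<in> L2 \<omega>" by (rule L2_diff[OF vL u_ad(1)])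
  have ug: "(\<lambda>x. u x - g x) \<in> L2 \<omega>" by (rule L2_diff[OF u_ad(1) gL])
  have "0 \<le> L2_inner \<omega> (\<lambda>x. p x + \<alpha> * (u x - ud x)) (\<lambda>x. ?v x - u x)"
    using cKKT v by (auto simp: continuous_KKT_def)
  also have "(\<lambda>x. p x + \<alpha> * (u x - ud x)) = (\<lambda>x. \<alpha> * (u x - g x))"
    using pos by (auto simp: g_def algebra_simps)
  finally have "0 \<le> L2_inner \<omega> (\<lambda>x. u x - g x) (\<lambda>x. ?v x - u x)"
    using pos by (simp add: L2_inner_mult_left zero_le_mult_iff)
  also have "\<dots> \<le> (LINT x|lebesgue_on \<omega>. - (norm (?v x - u x))\<^sup>2)"
    unfolding L2_inner_def
  proof (rule integral_mono_AE)
    show "integrable (lebesgue_on \<omega>) (\<lambda>x. (u x - g x) \<bullet> (?v x - u x))" by (rule L2_integrable_inner[OF ug d])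
    show "integrable (lebesgue_on \<omega>) (\<lambda>x. - (norm (?v x - u x))\<^sup>2)" using L2_D(2)[OF d] by simp
    show "AE x in lebesgue_on \<omega>. (u x - g x) \<bullet> (?v x - u x) \<le> - (norm (?v x - u x))\<^sup>2"
      using u_ad(2)
    proof eventually_elim
      case (elim x)
      have "(clip a b (g x) - g x) * (u x - clip a b (g x)) \<ge> 0"
        using clip_projection[OF ab, of "u x" "g x"] elim by simp
      then show ?case by (simp add: power2_eq_square algebra_simps)
    qed
  qed
  also have "\<dots> = - (L2_norm \<omega> (\<lambda>x. ?v x - u x))\<^sup>2" by (simp add: L2_norm_square)
  finally have "(L2_norm \<omega> (\<lambda>x. ?v x - u x))\<^sup>2 \<le> 0" by simp
  then have "L2_norm \<omega> (\<lambda>x. ?v x - u x) = 0" by simp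
  then have "AE x in lebesgue_on \<omega>. ?v x - u x = 0" using L2_norm_zero_iff_AE[OF d] by simp
  then show ?thesis by eventually_elim simp
qed

lemma cells: "cells_in \<M> \<omega> \<subseteq> \<M>" "finite (cells_in \<M> \<omega>)" "\<And>K. K \<in> cells_in \<M> \<omega> \<Longrightarrow> K \<subseteq> \<omega>"
  using polytopal_mesh_D(1)[OF mesh(1)] by (auto simp: cells_in_def)

lemma cell:
  assumes "K \<in> \<M>"
  shows "open K" "K \<in> lmeasurable" "K \<in> sets lebesgue" "0 < measure lebesgue K"
  using polytopal_domain_D[OF polytopal_mesh_D(2)[OF mesh(1) assms]] by auto

lemma mesh_proj_cell: "K \<in> \<M> \<Longrightarrow> x \<in> K \<Longrightarrow> mesh_proj \<M> v x = cell_avg K v"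
  by (rule mesh_proj_eq_cell_avg[OF polytopal_mesh_D(1,4)[OF mesh(1)]])

lemma mesh_proj_in_L2: "S \<in> lmeasurable \<Longrightarrow> mesh_proj \<M> v \<in> L2 S"
  using mesh_proj_L2[OF _ polytopal_mesh_D(1)[OF mesh(1)]] cell(3) by blast

lemma integral_cells:
  assumes "integrable (lebesgue_on \<omega>) (F :: real^'d \<Rightarrow> real)"
  shows "(LINT x|lebesgue_on \<omega>. F x) = (\<Sum>K\<in>cells_in \<M> \<omega>. LINT x|lebesgue_on K. F x)"
proof (rule integral_lebesgue_on_partition[OF cells(2) _ _ \<omega>(4) _ _ assms])
  show "K \<in> sets lebesgue" if "K \<in> cells_in \<M> \<omega>" for K using cell(3) cells(1) that by blast
qed (use polytopal_mesh_D[OF mesh(3)] in auto)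

lemma uc_cell: "K \<in> \<M> \<Longrightarrow> x \<in> K \<Longrightarrow> uc x = clip a b (cell_avg K g)"
  by (simp add: uc_def mesh_proj_cell)

lemma uc_ad: "uc \<in> L2 \<omega>" "uc \<in> U_ad_h \<omega> (U_ad \<omega> a b) (U_h \<M>)"
proof -
  have U: "uc \<in> U_ad \<omega> a b"
    unfolding uc_def by (rule clip_L2[OF L2_D(1)[OF mesh_proj_in_L2[OF \<omega>(3)]]])
  then show "uc \<in> L2 \<omega>" by (simp add: U_ad_def)
  have "uc \<in> U_h \<M>"
    unfolding U_h_def
  proof (intro CollectI ballI)
    fix K assume K: "K \<in> \<M>"
    have "AE x in lebesgue_on K. uc x = clip a b (cell_avg K g)"
      using AE_in_lebesgue_on[of K] by eventually_elim (rule uc_cell[OF K])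
    then show "\<exists>c. AE x in lebesgue_on K. uc x = c" ..
  qed
  then show "uc \<in> U_ad_h \<omega> (U_ad \<omega> a b) (U_h \<M>)" using U by (auto simp: U_ad_h_def intro!: bexI[of _ uc])
qed

lemma du_cell:
  assumes K: "K \<in> cells_in \<M> \<omega>"
  shows "\<exists>c. AE x in lebesgue_on K. uh x - uc x = c"
proof -
  have KM: "K \<in> \<M>" and K\<omega>: "K \<subseteq> \<omega>" using K cells by auto
  obtain v where v: "v \<in> U_h \<M>" "AE x in lebesgue_on \<omega>. uh x = v x"
    using uh_ad(3) by (auto simp: U_ad_h_def)
  obtain c where c: "AE x in lebesgue_on K. v x = c" using v(1) KM by (auto simp: U_h_def)
  have "AE x in lebesgue_on K. uh x = v x"
    by (rule AE_lebesgue_on_subset[OF \<omega>(4) cell(3)[OF KM] K\<omega> v(2)])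
  with c have "AE x in lebesgue_on K. uh x - uc x = c - clip a b (cell_avg K g)"
    using AE_in_lebesgue_on[of K] by eventually_elim (simp add: uc_cell[OF KM])
  then show ?thesis ..
qed

text \<open>\<open>uh - uc\<close> is a.e. constant on each cell, so only the cell means of
  \<open>F\<close> are seen. This is what permits the use of the projected estimate in
  (A1)(ii).\<close>

lemma inner_mesh_proj:
  assumes F: "F \<in> L2 \<omega>"
  shows "L2_inner \<omega> F (\<lambda>x. uh x - uc x) = L2_inner \<omega> (mesh_proj \<M> F) (\<lambda>x. uh x - uc x)"
proof -
  let ?d = "\<lambda>x. uh x - uc x"
  have d: "?d \<in> L2 \<omega>" by (rule L2_diff[OF uh_ad(1) uc_ad(1)])
  have "(LINT x|lebesgue_on K. F x * ?d x) = (LINT x|lebesgue_on K. mesh_proj \<M> F x * ?d x)"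
    if K: "K \<in> cells_in \<M> \<omega>" for K
  proof -
    have KM: "K \<in> \<M>" using K cells by auto
    obtain c where c: "AE x in lebesgue_on K. ?d x = c" using du_cell[OF K] by blast
    have "(LINT x|lebesgue_on K. F x * ?d x) = (LINT x|lebesgue_on K. F x * c)"
      by (rule lebesgue_on_cong_AE(3)[OF cell(3)[OF KM]]) (use c in eventually_elim, simp)
    also have "\<dots> = (LINT x|lebesgue_on K. cell_avg K F * c)"
      using integral_cell_avg(1)[OF cell(2,4)[OF KM], of "cell_avg K F * c"]
        integral_cell_avg(2)[OF cell(2,4)[OF KM], of F] by (auto simp del: lebesgue_integral_const simp add: mult_ac)
    also have "\<dots> = (LINT x|lebesgue_on K. mesh_proj \<M> F x * ?d x)"
      by (rule lebesgue_on_cong_AE(3)[OF cell(3)[OF KM]])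
         (use c AE_in_lebesgue_on[of K] in \<open>eventually_elim, simp add: mesh_proj_cell[OF KM]\<close>)
    finally show ?thesis .
  qed
  then show ?thesis
    using integral_cells[OF L2_integrable_mult[OF F d]]
      integral_cells[OF L2_integrable_mult[OF mesh_proj_in_L2[OF \<omega>(3)] d]]
    by (simp add: L2_inner_def)
qed

text \<open>With d = uh - uc one has p - PiD pD = \<alpha> (uc - g) + \<alpha> d - (PiD pD +
  \<alpha> (uh - ud)). Tested with d, the first term is nonnegative by the projection property of
  \<open>uc\<close>, the last one by the discrete inequality tested with \<open>uc\<close>.\<close>

lemma variational_inequality:
  "\<alpha> * (L2_norm \<omega> (\<lambda>x. uh x - uc x))\<^sup>2 \<le> L2_inner \<omega> (\<lambda>x. p x - PiD pD x) (\<lambda>x. uh x - uc x)"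
proof -
  let ?d = "\<lambda>x. uh x - uc x"
  have d: "?d \<in> L2 \<omega>" by (rule L2_diff[OF uh_ad(1) uc_ad(1)])
  have pDX: "pD \<in> X" using dKKT by (simp add: discrete_KKT_def)
  have pL: "p \<in> L2 \<omega>" "ud \<in> L2 \<omega>" "PiD pD \<in> L2 \<omega>" by (intro L2_sub L2s PiD_L2 pDX)+
  have gL: "g \<in> L2 \<omega>" by (rule L2_sub[OF g_L2])
  have mL: "mesh_proj \<M> g \<in> L2 \<omega>" by (rule mesh_proj_in_L2[OF \<omega>(3)])
  \<comment> \<open>\<open>g\<close> may be replaced by its cell means, whose clipping is
    \<open>uc\<close>; then the projection inequality holds pointwise.\<close>
  have 1: "0 \<le> L2_inner \<omega> (\<lambda>x. uc x - g x) ?d"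
  proof -
    have "L2_inner \<omega> (\<lambda>x. uc x - g x) ?d = L2_inner \<omega> (\<lambda>x. uc x - mesh_proj \<M> g x) ?d"
      by (simp add: L2_inner_diff_left[OF uc_ad(1) gL d] L2_inner_diff_left[OF uc_ad(1) mL d] inner_mesh_proj[OF gL])
    also have "0 \<le> \<dots>"
      unfolding L2_inner_def
    proof (rule integral_nonneg_AE)
      show "AE x in lebesgue_on \<omega>. 0 \<le> (uc x - mesh_proj \<M> g x) \<bullet> ?d x"
        using uh_ad(2)
      proof eventually_elim
        case (elim x)
        then show ?case using clip_projection[OF ab, of "uh x" "mesh_proj \<M> g x"] by (simp add: uc_def)
      qed
    qed
    finally show ?thesis .
  qed
  have e: "(\<lambda>x. PiD pD x + \<alpha> * (uh x - ud x)) \<in> L2 \<omega>"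
    by (intro L2_add L2_mult L2_diff pL uh_ad(1))
  have "0 \<le> L2_inner \<omega> (\<lambda>x. PiD pD x + \<alpha> * (uh x - ud x)) (\<lambda>x. uc x - uh x)"
    using dKKT uc_ad(2) by (simp add: discrete_KKT_def)
  also have "\<dots> = - L2_inner \<omega> (\<lambda>x. PiD pD x + \<alpha> * (uh x - ud x)) ?d"
    using L2_inner_mult_left[of \<omega> "-1" ?d "\<lambda>x. PiD pD x + \<alpha> * (uh x - ud x)"]
    by (simp add: L2_inner_commute[of \<omega> "\<lambda>x. PiD pD x + \<alpha> * (uh x - ud x)"])
  finally have 2: "L2_inner \<omega> (\<lambda>x. PiD pD x + \<alpha> * (uh x - ud x)) ?d \<le> 0" by simp
  have ug: "(\<lambda>x. uc x - g x) \<in> L2 \<omega>" by (rule L2_diff[OF uc_ad(1) gL])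
  have "L2_inner \<omega> (\<lambda>x. p x - PiD pD x) ?d
      = L2_inner \<omega> (\<lambda>x. (\<alpha> * (uc x - g x) + \<alpha> * ?d x) - (PiD pD x + \<alpha> * (uh x - ud x))) ?d"
    using pos by (simp add: g_def algebra_simps)
  also have "\<dots> = (\<alpha> * L2_inner \<omega> (\<lambda>x. uc x - g x) ?d + \<alpha> * L2_inner \<omega> ?d ?d)
      - L2_inner \<omega> (\<lambda>x. PiD pD x + \<alpha> * (uh x - ud x)) ?d"
    by (simp only: L2_inner_diff_left[OF L2_add[OF L2_mult[OF ug] L2_mult[OF d]] e d]
        L2_inner_add_left[OF L2_mult[OF ug] L2_mult[OF d] d] L2_inner_mult_left)
  finally have eq: "L2_inner \<omega> (\<lambda>x. p x - PiD pD x) ?d = \<dots>" .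
  have "0 \<le> \<alpha> * L2_inner \<omega> (\<lambda>x. uc x - g x) ?d" using 1 pos by simp
  with 2 show ?thesis unfolding eq L2_inner_self by linarith
qed

end

section \<open>Error bounds for the control problem\<close>

lemma L2_abs:
  fixes f :: "'a::euclidean_space \<Rightarrow> real"
  assumes "f \<in> L2 S"
  shows "(\<lambda>x. \<bar>f x\<bar>) \<in> L2 S" "L2_norm S (\<lambda>x. \<bar>f x\<bar>) = L2_norm S f"
  using assms by (auto simp: L2_def L2_norm_def)

context optimal_control
begin

definition CP :: real where "CP = (\<eta> + 4 * 2 ^ CARD('d)) * (\<eta> + 1) ^ CARD('d)"

lemma h_nonneg: "0 \<le> h"
proof -
  have "\<M> \<noteq> {}"
    using polytopal_mesh_D(6)[OF mesh(1)] open_not_negligible[OF \<Omega>(1)] polytopal_domain_D(3)[OF dom(1)] by auto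
  then obtain K where K: "K \<in> \<M>" by blast
  have "diameter K \<le> h" using star_cell_mesh(2)[OF mesh(1,2) pos(1) K] by (simp add: h_def)
  moreover have "0 \<le> diameter K" by (rule diameter_ge_0) (use polytopal_domain_D(2)[OF polytopal_mesh_D(2)[OF mesh(1) K]] in simp)
  ultimately show ?thesis by simp
qed

lemma M_cells: "M1_cells \<M> \<omega> a b u \<subseteq> cells_in \<M> \<omega>" "M2_cells \<M> \<omega> a b u \<subseteq> cells_in \<M> \<omega>"
  by (auto simp: M1_cells_def M2_cells_def)

lemma M1_finite: "finite (M1_cells \<M> \<omega> a b u)" and M2_finite: "finite (M2_cells \<M> \<omega> a b u)"
  using M_cells cells(2) finite_subset by blast+

lemma N_ge:
  "0 \<le> W" "W \<le> N" "minmod a b \<le> N" "L2_norm \<Omega> f \<le> N" "Hk_norm 2 \<Omega> ud \<le> N"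
  "Hk_norm 4 \<Omega> y \<le> N" "Hk_norm 4 \<Omega> p \<le> N" "Hk_norm 2 \<Omega> y \<le> N" "Hk_norm 2 \<Omega> p \<le> N"
  "Hk_norm 4 \<Omega> y + L2_norm \<Omega> yd \<le> N" "0 \<le> N"
proof -
  show W: "0 \<le> W" unfolding W_def by (rule broken_W1inf_norm_ge(2)[OF M1_finite])
  note nn = minmod_nonneg[of a b] L2_norm_nonneg[of \<Omega> f] L2_norm_nonneg[of \<Omega> yd] Hk_norm_nonneg[of 2 \<Omega> ud]
    Hk_norm_nonneg[of 4 \<Omega> y] Hk_norm_nonneg[of 4 \<Omega> p] W
  show "W \<le> N" "minmod a b \<le> N" "L2_norm \<Omega> f \<le> N" "Hk_norm 2 \<Omega> ud \<le> N"
    and y: "Hk_norm 4 \<Omega> y \<le> N" and p: "Hk_norm 4 \<Omega> p \<le> N"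
    and "Hk_norm 4 \<Omega> y + L2_norm \<Omega> yd \<le> N" "0 \<le> N"
    unfolding N_def data_size_def using nn by linarith+
  show "Hk_norm 2 \<Omega> y \<le> N" "Hk_norm 2 \<Omega> p \<le> N"
    using y p Hk_norm_mono[of 2 4 \<Omega> y] Hk_norm_mono[of 2 4 \<Omega> p] by auto
qed

lemma N_le_kN: "N \<le> k * N"
  using mult_right_mono[OF k_ge(1) N_ge(11)] by simp

text \<open>The place where \<open>minmod a b\<close> enters the data: the projection formula bounds
  |u| by minmod a b + |ud| + |p| / \<alpha>. So the right-hand side of the state equation is
  controlled by \<open>N\<close> at the cost of one factor \<open>k\<close>.\<close>

lemma source_bound: "L2_norm \<Omega> (\<lambda>x. f x + ext_zero \<omega> u x) \<le> (sqrt (measure lebesgue \<Omega>) + 2) * (k * N)"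
proof -
  let ?m = "sqrt (measure lebesgue \<Omega>)"
  let ?q = "\<lambda>x. minmod a b + (\<bar>ud x\<bar> + (1 / \<alpha>) * \<bar>p x\<bar>)"
  note c = L2_const[OF \<Omega>(3), of "minmod a b"] and a1 = L2_abs(1)[OF L2s(3)] and a2 = L2_mult[OF L2_abs(1)[OF L2s(2)], of "1 / \<alpha>"]
  have q: "?q \<in> L2 \<Omega>" by (intro L2_add c a1 a2)
  have ae: "AE x in lebesgue_on \<omega>. norm (u x) \<le> norm (?q x)"
    using u_eq
  proof eventually_elim
    case (elim x)
    have "\<bar>(1 / \<alpha>) * p x\<bar> = (1 / \<alpha>) * \<bar>p x\<bar>" using pos by (simp add: abs_mult)
    then have "\<bar>g x\<bar> \<le> \<bar>ud x\<bar> + (1 / \<alpha>) * \<bar>p x\<bar>" unfolding g_def by linarith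
    then show ?case using elim clip_abs_le[OF ab, of "g x"] by simp
  qed
  have "L2_norm \<omega> u \<le> L2_norm \<omega> ?q" by (rule L2_norm_mono_AE[OF L2_sub[OF q] ae])
  also have "\<dots> \<le> L2_norm \<Omega> ?q" by (rule L2_norm_sub[OF q])
  also have "\<dots> \<le> L2_norm \<Omega> (\<lambda>x. minmod a b) + L2_norm \<Omega> (\<lambda>x. \<bar>ud x\<bar> + (1 / \<alpha>) * \<bar>p x\<bar>)"
    by (rule L2_norm_triangle[OF c L2_add[OF a1 a2]])
  also have "\<dots> \<le> L2_norm \<Omega> (\<lambda>x. minmod a b) + (L2_norm \<Omega> (\<lambda>x. \<bar>ud x\<bar>) + L2_norm \<Omega> (\<lambda>x. (1 / \<alpha>) * \<bar>p x\<bar>))"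
    by (rule add_left_mono[OF L2_norm_triangle[OF a1 a2]])
  also have "L2_norm \<Omega> (\<lambda>x. minmod a b) \<le> minmod a b * ?m"
    by (rule L2_norm_bounded[OF \<Omega>(3) minmod_nonneg]) (simp add: minmod_nonneg)
  also have "minmod a b * ?m \<le> N * ?m" using N_ge(3) by (rule mult_right_mono) simp
  also have "L2_norm \<Omega> (\<lambda>x. \<bar>ud x\<bar>) \<le> N"
    using L2_norm_le_Hk_norm[OF \<Omega>(1) L2s(3), of 2] N_ge(5) L2_abs(2)[OF L2s(3)] by simp
  also have "L2_norm \<Omega> (\<lambda>x. (1 / \<alpha>) * \<bar>p x\<bar>) \<le> (1 / \<alpha>) * N"
  proof -
    have "L2_norm \<Omega> (\<lambda>x. (1 / \<alpha>) * \<bar>p x\<bar>) = (1 / \<alpha>) * L2_norm \<Omega> p"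
      using pos unfolding L2_norm_mult L2_abs(2)[OF L2s(2)] by simp
    also have "\<dots> \<le> (1 / \<alpha>) * N"
      using L2_norm_le_Hk_norm[OF \<Omega>(1) L2s(2), of 4] N_ge(7) pos by (intro mult_left_mono) auto
    finally show ?thesis .
  qed
  finally have un: "L2_norm \<omega> u \<le> N * ?m + (N + (1 / \<alpha>) * N)" by simp
  have e: "ext_zero \<omega> u \<in> L2 \<Omega>" using ext_zero_L2(1)[OF \<Omega>(4) \<omega>(4) dom(3)] u_ad(1) by simp
  have "L2_norm \<Omega> (\<lambda>x. f x + ext_zero \<omega> u x) \<le> L2_norm \<Omega> f + L2_norm \<omega> u"
    using L2_norm_triangle[OF data(1) e] ext_zero_L2(3)[OF \<Omega>(4) \<omega>(4) dom(3)] by simp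
  also have "\<dots> \<le> N + (N * ?m + (N + (1 / \<alpha>) * N))" using un N_ge(4) by linarith
  also have "\<dots> = N * ?m + N + k * N" by (simp add: k_def algebra_simps)
  also have "\<dots> \<le> (k * N) * ?m + k * N + k * N"
    using N_le_kN N_ge(11) by (intro add_mono mult_right_mono) auto
  finally show ?thesis by (simp add: algebra_simps)
qed

lemma A_sym:
  assumes "x \<in> \<Omega>"
  shows "A i j m l x = A i j l m x" "A i j m l x = A m l i j x"
  using A assms unfolding admissible_coeffs_def by blast+

lemma H20s: "y \<in> H20 \<Omega>" "p \<in> H20 \<Omega>"
  using cKKT by (auto simp: continuous_KKT_def)

lemma y_error:
  assumes "scheme (\<lambda>x. f x + ext_zero \<omega> u x) w"
  shows "L2_norm \<Omega> (\<lambda>x. PiD w x - wM y x) \<le> c0 * (sqrt (measure lebesgue \<Omega>) + 2) * (k * h\<^sup>2 * N)"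
proof -
  let ?g = "\<lambda>x. f x + ext_zero \<omega> u x"
  have gL: "?g \<in> L2 \<Omega>"
    using ext_zero_L2(1)[OF \<Omega>(4) \<omega>(4) dom(3)] u_ad(1) by (intro L2_add data) simp
  have "solves_pde \<Omega> A y ?g"
    by (rule solves_pdeI[OF \<Omega>(1) A_sym(1)]) (use cKKT in \<open>auto simp: continuous_KKT_def\<close>)
  then have "L2_norm \<Omega> (\<lambda>x. PiD w x - wM y x) \<le> c0 * h\<^sup>2 * L2_norm \<Omega> ?g"
    using A1 reg(1) H20s(1) gL assms unfolding assumption_A1_def h_def by blast
  also have "\<dots> \<le> c0 * h\<^sup>2 * ((sqrt (measure lebesgue \<Omega>) + 2) * (k * N))"
    using source_bound pos by (intro mult_left_mono) auto
  finally show ?thesis by (simp add: mult_ac)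
qed

lemma p_error:
  assumes "scheme (\<lambda>x. y x - yd x) w"
  shows "L2_norm \<Omega> (\<lambda>x. PiD w x - wM p x) \<le> c0 * (k * h\<^sup>2 * N)"
proof -
  let ?g = "\<lambda>x. y x - yd x"
  have gL: "?g \<in> L2 \<Omega>" by (intro L2_diff data L2s)
  have "solves_pde \<Omega> A p ?g"
  proof (rule solves_pdeI[OF \<Omega>(1) A_sym(1)])
    fix \<phi> assume "\<phi> \<in> H20 \<Omega>"
    then show "aform \<Omega> A p \<phi> = L2_inner \<Omega> ?g \<phi>"
      using cKKT aform_commute[of \<Omega> A p \<phi>, OF A_sym(2)] by (simp add: continuous_KKT_def)
  qed
  then have "L2_norm \<Omega> (\<lambda>x. PiD w x - wM p x) \<le> c0 * h\<^sup>2 * L2_norm \<Omega> ?g"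
    using A1 reg(2) H20s(2) gL assms unfolding assumption_A1_def h_def by blast
  also have "\<dots> \<le> c0 * h\<^sup>2 * (k * N)"
    using L2_norm_diff[OF L2s(1) data(2)] L2_norm_le_Hk_norm[OF \<Omega>(1) L2s(1), of 4] N_ge(10) N_le_kN pos
    by (intro mult_left_mono) auto
  finally show ?thesis by (simp add: mult_ac)
qed

lemma y_consistency:
  assumes "v \<in> X"
  shows "\<bar>L2_inner \<Omega> (\<lambda>x. y x - wM y x) (PiD v)\<bar> \<le> c0 * (k * h\<^sup>2 * N) * L2_norm \<Omega> (PiD v)"
proof -
  have "\<bar>L2_inner \<Omega> (\<lambda>x. y x - wM y x) (PiD v)\<bar> \<le> c0 * h\<^sup>2 * L2_norm \<Omega> (PiD v) * Hk_norm 2 \<Omega> y"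
    using A1 Hk2(1) assms unfolding assumption_A1_def h_def by blast
  also have "\<dots> \<le> c0 * h\<^sup>2 * L2_norm \<Omega> (PiD v) * (k * N)"
    using N_ge(8) N_le_kN pos by (intro mult_left_mono) auto
  finally show ?thesis by (simp add: mult_ac)
qed

text \<open>The norm of p - wM p itself need not be of order h^2; its projection is, and against
  \<open>uh - uc\<close> only the projection counts.\<close>

lemma p_consistency:
  "\<bar>L2_inner \<omega> (\<lambda>x. p x - wM p x) (\<lambda>x. uh x - uc x)\<bar>
    \<le> c0 * (k * h\<^sup>2 * N) * L2_norm \<omega> (\<lambda>x. uh x - uc x)"
proof -
  let ?d = "\<lambda>x. uh x - uc x" and ?e = "\<lambda>x. p x - wM p x"
  have e: "?e \<in> L2 \<omega>" by (intro L2_sub L2_diff L2s)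
  have du: "?d \<in> L2 \<omega>" by (rule L2_diff[OF uh_ad(1) uc_ad(1)])
  have "\<bar>L2_inner \<omega> ?e ?d\<bar> \<le> L2_norm \<omega> (mesh_proj \<M> ?e) * L2_norm \<omega> ?d"
    unfolding inner_mesh_proj[OF e] by (rule L2_Cauchy_Schwarz[OF mesh_proj_in_L2[OF \<omega>(3)] du])
  also have "\<dots> \<le> (c0 * h\<^sup>2 * Hk_norm 2 \<Omega> p) * L2_norm \<omega> ?d"
  proof (rule mult_right_mono)
    have "L2_norm \<omega> (mesh_proj \<M> ?e) \<le> L2_norm \<Omega> (mesh_proj \<M> ?e)"
      by (rule L2_norm_sub[OF mesh_proj_in_L2[OF \<Omega>(3)]])
    also have "\<dots> \<le> c0 * h\<^sup>2 * Hk_norm 2 \<Omega> p"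
      using A1 Hk2(2) unfolding assumption_A1_def h_def by blast
    finally show "L2_norm \<omega> (mesh_proj \<M> ?e) \<le> c0 * h\<^sup>2 * Hk_norm 2 \<Omega> p" .
  qed simp
  also have "\<dots> \<le> (c0 * h\<^sup>2 * (k * N)) * L2_norm \<omega> ?d"
    using N_ge(9) N_le_kN pos by (intro mult_right_mono mult_left_mono) auto
  finally show ?thesis by (simp add: mult_ac)
qed

lemma u_cell:
  assumes K: "K \<in> cells_in \<M> \<omega>"
  shows "K \<in> \<M>" "K \<subseteq> \<omega>" "K \<subseteq> \<Omega>" "u \<in> L2 K" "uc \<in> L2 K" "g \<in> L2 K" "AE x in lebesgue_on K. u x = clip a b (g x)"
    "AE x in lebesgue_on K. uc x = clip a b (cell_avg K g)"
proof -
  show KM: "K \<in> \<M>" and K\<omega>: "K \<subseteq> \<omega>" using K cells by auto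
  show "K \<subseteq> \<Omega>" using K\<omega> dom(3) by blast
  note s = cell(3)[OF KM]
  show "u \<in> L2 K" "uc \<in> L2 K" "g \<in> L2 K"
    using L2_subset[OF \<omega>(4) s K\<omega>] u_ad(1) uc_ad(1) L2_sub[OF g_L2] by auto
  show "AE x in lebesgue_on K. u x = clip a b (g x)"
    by (rule AE_lebesgue_on_subset[OF \<omega>(4) s K\<omega> u_eq])
  show "AE x in lebesgue_on K. uc x = clip a b (cell_avg K g)"
    using AE_in_lebesgue_on[of K] by eventually_elim (rule uc_cell[OF KM])
qed

text \<open>Both controls are compared with one constant \<kappa>: \<open>u\<close> by its Lipschitz
  bound on the cell, \<open>uc\<close> because clipping the mean of \<open>g\<close> stays in any
  interval about \<kappa> that contains clip g = u. Hence the factor 2.\<close>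

lemma control_error_M1:
  assumes K: "K \<in> M1_cells \<M> \<omega> a b u"
  shows "AE x in lebesgue_on K. \<bar>u x - uc x\<bar> \<le> 2 * ((\<eta> + 4) * real CARD('d) * W * h)"
proof -
  have Kc: "K \<in> cells_in \<M> \<omega>" using K M_cells by blast
  note uK = u_cell[OF Kc]
  note cK = cell[OF uK(1)]
  interpret S: star_cell K "centroid K" "inradius K" "diameter K" \<eta>
    by (rule star_cell_mesh(1)[OF mesh(1,2) pos(1) uK(1)])
  have uW: "u \<in> W1inf K" using A4 K by (simp add: assumption_A4_def broken_W1inf_def)
  note wd = W1inf_weak_deriv[OF cK(1) uW]
  obtain \<kappa> where \<kappa>: "AE x in lebesgue_on K. \<bar>u x - \<kappa>\<bar> \<le> (\<eta> + 4) * real CARD('d) * W1inf_norm K u * diameter K"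
    using S.oscillation[OF L2_integrable[OF cK(2) uK(4)] wd(1,3,2)] by blast
  have le: "(\<eta> + 4) * real CARD('d) * W1inf_norm K u * diameter K \<le> (\<eta> + 4) * real CARD('d) * W * h"
    using star_cell_mesh(2)[OF mesh(1,2) pos(1) uK(1)] broken_W1inf_norm_ge(1)[OF M1_finite K, of u] wd(3) pos(1) N_ge(1) S.\<rho>
    unfolding h_def W_def by (intro mult_mono) auto
  have "AE x in lebesgue_on K. \<bar>clip a b (g x) - \<kappa>\<bar> \<le> (\<eta> + 4) * real CARD('d) * W * h"
    using \<kappa> uK(7) by eventually_elim (use le in auto)
  note near = clip_cell_avg_near[OF cK(2,4) L2_integrable[OF cK(2) uK(6)] ab this]
  show ?thesis
    using \<kappa> uK(8) by eventually_elim (use le near in linarith)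
qed

definition G where "G = (\<lambda>i x. weak_deriv \<Omega> [i] ud x - (1 / \<alpha>) * weak_deriv \<Omega> [i] p x)"

lemma G_weak_deriv: "is_weak_deriv \<Omega> [i] g (G i)" "G i \<in> L2 \<Omega>" "L2_norm \<Omega> (G i) \<le> k * N"
proof -
  note wu = Hk_weak_deriv[OF \<Omega>(1) reg(3), of "[i]"] and wp = Hk_weak_deriv[OF \<Omega>(1) reg(2), of "[i]"]
  show "is_weak_deriv \<Omega> [i] g (G i)"
    unfolding g_def G_def by (rule is_weak_deriv_diff_mult[OF \<Omega>(1) wu(1) wp(1)]) auto
  have p: "(\<lambda>x. (1 / \<alpha>) * weak_deriv \<Omega> [i] p x) \<in> L2 \<Omega>" by (rule L2_mult[OF wp(2)]) simp
  show "G i \<in> L2 \<Omega>" unfolding G_def by (rule L2_diff[OF wu(2) p]) simp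
  have "L2_norm \<Omega> (G i) \<le> L2_norm \<Omega> (weak_deriv \<Omega> [i] ud) + L2_norm \<Omega> (\<lambda>x. (1 / \<alpha>) * weak_deriv \<Omega> [i] p x)"
    unfolding G_def by (rule L2_norm_diff[OF wu(2) p]) simp
  also have "L2_norm \<Omega> (\<lambda>x. (1 / \<alpha>) * weak_deriv \<Omega> [i] p x) = (1 / \<alpha>) * L2_norm \<Omega> (weak_deriv \<Omega> [i] p)"
    using pos unfolding L2_norm_mult by simp
  also have "\<dots> \<le> (1 / \<alpha>) * N"
    using L2_norm_weak_deriv_le_Hk_norm[of "[i]" 4 \<Omega> p] N_ge(7) pos by (intro mult_left_mono) auto
  also have "L2_norm \<Omega> (weak_deriv \<Omega> [i] ud) \<le> N"
    using L2_norm_weak_deriv_le_Hk_norm[of "[i]" 2 \<Omega> ud] N_ge(5) by simp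
  finally show "L2_norm \<Omega> (G i) \<le> k * N" by (simp add: k_def algebra_simps)
qed

lemma CP_nonneg: "0 \<le> CP"
  using pos by (simp add: CP_def)

text \<open>If \<open>u\<close> equals a or b on the cell, so does \<open>uc\<close>, and the
  difference vanishes. If the constraints are inactive, u = g and uc is the mean of
  \<open>g\<close>, so the Poincare inequality applies.\<close>

lemma control_error_M2:
  assumes K: "K \<in> M2_cells \<M> \<omega> a b u"
  shows "L2_norm K (\<lambda>x. u x - uc x) \<le> CP * h * (\<Sum>i\<in>UNIV. L2_norm K (G i))"
    and "(LINT x|lebesgue_on K. u x - uc x) = 0"
proof -
  have Kc: "K \<in> cells_in \<M> \<omega>" using K M_cells by blast
  note uK = u_cell[OF Kc]
  note cK = cell[OF uK(1)]
  have gi: "integrable (lebesgue_on K) g" by (rule L2_integrable[OF cK(2) uK(6)])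
  have ci: "integrable (lebesgue_on K) (\<lambda>x. t)" for t :: real by (rule L2_integrable[OF cK(2) L2_const[OF cK(2)]])
  have rhs: "0 \<le> CP * h * (\<Sum>i\<in>UNIV. L2_norm K (G i))"
    using CP_nonneg h_nonneg by (intro mult_nonneg_nonneg sum_nonneg) auto
  let ?Q = "L2_norm K (\<lambda>x. u x - uc x) \<le> CP * h * (\<Sum>i\<in>UNIV. L2_norm K (G i)) \<and>
    (LINT x|lebesgue_on K. u x - uc x) = 0"
  have zero: ?Q if "AE x in lebesgue_on K. u x - uc x = 0"
  proof
    have 0: "L2_norm K (\<lambda>x. u x - uc x) = 0"
      using L2_norm_cong_AE[OF cK(3) that] by (simp add: L2_norm_def)
    show "L2_norm K (\<lambda>x. u x - uc x) \<le> CP * h * (\<Sum>i\<in>UNIV. L2_norm K (G i))"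
      unfolding 0 by (rule rhs)
    show "(LINT x|lebesgue_on K. u x - uc x) = 0"
      using lebesgue_on_cong_AE(3)[OF cK(3) that] by simp
  qed
  \<comment> \<open>\<open>clip_cell_avg_near\<close> with \<delta> = 0: a constant value of clip g
    is kept when the mean of \<open>g\<close> is clipped.\<close>
  have const: "AE x in lebesgue_on K. u x - uc x = 0" if t: "AE x in lebesgue_on K. u x = t" for t
  proof -
    have "AE x in lebesgue_on K. \<bar>clip a b (g x) - t\<bar> \<le> 0"
      using t uK(7) by eventually_elim simp
    from clip_cell_avg_near[OF cK(2,4) gi ab this] have ct: "clip a b (cell_avg K g) = t" by simp
    from t uK(8) show ?thesis by eventually_elim (simp add: ct)
  qed
  have inner: ?Q if t: "AE x in lebesgue_on K. a < u x \<and> u x < b"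
  proof (rule conjI)
    \<comment> \<open>Strict bounds leave the clipping inactive, so \<open>g\<close> lies in [a, b];
      its mean does too and is left unchanged by clipping.\<close>
    have gu: "AE x in lebesgue_on K. u x = g x \<and> a \<le> g x \<and> g x \<le> b"
      using t uK(7) by eventually_elim (auto simp: clip_def min_def max_def split: if_splits)
    have "(LINT x|lebesgue_on K. a) \<le> (LINT x|lebesgue_on K. g x)" "(LINT x|lebesgue_on K. g x) \<le> (LINT x|lebesgue_on K. b)"
      by (rule integral_mono_AE[OF ci gi], use gu in eventually_elim, simp)
        (rule integral_mono_AE[OF gi ci], use gu in eventually_elim, simp)
    then have "a \<le> cell_avg K g" "cell_avg K g \<le> b"
      unfolding integral_cell_avg(1)[OF cK(2,4)] integral_cell_avg(2)[OF cK(2,4), symmetric]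
      using cK(4) by auto
    then have ct: "clip a b (cell_avg K g) = cell_avg K g" by (simp add: clip_def)
    from gu uK(8) have ae: "AE x in lebesgue_on K. u x - uc x = g x - cell_avg K g"
      by eventually_elim (simp add: ct)
    interpret S: star_cell K "centroid K" "inradius K" "diameter K" \<eta>
      by (rule star_cell_mesh(1)[OF mesh(1,2) pos(1) uK(1)])
    obtain \<kappa> where "L2_norm K (\<lambda>x. g x - \<kappa>) \<le> CP * diameter K * (\<Sum>i\<in>UNIV. L2_norm K (G i))"
      using S.poincare[OF uK(6) is_weak_deriv_subset[OF \<Omega>(1) cK(1) uK(3) G_weak_deriv(1)]
          L2_subset[OF \<Omega>(4) cK(3) uK(3) G_weak_deriv(2)]] unfolding CP_def by blast
    moreover have "L2_norm K (\<lambda>x. g x - cell_avg K g) \<le> L2_norm K (\<lambda>x. g x - \<kappa>)"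
      by (rule L2_norm_cell_avg_le[OF cK(2,4) uK(6)])
    moreover have "CP * diameter K * (\<Sum>i\<in>UNIV. L2_norm K (G i)) \<le> CP * h * (\<Sum>i\<in>UNIV. L2_norm K (G i))"
      using star_cell_mesh(2)[OF mesh(1,2) pos(1) uK(1)] CP_nonneg unfolding h_def
      by (intro mult_right_mono mult_left_mono sum_nonneg) auto
    ultimately show "L2_norm K (\<lambda>x. u x - uc x) \<le> CP * h * (\<Sum>i\<in>UNIV. L2_norm K (G i))"
      unfolding L2_norm_cong_AE[OF cK(3) ae] by linarith
    have "(LINT x|lebesgue_on K. u x - uc x) = (LINT x|lebesgue_on K. g x - cell_avg K g)"
      by (rule lebesgue_on_cong_AE(3)[OF cK(3) ae])
    also have "\<dots> = 0"
      unfolding Bochner_Integration.integral_diff[OF gi ci] integral_cell_avg(1)[OF cK(2,4)]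
        integral_cell_avg(2)[OF cK(2,4), symmetric] by simp
    finally show "(LINT x|lebesgue_on K. u x - uc x) = 0" .
  qed
  have "(AE x in lebesgue_on K. u x = a) \<or> (AE x in lebesgue_on K. u x = b) \<or> (AE x in lebesgue_on K. a < u x \<and> u x < b)"
    using K by (simp add: M2_cells_def)
  then have r: ?Q
    using zero const inner by blast
  show "L2_norm K (\<lambda>x. u x - uc x) \<le> CP * h * (\<Sum>i\<in>UNIV. L2_norm K (G i))"
    using r by blast
  show "(LINT x|lebesgue_on K. u x - uc x) = 0" using r by blast
qed

lemma L2_set_cells:
  assumes F: "F \<in> L2 \<omega>" and \<K>: "\<K> \<subseteq> cells_in \<M> \<omega>"
  shows "L2_set (\<lambda>K. L2_norm K (F :: real^'d \<Rightarrow> real)) \<K> \<le> L2_norm \<omega> F"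
proof -
  have "(\<Sum>K\<in>\<K>. (L2_norm K F)\<^sup>2) \<le> (\<Sum>K\<in>cells_in \<M> \<omega>. (L2_norm K F)\<^sup>2)"
    by (rule sum_mono2[OF cells(2) \<K>]) simp
  also have "\<dots> = (L2_norm \<omega> F)\<^sup>2"
    unfolding L2_norm_square by (rule integral_cells[OF L2_D(2)[OF F], symmetric])
  finally have "sqrt (\<Sum>K\<in>\<K>. (L2_norm K F)\<^sup>2) \<le> sqrt ((L2_norm \<omega> F)\<^sup>2)" by (rule real_sqrt_le_mono)
  then show ?thesis by (simp add: L2_set_def)
qed

text \<open>The open disjoint cells lie in the interior of the union of their closures, which is the
  set measured in (A4).\<close>

lemma M1_measure: "(\<Sum>K\<in>M1_cells \<M> \<omega> a b u. measure lebesgue K) \<le> c0 * h"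
proof -
  let ?M1 = "M1_cells \<M> \<omega> a b u"
  have M1: "?M1 \<subseteq> \<M>" using M_cells cells by blast
  have "(\<Sum>K\<in>?M1. measure lebesgue K) = measure lebesgue (\<Union>K\<in>?M1. K)"
  proof (rule measure_finite_Union[OF M1_finite, symmetric])
    show "(\<lambda>K. K) ` ?M1 \<subseteq> sets lebesgue" using cell(3) M1 by auto
    show "disjoint_family_on (\<lambda>K. K) ?M1"
      using polytopal_mesh_D(4)[OF mesh(1)] M1 by (auto simp: disjoint_family_on_def pairwise_def disjnt_def)
    show "emeasure lebesgue K \<noteq> \<infinity>" if "K \<in> ?M1" for K
    proof -
      have "K \<in> lmeasurable" using cell(2)[of K] that M1 by auto
      from fmeasurableD2[OF this] show ?thesis by simp
    qed
  qed
  also have "\<dots> \<le> measure lebesgue (interior (\<Union>K\<in>?M1. closure K))"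
  proof (rule measure_mono_fmeasurable)
    have "open (\<Union>K\<in>?M1. K)" using cell(1) M1 by (intro open_UN ballI) auto
    then show "(\<Union>K\<in>?M1. K) \<subseteq> interior (\<Union>K\<in>?M1. closure K)"
      by (rule interior_maximal[rotated]) (intro UN_mono subset_refl closure_subset)
    show "(\<Union>K\<in>?M1. K) \<in> sets lebesgue" using \<open>open (\<Union>K\<in>?M1. K)\<close> by simp
    have "K \<subseteq> \<omega>" if "K \<in> ?M1" for K using cells(3) M_cells that by blast
    then have "(\<Union>K\<in>?M1. closure K) \<subseteq> closure \<omega>" by (intro UN_least closure_mono)
    then have "interior (\<Union>K\<in>?M1. closure K) \<subseteq> closure \<omega>" by (rule order_trans[OF interior_subset])
    then have "bounded (interior (\<Union>K\<in>?M1. closure K))"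
      by (rule bounded_subset[OF bounded_closure[OF \<omega>(2)]])
    then show "interior (\<Union>K\<in>?M1. closure K) \<in> lmeasurable" by (rule lmeasurable_open[OF _ open_interior])
  qed
  also have "\<dots> \<le> c0 * h" using A4 by (simp add: assumption_A4_def h_def)
  finally show ?thesis .
qed

text \<open>Sum over M_1: oscillation 2 (\<eta> + 4) d W h, times sup bound c0 |HD v|, times total
  measure c0 h. Sum over M_2: Poincare bound CP h times the gradient of \<open>g\<close>, summed
  over d directions, times c0 h |HD v| from (A2). Both are of order h^2.\<close>

lemma control_consistency:
  assumes v: "v \<in> X"
  shows "\<bar>L2_inner \<omega> (\<lambda>x. u x - uc x) (PiD v)\<bar>
    \<le> (2 * (\<eta> + 4) * real CARD('d) * c0\<^sup>2 + CP * real CARD('d) * c0) * (k * h\<^sup>2 * N) * L2_norm \<Omega> (HD v)"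
proof -
  let ?M1 = "M1_cells \<M> \<omega> a b u" and ?M2 = "M2_cells \<M> \<omega> a b u" and ?H = "L2_norm \<Omega> (HD v)"
  let ?I = "\<lambda>K. LINT x|lebesgue_on K. (u x - uc x) * PiD v x"
  have v\<Omega>: "PiD v \<in> L2 \<Omega>" by (rule PiD_L2[OF v])
  have v\<omega>: "PiD v \<in> L2 \<omega>" by (rule L2_sub[OF v\<Omega>])
  have uL: "(\<lambda>x. u x - uc x) \<in> L2 \<omega>" by (rule L2_diff[OF u_ad(1) uc_ad(1)])
  have split: "cells_in \<M> \<omega> = ?M1 \<union> ?M2" "?M1 \<inter> ?M2 = {}"
    by (auto simp: M1_cells_def M2_cells_def)
  have eq: "L2_inner \<omega> (\<lambda>x. u x - uc x) (PiD v) = (\<Sum>K\<in>?M1. ?I K) + (\<Sum>K\<in>?M2. ?I K)"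
    using integral_cells[OF L2_integrable_mult[OF uL v\<omega>]] sum.union_disjoint[OF M1_finite M2_finite split(2)] split(1)
    by (simp add: L2_inner_def)
  have Linf: "PiD v \<in> Linf \<Omega>" "Linf_norm \<Omega> (PiD v) \<le> c0 * ?H"
    using A3 v by (auto simp: assumption_A3_def)
  have W0: "0 \<le> (\<eta> + 4) * real CARD('d) * W * h" using pos N_ge(1) h_nonneg by simp
  have M1: "\<bar>?I K\<bar> \<le> (2 * ((\<eta> + 4) * real CARD('d) * W * h) * (c0 * ?H)) * measure lebesgue K" if K: "K \<in> ?M1" for K
  proof -
    have Kc: "K \<in> cells_in \<M> \<omega>" using K M_cells by blast
    note uK = u_cell[OF Kc]
    note cK = cell[OF uK(1)]
    have "\<bar>?I K\<bar> \<le> (LINT x|lebesgue_on K. \<bar>(u x - uc x) * PiD v x\<bar>)" by (rule integral_abs_bound)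
    also have "\<dots> \<le> (LINT x|lebesgue_on K. 2 * ((\<eta> + 4) * real CARD('d) * W * h) * (c0 * ?H))"
    proof (rule integral_mono_AE')
      show "integrable (lebesgue_on K) (\<lambda>x. 2 * ((\<eta> + 4) * real CARD('d) * W * h) * (c0 * ?H))"
        by (rule L2_integrable[OF cK(2) L2_const[OF cK(2)]])
      show "AE x in lebesgue_on K. \<bar>(u x - uc x) * PiD v x\<bar> \<le> 2 * ((\<eta> + 4) * real CARD('d) * W * h) * (c0 * ?H)"
        using control_error_M1[OF K] AE_lebesgue_on_subset[OF \<Omega>(4) cK(3) uK(3) Linf_norm_AE(1)[OF Linf(1)]]
      proof eventually_elim
        case (elim x)
        then show ?case using Linf(2) W0 unfolding abs_mult by (intro mult_mono) auto
      qed
      show "AE x in lebesgue_on K. 0 \<le> 2 * ((\<eta> + 4) * real CARD('d) * W * h) * (c0 * ?H)"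
        using N_ge(1) h_nonneg pos by (intro AE_I2 mult_nonneg_nonneg) auto
    qed
    also have "\<dots> = (2 * ((\<eta> + 4) * real CARD('d) * W * h) * (c0 * ?H)) * measure lebesgue K"
      by (rule integral_cell_avg(1)[OF cK(2,4)])
    finally show ?thesis .
  qed
  have "\<bar>\<Sum>K\<in>?M1. ?I K\<bar> \<le> (\<Sum>K\<in>?M1. (2 * ((\<eta> + 4) * real CARD('d) * W * h) * (c0 * ?H)) * measure lebesgue K)"
    using M1 by (intro order_trans[OF sum_abs sum_mono])
  also have "\<dots> = (2 * ((\<eta> + 4) * real CARD('d) * W * h) * (c0 * ?H)) * (\<Sum>K\<in>?M1. measure lebesgue K)"
    by (simp add: sum_distrib_left)
  also have "\<dots> \<le> (2 * ((\<eta> + 4) * real CARD('d) * W * h) * (c0 * ?H)) * (c0 * h)"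
    using N_ge(1) h_nonneg pos by (intro mult_left_mono M1_measure mult_nonneg_nonneg) auto
  also have "\<dots> = W * (2 * (\<eta> + 4) * real CARD('d) * c0\<^sup>2 * h\<^sup>2 * ?H)"
    by (simp add: power2_eq_square)
  also have "\<dots> \<le> (k * N) * (2 * (\<eta> + 4) * real CARD('d) * c0\<^sup>2 * h\<^sup>2 * ?H)"
    using N_ge(2) N_le_kN pos by (intro mult_right_mono) auto
  finally have s1: "\<bar>\<Sum>K\<in>?M1. ?I K\<bar> \<le> (k * N) * (2 * (\<eta> + 4) * real CARD('d) * c0\<^sup>2 * h\<^sup>2 * ?H)" .
  \<comment> \<open>On cells of M_2 the difference u - uc has mean zero, so \<open>PiD v\<close> may
    be reduced by its cell mean.\<close>
  define r where "r = (\<lambda>x. PiD v x - mesh_proj \<M> (PiD v) x)"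
  have r\<Omega>: "r \<in> L2 \<Omega>" unfolding r_def by (rule L2_diff[OF v\<Omega> mesh_proj_in_L2[OF \<Omega>(3)]])
  have M2: "\<bar>?I K\<bar> \<le> (CP * h * (\<Sum>i\<in>UNIV. L2_norm K (G i))) * L2_norm K r" if K: "K \<in> ?M2" for K
  proof -
    have Kc: "K \<in> cells_in \<M> \<omega>" using K M_cells by blast
    note uK = u_cell[OF Kc]
    note cK = cell[OF uK(1)]
    have uL: "(\<lambda>x. u x - uc x) \<in> L2 K" by (rule L2_diff[OF uK(4,5)])
    have vK: "PiD v \<in> L2 K" by (rule L2_subset[OF \<Omega>(4) cK(3) uK(3) v\<Omega>])
    have rK: "r \<in> L2 K" by (rule L2_subset[OF \<Omega>(4) cK(3) uK(3) r\<Omega>])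
    have "L2_inner K (\<lambda>x. u x - uc x) r = (LINT x|lebesgue_on K. (u x - uc x) * PiD v x - cell_avg K (PiD v) * (u x - uc x))"
      unfolding L2_inner_def r_def
      by (intro Bochner_Integration.integral_cong)
         (auto simp: space_restrict_space mesh_proj_cell[OF uK(1)] algebra_simps)
    also have "\<dots> = ?I K - cell_avg K (PiD v) * (LINT x|lebesgue_on K. u x - uc x)"
      using L2_integrable_mult[OF uL vK] L2_integrable[OF cK(2) L2_mult[OF uL]]
      by (subst Bochner_Integration.integral_diff) auto
    also have "\<dots> = ?I K" by (simp add: control_error_M2(2)[OF K])
    finally have "\<bar>?I K\<bar> \<le> L2_norm K (\<lambda>x. u x - uc x) * L2_norm K r"
      using L2_Cauchy_Schwarz[OF uL rK] by simp
    also have "\<dots> \<le> (CP * h * (\<Sum>i\<in>UNIV. L2_norm K (G i))) * L2_norm K r"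
      by (rule mult_right_mono[OF control_error_M2(1)[OF K]]) simp
    finally show ?thesis .
  qed
  have "\<bar>\<Sum>K\<in>?M2. ?I K\<bar> \<le> (\<Sum>K\<in>?M2. (CP * h * (\<Sum>i\<in>UNIV. L2_norm K (G i))) * L2_norm K r)"
    using M2 by (intro order_trans[OF sum_abs sum_mono])
  also have "\<dots> = CP * h * (\<Sum>K\<in>?M2. \<Sum>i\<in>UNIV. L2_norm K (G i) * L2_norm K r)"
    by (simp add: sum_distrib_left sum_distrib_right mult.assoc)
  \<comment> \<open>Summing over the cells inside each direction allows a Cauchy-Schwarz inequality
    over the cells, which reassembles global L2 norms.\<close>
  also have "(\<Sum>K\<in>?M2. \<Sum>i\<in>UNIV. L2_norm K (G i) * L2_norm K r) = (\<Sum>i\<in>UNIV. \<Sum>K\<in>?M2. L2_norm K (G i) * L2_norm K r)"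
    by (rule sum.swap)
  also have "CP * h * \<dots> \<le> CP * h * (\<Sum>i\<in>(UNIV::'d set). (k * N) * (c0 * h * ?H))"
  proof (intro mult_left_mono sum_mono)
    fix i :: 'd
    have "(\<Sum>K\<in>?M2. L2_norm K (G i) * L2_norm K r) = (\<Sum>K\<in>?M2. \<bar>L2_norm K (G i)\<bar> * \<bar>L2_norm K r\<bar>)" by simp
    also have "\<dots> \<le> L2_set (\<lambda>K. L2_norm K (G i)) ?M2 * L2_set (\<lambda>K. L2_norm K r) ?M2"
      by (rule L2_set_mult_ineq)
    also have "\<dots> \<le> (k * N) * (c0 * h * ?H)"
    proof (rule mult_mono)
      have "L2_set (\<lambda>K. L2_norm K (G i)) ?M2 \<le> L2_norm \<omega> (G i)"
        by (rule L2_set_cells[OF L2_sub[OF G_weak_deriv(2)] M_cells(2)])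
      also have "\<dots> \<le> L2_norm \<Omega> (G i)" by (rule L2_norm_sub[OF G_weak_deriv(2)])
      also have "\<dots> \<le> k * N" by (rule G_weak_deriv(3))
      finally show "L2_set (\<lambda>K. L2_norm K (G i)) ?M2 \<le> k * N" .
      have "L2_set (\<lambda>K. L2_norm K r) ?M2 \<le> L2_norm \<omega> r"
        by (rule L2_set_cells[OF L2_sub[OF r\<Omega>] M_cells(2)])
      also have "\<dots> \<le> L2_norm \<Omega> r" by (rule L2_norm_sub[OF r\<Omega>])
      also have "\<dots> \<le> c0 * h * ?H" using A2 v by (simp add: assumption_A2_def r_def h_def)
      finally show "L2_set (\<lambda>K. L2_norm K r) ?M2 \<le> c0 * h * ?H" .
      show "0 \<le> k * N" using N_ge(11) N_le_kN by linarith
    qed simp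
    finally show "(\<Sum>K\<in>?M2. L2_norm K (G i) * L2_norm K r) \<le> (k * N) * (c0 * h * ?H)" .
  qed (use CP_nonneg h_nonneg in simp)
  also have "\<dots> = (k * N) * (CP * real CARD('d) * c0 * h\<^sup>2 * ?H)"
    by (simp add: power2_eq_square)
  finally have s2: "\<bar>\<Sum>K\<in>?M2. ?I K\<bar> \<le> (k * N) * (CP * real CARD('d) * c0 * h\<^sup>2 * ?H)" .
  have "\<bar>L2_inner \<omega> (\<lambda>x. u x - uc x) (PiD v)\<bar>
      \<le> (k * N) * (2 * (\<eta> + 4) * real CARD('d) * c0\<^sup>2 * h\<^sup>2 * ?H) + (k * N) * (CP * real CARD('d) * c0 * h\<^sup>2 * ?H)"
    unfolding eq using s1 s2 by linarith
  also have "\<dots> = (2 * (\<eta> + 4) * real CARD('d) * c0\<^sup>2 + CP * real CARD('d) * c0) * (k * h\<^sup>2 * N) * ?H"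
    by (simp add: algebra_simps)
  finally show ?thesis .
qed

text \<open>The quantity \<open>T\<close> of \<open>adjoint_error\<close> with the common factor k
  h^2 N taken out.\<close>

definition T0 where
  "T0 = c0 + (c0 * (sqrt (measure lebesgue \<Omega>) + 2) + c0) * P\<^sup>2 + (2 * (\<eta> + 4) * real CARD('d) * c0\<^sup>2 + CP * real CARD('d) * c0) * P ^ 3"

lemma T0_nonneg: "0 \<le> T0"
  unfolding T0_def using pos CP_nonneg P(1) by (intro add_nonneg_nonneg mult_nonneg_nonneg) auto

text \<open>All five error levels carry one factor \<open>k\<close>; the second one absorbs the
  division by \<alpha> in the bound for the control error.\<close>

lemma adjoint_estimate:
  "L2_norm \<Omega> (\<lambda>x. wM p x - PiD pD x) \<le> (T0 + P ^ 4 * (c0 + T0)) * k\<^sup>2 * (h\<^sup>2 * N)"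
proof -
  let ?H = "k * h\<^sup>2 * N"
  have H0: "0 \<le> ?H" using k_ge(1) N_ge(11) by simp
  have yDX: "yD \<in> X" and pDX: "pD \<in> X" using dKKT by (auto simp: discrete_KKT_def)
  have yD: "scheme (\<lambda>x. f x + ext_zero \<omega> uh x) yD"
    using dKKT by (simp add: discrete_KKT_def hessian_scheme_def)
  have pD: "scheme (\<lambda>x. PiD yD x - yd x) pD"
    using dKKT by (simp add: discrete_KKT_def hessian_scheme_def aD_commute[of pD])
  have "L2_norm \<Omega> (\<lambda>x. wM p x - PiD pD x)
      \<le> (c0 * ?H + (c0 * (sqrt (measure lebesgue \<Omega>) + 2) * ?H + c0 * ?H) * P\<^sup>2
          + ((2 * (\<eta> + 4) * real CARD('d) * c0\<^sup>2 + CP * real CARD('d) * c0) * ?H) * P ^ 3)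
        + P ^ 4 * ((c0 * ?H + (c0 * ?H + (c0 * (sqrt (measure lebesgue \<Omega>) + 2) * ?H + c0 * ?H) * P\<^sup>2
          + ((2 * (\<eta> + 4) * real CARD('d) * c0\<^sup>2 + CP * real CARD('d) * c0) * ?H) * P ^ 3)) / \<alpha>)"
    by (rule adjoint_error[OF \<omega>(4) dom(3) pos(3) data L2s(1,4,2,5) u_ad(1) uc_ad(1) uh_ad(1) yD pD
        _ _ _ _ p_error y_error y_consistency control_consistency p_consistency variational_inequality])
       (use H0 pos CP_nonneg in auto)
  also have "\<dots> = T0 * ?H + P ^ 4 * ((c0 * ?H + T0 * ?H) / \<alpha>)"
    by (simp add: T0_def algebra_simps)
  also have "\<dots> = T0 * ?H + P ^ 4 * (c0 + T0) * (1 / \<alpha>) * ?H"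
    by (simp add: algebra_simps add_divide_distrib)
  also have "\<dots> \<le> T0 * (k * ?H) + P ^ 4 * (c0 + T0) * k * ?H"
  proof (rule add_mono)
    show "T0 * ?H \<le> T0 * (k * ?H)"
      using T0_nonneg mult_right_mono[OF k_ge(1) H0] by (intro mult_left_mono) auto
    show "P ^ 4 * (c0 + T0) * (1 / \<alpha>) * ?H \<le> P ^ 4 * (c0 + T0) * k * ?H"
      using k_ge(2) T0_nonneg pos P(1) H0 by (intro mult_right_mono mult_left_mono) auto
  qed
  also have "\<dots> = (T0 + P ^ 4 * (c0 + T0)) * k\<^sup>2 * (h\<^sup>2 * N)"
    by (simp add: power2_eq_square algebra_simps)
  finally show ?thesis .
qed

text \<open>The projected \<open>ud\<close> is common to both controls and cancels under the
  Lipschitz bound for clipping; the remaining 1 / \<alpha> is the third factor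
  \<open>k\<close>.\<close>

lemma postprocess_estimate:
  "L2_norm \<Omega> (\<lambda>x. postprocess \<M> \<omega> \<alpha> a b ud (wM p) x - postprocess \<M> \<omega> \<alpha> a b ud (PiD pD) x)
    \<le> (T0 + P ^ 4 * (c0 + T0)) * k ^ 3 * (h\<^sup>2 * N)"
proof -
  let ?e = "\<lambda>x. wM p x - PiD pD x"
  have pDX: "pD \<in> X" using dKKT by (simp add: discrete_KKT_def)
  have e: "?e \<in> L2 \<Omega>" by (rule L2_diff[OF L2s(5) PiD_L2[OF pDX]])
  have "L2_norm \<Omega> (\<lambda>x. postprocess \<M> \<omega> \<alpha> a b ud (wM p) x - postprocess \<M> \<omega> \<alpha> a b ud (PiD pD) x)
      \<le> L2_norm \<Omega> (\<lambda>x. (1 / \<alpha>) * ?e x)"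
  proof (rule L2_norm_mono_AE[OF L2_mult[OF e]], rule AE_I2)
    fix x
    let ?s = "mesh_proj \<M> ud x" and ?i = "indicat_real \<omega> x"
    have "\<bar>postprocess \<M> \<omega> \<alpha> a b ud (wM p) x - postprocess \<M> \<omega> \<alpha> a b ud (PiD pD) x\<bar>
        \<le> \<bar>(?s - ?i / \<alpha> * wM p x) - (?s - ?i / \<alpha> * PiD pD x)\<bar>"
      unfolding postprocess_def by (rule clip_lipschitz)
    also have "\<dots> = ?i / \<alpha> * \<bar>?e x\<bar>"
    proof -
      have "(?s - ?i / \<alpha> * wM p x) - (?s - ?i / \<alpha> * PiD pD x) = - (?i / \<alpha> * ?e x)"
        by (simp add: right_diff_distrib)
      then show ?thesis using pos by (simp add: abs_mult)
    qed
    also have "\<dots> \<le> (1 / \<alpha>) * \<bar>?e x\<bar>"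
      using pos by (intro mult_right_mono divide_right_mono) auto
    finally show "norm (postprocess \<M> \<omega> \<alpha> a b ud (wM p) x - postprocess \<M> \<omega> \<alpha> a b ud (PiD pD) x) \<le> norm ((1 / \<alpha>) * ?e x)"
      using pos by (simp add: abs_mult)
  qed
  also have "\<dots> = (1 / \<alpha>) * L2_norm \<Omega> ?e" using pos unfolding L2_norm_mult by simp
  also have "\<dots> \<le> k * ((T0 + P ^ 4 * (c0 + T0)) * k\<^sup>2 * (h\<^sup>2 * N))"
    using k_ge adjoint_estimate by (intro mult_mono) auto
  finally show ?thesis by (simp add: power2_eq_square power3_eq_cube mult_ac)
qed

end

theorem theorem4p6:
  shows "\<exists>C :: real \<Rightarrow> real. (\<forall>\<alpha>>0. C \<alpha> > 0) \<and>
    (\<forall>(\<Omega> :: (real^'d::finite) set) (B :: real^'d^'d \<Rightarrow> real^'d^'d)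
       (\<rho> :: real) (CB :: real) (\<eta> :: real) (c0 :: real).
      polytopal_domain \<Omega> \<and>
      linear B \<and> (\<forall>\<xi>. symmetric_matrix \<xi> \<longrightarrow> symmetric_matrix (B \<xi>)) \<and>
      \<rho> > 0 \<and> coercive B \<Omega> \<rho> \<and> \<eta> > 0 \<and> c0 > 0 \<longrightarrow>
      (\<exists>C'>0. \<forall>(A :: 'd coeffs) (\<omega> :: (real^'d) set) (\<M> :: (real^'d) set set)
           (X :: 'x::real_vector set) (PiD :: 'x \<Rightarrow> real^'d \<Rightarrow> real)
           (GradD :: 'x \<Rightarrow> real^'d \<Rightarrow> real^'d) (HD :: 'x \<Rightarrow> real^'d \<Rightarrow> real^'d^'d)
           (wM :: (real^'d \<Rightarrow> real) \<Rightarrow> real^'d \<Rightarrow> real)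
           (\<alpha> :: real) (a :: real) (b :: real)
           (f :: real^'d \<Rightarrow> real) (yd :: real^'d \<Rightarrow> real) (ud :: real^'d \<Rightarrow> real)
           (y :: real^'d \<Rightarrow> real) (p :: real^'d \<Rightarrow> real) (u :: real^'d \<Rightarrow> real)
           (yD :: 'x) (pD :: 'x) (uh :: real^'d \<Rightarrow> real).
         admissible_coeffs \<Omega> B A \<and>
         polytopal_mesh \<Omega> \<M> \<and> mesh_regular \<M> \<eta> \<and>
         polytopal_domain \<omega> \<and> \<omega> \<subseteq> \<Omega> \<and> polytopal_mesh \<omega> (cells_in \<M> \<omega>) \<and>
         hessian_discretisation \<Omega> X PiD GradD HD \<and> CD \<Omega> X PiD GradD HD \<le> CB \<and>
         \<alpha> > 0 \<and> a \<le> b \<and> f \<in> L2 \<Omega> \<and> yd \<in> L2 \<Omega> \<and>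
         continuous_KKT \<Omega> \<omega> A \<alpha> (U_ad \<omega> a b) f yd ud y p u \<and>
         discrete_KKT \<Omega> \<omega> X PiD HD \<alpha> (U_ad_h \<omega> (U_ad \<omega> a b) (U_h \<M>)) f yd ud yD pD uh \<and>
         assumption_A1 \<Omega> A \<M> X PiD HD c0 wM \<and>
         assumption_A2 \<Omega> \<M> X PiD HD c0 \<and>
         assumption_A3 \<Omega> X PiD HD c0 \<and>
         assumption_A4 \<M> \<omega> a b u c0 \<and>
         y \<in> Hk 4 \<Omega> \<and> p \<in> Hk 4 \<Omega> \<and> ud \<in> Hk 2 \<Omega> \<longrightarrow>
         L2_norm \<Omega> (\<lambda>x. postprocess \<M> \<omega> \<alpha> a b ud (wM p) x
                       - postprocess \<M> \<omega> \<alpha> a b ud (PiD pD) x)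
           \<le> C' * C \<alpha> * (mesh_size \<M>)\<^sup>2 *
             (broken_W1inf_norm (M1_cells \<M> \<omega> a b u) u + data_size \<Omega> a b yd ud f y p)))"
proof (intro exI[of _ "\<lambda>\<alpha>. (1 + 1 / \<alpha>) ^ 3"] conjI allI impI, goal_cases)
  case (1 \<alpha>)
  then show ?case by (simp add: add_pos_pos)
next
  case asm: (2 \<Omega> B \<rho> CB \<eta> c0)
  \<comment> \<open>\<open>P\<close>, \<open>CP\<close> and \<open>T\<close> restate the locale
    constants in terms of \<Omega>, \<eta> and c0 alone, so that C' is fixed before the mesh, the
    discretisation and the data.\<close>
  define P where "P = c0 * sqrt (measure lebesgue \<Omega>)"
  define CP where "CP = (\<eta> + 4 * 2 ^ CARD('d)) * (\<eta> + 1) ^ CARD('d)"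
  define T where "T = c0 + (c0 * (sqrt (measure lebesgue \<Omega>) + 2) + c0) * P\<^sup>2
    + (2 * (\<eta> + 4) * real CARD('d) * c0\<^sup>2 + CP * real CARD('d) * c0) * P ^ 3"
  have "0 \<le> P" "0 \<le> CP" using asm by (auto simp: P_def CP_def)
  then have "0 \<le> T" unfolding T_def using asm by (intro add_nonneg_nonneg mult_nonneg_nonneg) auto
  \<comment> \<open>The summand 1 makes the constant strictly positive from the nonnegativity of
    \<open>P\<close> and \<open>T\<close>.\<close>
  then have C': "0 < T + P ^ 4 * (c0 + T) + 1"
    using asm \<open>0 \<le> P\<close> by (intro add_nonneg_pos add_nonneg_nonneg mult_nonneg_nonneg) auto
  show ?case
  proof (rule exI[of _ "T + P ^ 4 * (c0 + T) + 1"], rule conjI[OF C'], intro allI impI, elim conjE)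
    fix A :: "'d coeffs" and \<omega> :: "(real^'d) set" and \<M> :: "(real^'d) set set"
      and X :: "'x set" and PiD :: "'x \<Rightarrow> real^'d \<Rightarrow> real"
      and GradD :: "'x \<Rightarrow> real^'d \<Rightarrow> real^'d" and HD :: "'x \<Rightarrow> real^'d \<Rightarrow> real^'d^'d"
      and wM :: "(real^'d \<Rightarrow> real) \<Rightarrow> real^'d \<Rightarrow> real" and \<alpha> a b :: real
      and f yd ud y p u :: "real^'d \<Rightarrow> real" and yD pD :: 'x and uh :: "real^'d \<Rightarrow> real"
    assume hyps: "admissible_coeffs \<Omega> B A" "polytopal_mesh \<Omega> \<M>" "mesh_regular \<M> \<eta>"
      "polytopal_domain \<omega>" "\<omega> \<subseteq> \<Omega>" "polytopal_mesh \<omega> (cells_in \<M> \<omega>)"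
      "hessian_discretisation \<Omega> X PiD GradD HD" "\<alpha> > 0" "a \<le> b" "f \<in> L2 \<Omega>" "yd \<in> L2 \<Omega>"
      "continuous_KKT \<Omega> \<omega> A \<alpha> (U_ad \<omega> a b) f yd ud y p u"
      "discrete_KKT \<Omega> \<omega> X PiD HD \<alpha> (U_ad_h \<omega> (U_ad \<omega> a b) (U_h \<M>)) f yd ud yD pD uh"
      "assumption_A1 \<Omega> A \<M> X PiD HD c0 wM" "assumption_A2 \<Omega> \<M> X PiD HD c0"
      "assumption_A3 \<Omega> X PiD HD c0" "assumption_A4 \<M> \<omega> a b u c0"
      "y \<in> Hk 4 \<Omega>" "p \<in> Hk 4 \<Omega>" "ud \<in> Hk 2 \<Omega>"
    interpret oc: optimal_control \<Omega> \<omega> B A \<M> \<eta> c0 X PiD GradD HD wM \<alpha> a b f yd ud y p u yD pD uh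
      by unfold_locales (use asm hyps in auto)
    have T: "oc.T0 = T" "oc.P = P"
      by (simp_all add: oc.T0_def T_def oc.CP_def CP_def oc.P_def P_def)
    have "L2_norm \<Omega> (\<lambda>x. postprocess \<M> \<omega> \<alpha> a b ud (wM p) x - postprocess \<M> \<omega> \<alpha> a b ud (PiD pD) x)
        \<le> (T + P ^ 4 * (c0 + T)) * oc.k ^ 3 * (oc.h\<^sup>2 * oc.N)"
      using oc.postprocess_estimate unfolding T .
    also have "\<dots> \<le> (T + P ^ 4 * (c0 + T) + 1) * oc.k ^ 3 * (oc.h\<^sup>2 * oc.N)"
      using oc.k_ge(1) oc.N_ge(11) by (intro mult_right_mono) auto
    finally show "L2_norm \<Omega> (\<lambda>x. postprocess \<M> \<omega> \<alpha> a b ud (wM p) x - postprocess \<M> \<omega> \<alpha> a b ud (PiD pD) x)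
        \<le> (T + P ^ 4 * (c0 + T) + 1) * (1 + 1 / \<alpha>) ^ 3 * (mesh_size \<M>)\<^sup>2 *
          (broken_W1inf_norm (M1_cells \<M> \<omega> a b u) u + data_size \<Omega> a b yd ud f y p)"
      by (simp add: oc.k_def oc.h_def oc.N_def oc.W_def mult.assoc)
  qed
qed

end
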